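(* Let $\rho$ be a probability measure on the Borel space $\mathcal{M}_\lambda$ and let $V : I\times\mathbb{R}^d\times\mathcal{M}_\lambda \to \mathbb{R}^q$ be a continuous map such that $$\|V\|_{L^2(\rho)}^2 := \int_{\mathcal{M}_\lambda} |V(\cdot,\cdot,\mu)|_\mu^2\,\rho(d\mu) < \infty, \qquad |V(\cdot,\cdot,\mu)|_\mu^2 := \int_{I\times\mathbb{R}^d} |V(u,x,\mu)|^2\,\mu(du,dx).$$ Then, for every $\epsilon>0$, there exist $J,r\in\mathbb{N}^\star$, maps $\varphi_1,\dots,\varphi_J\in \mathcal{C}(I\times\mathbb{R}^d)$, trunk nets $\mathcal{T}_k : I\times\mathbb{R}^d\to\mathbb{R}$, $1\le k\le r$, and branch nets $\mathcal{B}_k : \mathbb{R}^J\to\mathbb{R}^q$, $1\le k\le r$, such that $$\int_{\mathcal{M}_\lambda} \mathbb{E}_{(U,X)\sim\mu}\Big[\Big|V(U,X,\mu) - \sum_{k=1}^r \mathcal{T}_k(U,X)\,\mathcal{B}_k\big(\Phi_J(\mu)\big)\Big|^2\Big]\rho(d\mu) \le \epsilon,$$ where $\Phi_J(\mu) := \big(\langle\varphi_1,\mu\rangle,\dots,\langle\varphi_J,\mu\rangle\big)\in\mathbb{R}^J$.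
   Context: $I=[0,1]$ is the label space, endowed with a fixed reference Borel probability measure $\lambda$ (e.g. the uniform distribution); $d,q\ge 1$ are integers, $\mathbb{N}^\star=\{1,2,\dots\}$. $\mathcal{P}_2(I\times\mathbb{R}^d)$ is the set of Borel probability measures on $I\times\mathbb{R}^d$ with finite second moment, with the 2-Wasserstein distance $\mathcal{W}_2$, and $$\mathcal{M}_\lambda := \{\mu\in\mathcal{P}_2(I\times\mathbb{R}^d) : \mathrm{pr}_1\sharp\mu=\lambda\},$$ where $\mathrm{pr}_1(u,x)=u$ and $\sharp$ denotes push-forward. $\mathcal{M}_\lambda$ carries the topology and Borel $\sigma$-algebra induced by $\mathcal{W}_2$; continuity of $V$ is with respect to the product topology on $I\times\mathbb{R}^d\times\mathcal{M}_\lambda$. $\mathcal{C}(E)$ is the space of continuous functions $E\to\mathbb{R}$. For $\varphi:I\times\mathbb{R}^d\to\mathbb{R}$, $\langle\varphi,\mu\rangle:=\int_{I\times\mathbb{R}^d}\varphi\,d\mu$ (the functions $\varphi_j$ in the claim are such that these integrals are well defined for all $\mu\in\mathcal{M}_\lambda$). $\mathbb{E}_{(U,X)\sim\mu}[\phi(U,X)]:=\int\phi\,d\mu$. "Trunk net" and "branch net" both mean a feedforward neural network, i.e. a finite composition $A_{\ell}\circ\sigma\circ A_{\ell-1}\circ\cdots\circ\sigma\circ A_1$ of affine maps $A_i$ between Euclidean spaces (arbitrary depth and widths, affine output layer) and an activation function $\sigma$ applied componentwise; the activation is $\sigma=\tanh$. The trunk nets are restricted to $I\times\mathbb{R}^d\subset\mathbb{R}^{1+d}$.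 *)

theory Defs
  imports "HOL-Probability.Probability" "Jordan_Normal_Form.Matrix"
begin

section \<open>The label-state space and Wasserstein space\<close>

text \<open>\<open>\<real>\<^sup>d\<close> is \<open>real ^ 'd\<close>; the distance on \<open>real \<times> (real ^ 'd)\<close> is the library's
  (Euclidean) product distance.\<close>

definition label_space :: "real measure" where
  "label_space = restrict_space borel {0..1}"

definition state_set :: "(real \<times> (real ^ 'd)) set" where
  "state_set = {0..1} \<times> UNIV"

definition state_space :: "(real \<times> (real ^ 'd)) measure" where
  "state_space = restrict_space borel state_set"

definition P2 :: "(real \<times> (real ^ 'd)) measure set" where
  "P2 = {\<mu>. sets \<mu> = sets state_space \<and> prob_space \<mu> \<and>
             (\<integral>\<^sup>+ z. ennreal ((norm z)\<^sup>2) \<partial>\<mu>) < \<infinity>}"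

definition couplings ::
  "'a measure \<Rightarrow> 'b measure \<Rightarrow> ('a \<times> 'b) measure set" where
  "couplings \<mu> \<nu> = {\<pi>. sets \<pi> = sets (\<mu> \<Otimes>\<^sub>M \<nu>) \<and> prob_space \<pi> \<and>
                        distr \<pi> \<mu> fst = \<mu> \<and> distr \<pi> \<nu> snd = \<nu>}"

text \<open>The infimum is finite on \<open>P2\<close>, so \<open>enn2real\<close> loses nothing there.\<close>

definition W2 ::
  "'a::metric_space measure \<Rightarrow> 'a measure \<Rightarrow> real" where
  "W2 \<mu> \<nu> =
     sqrt (enn2real (INF \<pi> \<in> couplings \<mu> \<nu>. \<integral>\<^sup>+ (z, w). ennreal ((dist z w)\<^sup>2) \<partial>\<pi>))"

definition Mlam :: "real measure \<Rightarrow> (real \<times> (real ^ 'd)) measure set" where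
  "Mlam lam = {\<mu> \<in> P2. distr \<mu> label_space fst = lam}"

text \<open>The metric topology of \<open>W2\<close> on \<open>Mlam lam\<close>. The library's \<open>Metric_space.mtopology\<close> has
  the same open sets, but its defining equation is available only once \<open>W2\<close> is known to be
  a metric.\<close>

definition W2_topology :: "real measure \<Rightarrow> (real \<times> (real ^ 'd)) measure topology" where
  "W2_topology lam = topology (\<lambda>A. A \<subseteq> Mlam lam \<and>
     (\<forall>\<mu>\<in>A. \<exists>r>0. \<forall>\<nu>\<in>Mlam lam. W2 \<mu> \<nu> < r \<longrightarrow> \<nu> \<in> A))"

lemma openin_W2_topology:
  fixes A :: "(real \<times> (real ^ 'd)) measure set"
  shows "openin (W2_topology lam) A \<longleftrightarrow>
     A \<subseteq> Mlam lam \<and> (\<forall>\<mu>\<in>A. \<exists>r>0. \<forall>\<nu>\<in>Mlam lam. W2 \<mu> \<nu> < r \<longrightarrow> \<nu> \<in> A)"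
proof -
  let ?P = "\<lambda>A :: (real \<times> (real ^ 'd)) measure set. A \<subseteq> Mlam lam \<and> (\<forall>\<mu>\<in>A. \<exists>r>0. \<forall>\<nu>\<in>Mlam lam. W2 \<mu> \<nu> < r \<longrightarrow> \<nu> \<in> A)"
  have "?P (S \<inter> T)" if S: "?P S" and T: "?P T" for S T
  proof (intro conjI ballI)
    show "S \<inter> T \<subseteq> Mlam lam" using S by blast
    fix \<mu> assume "\<mu> \<in> S \<inter> T"
    then obtain r s where "r > 0" "s > 0"
      and "\<forall>\<nu>\<in>Mlam lam. W2 \<mu> \<nu> < r \<longrightarrow> \<nu> \<in> S" "\<forall>\<nu>\<in>Mlam lam. W2 \<mu> \<nu> < s \<longrightarrow> \<nu> \<in> T"
      using S T by (metis IntD1 IntD2)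
    then show "\<exists>r>0. \<forall>\<nu>\<in>Mlam lam. W2 \<mu> \<nu> < r \<longrightarrow> \<nu> \<in> S \<inter> T"
      by (intro exI[of _ "min r s"]) auto
  qed
  moreover have "?P (\<Union>K)" if K: "\<forall>S\<in>K. ?P S" for K
  proof (intro conjI ballI)
    show "\<Union>K \<subseteq> Mlam lam" using K by blast
    fix \<mu> assume "\<mu> \<in> \<Union>K"
    then obtain S where S: "S \<in> K" "\<mu> \<in> S" by blast
    then obtain r where "r > 0" "\<forall>\<nu>\<in>Mlam lam. W2 \<mu> \<nu> < r \<longrightarrow> \<nu> \<in> S"
      using K by meson
    then show "\<exists>r>0. \<forall>\<nu>\<in>Mlam lam. W2 \<mu> \<nu> < r \<longrightarrow> \<nu> \<in> \<Union>K"
      using S by blast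
  qed
  ultimately have "istopology ?P"
    unfolding istopology_def by blast
  then show ?thesis
    by (simp add: W2_topology_def topology_inverse')
qed

lemma topspace_W2_topology:
  "topspace (W2_topology lam :: (real \<times> (real ^ 'd)) measure topology) = Mlam lam"
  (is "topspace ?X = ?M")
proof
  show "topspace ?X \<subseteq> ?M"
    using openin_topspace[of ?X] unfolding openin_W2_topology by blast
  have "openin ?X ?M"
    unfolding openin_W2_topology by (auto intro: exI[of _ "1::real"])
  then show "?M \<subseteq> topspace ?X"
    by (rule openin_subset)
qed

definition Mlam_borel :: "real measure \<Rightarrow> (real \<times> (real ^ 'd)) measure measure" where
  "Mlam_borel lam = sigma (Mlam lam) {A. openin (W2_topology lam) A}"

section \<open>Feedforward tanh networks\<close>

text \<open>\<open>tanh_net n m f\<close>: \<open>f\<close> is a network \<open>\<real>\<^sup>n \<rightarrow> \<real>\<^sup>m\<close>. The dimensions (input dimension of the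
  branch nets, hidden widths) are not fixed in advance, so Euclidean spaces are rendered here
  by the vectors with explicit dimension of \<open>Jordan_Normal_Form\<close>.\<close>

inductive tanh_net ::
  "nat \<Rightarrow> nat \<Rightarrow> (real Matrix.vec \<Rightarrow> real Matrix.vec) \<Rightarrow> bool" where
  affine: "A \<in> carrier_mat m n \<Longrightarrow> b \<in> carrier_vec m \<Longrightarrow> tanh_net n m (\<lambda>v. A *\<^sub>v v + b)"
| layer: "tanh_net n k f \<Longrightarrow> A \<in> carrier_mat m k \<Longrightarrow> b \<in> carrier_vec m \<Longrightarrow>
    tanh_net n m (\<lambda>v. A *\<^sub>v map_vec tanh (f v) + b)"

text \<open>Coordinates along a fixed enumeration of the index type. Which enumeration is used is
  immaterial, since the first and last affine maps of a network absorb permutations.\<close>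

definition coord_vec :: "real ^ 'n \<Rightarrow> real Matrix.vec" where
  "coord_vec x =
     Matrix.vec CARD('n) (\<lambda>i. vec_nth x (from_nat_into (UNIV :: 'n set) i))"

definition trunk_net :: "(real \<times> (real ^ 'd) \<Rightarrow> real) \<Rightarrow> bool" where
  "trunk_net T \<longleftrightarrow> (\<exists>N. tanh_net (1 + CARD('d)) 1 N \<and>
     (\<forall>(u, x) \<in> state_set. T (u, x) = vec_index (N (vCons u (coord_vec x))) 0))"

definition branch_net :: "nat \<Rightarrow> (real Matrix.vec \<Rightarrow> real ^ 'q) \<Rightarrow> bool" where
  "branch_net J B \<longleftrightarrow> (\<exists>N. tanh_net J CARD('q) N \<and>
     (\<forall>y \<in> carrier_vec J. coord_vec (B y) = N y))"

definition moment_vec ::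
  "nat \<Rightarrow> (nat \<Rightarrow> 'a \<Rightarrow> real) \<Rightarrow> 'a measure \<Rightarrow> real Matrix.vec" where
  "moment_vec J \<phi> \<mu> = Matrix.vec J (\<lambda>j. integral\<^sup>L \<mu> (\<phi> j))"

end

theory Submission
  imports Defs
begin

text \<open>The difficulty is that \<open>V\<close> depends on a measure, a point of an infinite-dimensional space on which \<open>\<rho>\<close>
need not have compact support. It is removed by a finite-dimensional projection inside
\<open>Mlam lam\<close> (locale \<open>finite_projection\<close>). Take a fine continuous partition of unity \<open>psi\<close> of the label
interval and one \<open>chi\<close> of a large ball of states, and let the moments of \<open>\<mu>\<close> be the integrals \<open>y\<close> of the
products \<open>eta j\<close>, one for each pair \<open>(p, c)\<close> of centres. From \<open>y\<close> one rebuilds the measure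
\<open>recon y\<close>, the sum of \<open>y j\<close> times \<open>(psi p \<cdot> lam / \<integral> psi p) \<otimes> \<delta>\<^sub>c\<close>: the state is replaced by a centre, but the
label keeps a density with respect to \<open>lam\<close>, and summing over the cells returns exactly \<open>lam\<close> as first
marginal. So \<open>recon y\<close> again lies in \<open>Mlam lam\<close>, where \<open>V\<close> is defined. The obvious coupling, cell by
cell, bounds the distance from \<open>\<mu>\<close> to its reconstruction by the mesh plus the second moment of \<open>\<mu>\<close>
outside the large ball (\<open>W2_recon_moments\<close>), which tends to zero for each fixed \<open>\<mu>\<close>. As \<open>V\<close> is continuous,
\<open>V (z, recon y)\<close> at the moments \<open>y\<close> of \<open>\<mu>\<close> converges to \<open>V (z, \<mu>)\<close> pointwise, and it is a continuous function of \<open>z\<close> and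
of the vector \<open>y\<close>, which ranges over a compact set (\<open>continuous_map_recon\<close>, \<open>compact_admissible\<close>).

What is left is a uniform approximation in finite dimension, but with an unbounded variable \<open>z\<close>.
The first hidden layer of the trunk nets maps \<open>z\<close> to \<open>squash z = (tanh u, tanh x)\<close>, which lives in a bounded set; after
truncating the coordinates of \<open>z\<close> one has a continuous function \<open>G (squash z, y)\<close> on a compact set. The
exponentials of linear forms in \<open>(squash z, y)\<close> span an algebra that separates points, so
Stone-Weierstrass applies, and each exponential splits into a factor depending on \<open>z\<close> and one
depending on \<open>y\<close>, which is the trunk-branch structure. Finally \<open>exp t\<close> is itself a limit of tanh
units, since \<open>exp (2 c) / 2 \<cdot> (tanh (t / 2 - c) + 1) = exp t / (1 + exp (t - 2 c))\<close>. This gives \<open>net_sum_dense\<close>,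
with an error that is uniform in all states, also the unbounded ones.

Square integrability enters only at the end. Clipping \<open>V\<close> to a ball costs little in the \<open>L\<^sup>2\<close> norm, and
for the bounded, continuous, clipped function the pointwise convergence of the networks becomes
convergence in \<open>L\<^sup>2\<close> by dominated convergence. All integrals are taken under the joint law of
\<open>(z, \<mu>)\<close> with \<open>\<mu>\<close> drawn from \<open>\<rho>\<close> and \<open>z\<close> from \<open>\<mu>\<close>; that this law exists, and that \<open>V\<close> is jointly measurable, is
the content of the second section.\<close>

section \<open>Couplings and the Wasserstein distance\<close>

lemma space_state_space [simp]: "space state_space = state_set"
  by (simp add: state_space_def space_restrict_space)

lemma measurable_ident_state_space [measurable]: "(\<lambda>z. z) \<in> borel_measurable state_space"
  unfolding state_space_def by (intro measurable_restrict_space1) simp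

lemma P2_D:
  fixes \<mu> :: "(real \<times> (real ^ 'd)) measure"
  assumes "\<mu> \<in> P2"
  shows "sets \<mu> = sets state_space" "space \<mu> = state_set" "prob_space \<mu>"
    "(\<integral>\<^sup>+ z. ennreal ((norm z)\<^sup>2) \<partial>\<mu>) < \<infinity>"
  using assms sets_eq_imp_space_eq[of \<mu> state_space] by (auto simp: P2_def)

lemma Mlam_subset_P2: "Mlam lam \<subseteq> P2"
  by (auto simp: Mlam_def)

text \<open>All couplings below, and the reconstructed measures, are finite sums of sub-probability measures.
Binding over a counting measure is a convenient form of such a sum: its integrals are
given by the rules for the Giry monad.\<close>

definition mixture :: "'i set \<Rightarrow> ('i \<Rightarrow> 'a measure) \<Rightarrow> 'a measure" where
  "mixture I m = count_space I \<bind> m"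

context
  fixes I :: "'i set" and m :: "'i \<Rightarrow> 'a measure" and B :: "'a measure"
  assumes fin: "finite I" and ne: "I \<noteq> {}"
    and sub: "\<And>i. i \<in> I \<Longrightarrow> subprob_space (m i)"
    and sets_m: "\<And>i. i \<in> I \<Longrightarrow> sets (m i) = sets B"
begin

lemma measurable_mixture_components: "m \<in> measurable (count_space I) (subprob_algebra B)"
  using sub sets_m by (auto simp: measurable_count_space_eq1 space_subprob_algebra)

lemma sets_mixture: "sets (mixture I m) = sets B"
  unfolding mixture_def by (rule sets_bind) (use ne sets_m in auto)

lemma nn_integral_mixture:
  assumes "f \<in> borel_measurable B"
  shows "(\<integral>\<^sup>+ x. f x \<partial>mixture I m) = (\<Sum>i\<in>I. \<integral>\<^sup>+ x. f x \<partial>m i)"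
  unfolding mixture_def
  using fin by (simp add: nn_integral_bind[OF assms measurable_mixture_components] nn_integral_count_space_finite)

lemma emeasure_mixture:
  assumes "E \<in> sets B"
  shows "emeasure (mixture I m) E = (\<Sum>i\<in>I. emeasure (m i) E)"
proof -
  have "emeasure (mixture I m) E = (\<integral>\<^sup>+ x. indicator E x \<partial>mixture I m)"
    using assms by (simp add: sets_mixture)
  also have "\<dots> = (\<Sum>i\<in>I. emeasure (m i) E)"
    using assms by (subst nn_integral_mixture) (auto intro!: sum.cong simp: sets_m)
  finally show ?thesis .
qed

end

lemma measurable_sq_dist [measurable]:
  "(\<lambda>(z, w). ennreal ((dist z w)\<^sup>2)) \<in> borel_measurable (state_space \<Otimes>\<^sub>M (state_space :: (real \<times> (real ^ 'd)) measure))"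
  by measurable

text \<open>Upper bounds on the distance are always obtained from an explicit coupling; only its marginals and its cost have
to be computed, and each of them is a sum over the components.\<close>

lemma W2_le_mixture_coupling:
  fixes \<mu> \<nu> :: "(real \<times> (real ^ 'd)) measure" and m :: "'i \<Rightarrow> _"
  assumes fin: "finite I" and ne: "I \<noteq> {}" and mu: "\<mu> \<in> P2" and nu: "\<nu> \<in> P2"
    and sub: "\<And>i. i \<in> I \<Longrightarrow> subprob_space (m i)"
    and sets_m: "\<And>i. i \<in> I \<Longrightarrow> sets (m i) = sets (state_space \<Otimes>\<^sub>M state_space)"
    and fst: "\<And>E. E \<in> sets state_space \<Longrightarrow> (\<Sum>i\<in>I. emeasure (m i) (E \<times> state_set)) = emeasure \<mu> E"
    and snd: "\<And>E. E \<in> sets state_space \<Longrightarrow> (\<Sum>i\<in>I. emeasure (m i) (state_set \<times> E)) = emeasure \<nu> E"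
    and C: "C \<ge> 0" and cost: "(\<Sum>i\<in>I. \<integral>\<^sup>+ (z, w). ennreal ((dist z w)\<^sup>2) \<partial>m i) \<le> ennreal C"
  shows "W2 \<mu> \<nu> \<le> sqrt C"
proof -
  let ?\<pi> = "mixture I m" and ?B = "state_space \<Otimes>\<^sub>M (state_space :: (real \<times> (real ^ 'd)) measure)"
  note sets_pi = sets_mixture[OF fin ne sub sets_m] and em = emeasure_mixture[OF fin ne sub sets_m]
  note muD = P2_D[OF mu] and nuD = P2_D[OF nu]
  have sets_prod: "sets (\<mu> \<Otimes>\<^sub>M \<nu>) = sets ?B"
    using muD nuD by (intro sets_pair_measure_cong) auto
  have space_pi: "space ?\<pi> = state_set \<times> state_set"
    using sets_eq_imp_space_eq[OF sets_pi] by (simp add: space_pair_measure)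
  have E_top: "state_set \<in> sets (state_space :: (real \<times> (real ^ 'd)) measure)"
    by (metis sets.top space_state_space)
  have "emeasure ?\<pi> (space ?\<pi>) = 1"
    using fst[OF E_top] em[where E = "state_set \<times> state_set"] E_top muD
    by (simp add: space_pi prob_space.emeasure_space_1[OF muD(3), unfolded muD(2)])
  then have prob: "prob_space ?\<pi>" by (rule prob_spaceI)
  have d1: "distr ?\<pi> \<mu> fst = \<mu>"
  proof (rule measure_eqI)
    fix E assume "E \<in> sets (distr ?\<pi> \<mu> fst)"
    then have E: "E \<in> sets state_space" using muD by simp
    have sub: "fst -` E \<inter> space ?\<pi> = E \<times> state_set"
      using sets.sets_into_space[OF E] by (auto simp: space_pi)
    have "emeasure (distr ?\<pi> \<mu> fst) E = emeasure ?\<pi> (E \<times> state_set)"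
      using E sub muD sets_pi by (subst emeasure_distr) (auto simp: measurable_cong_sets[OF sets_pi muD(1)])
    then show "emeasure (distr ?\<pi> \<mu> fst) E = emeasure \<mu> E"
      using fst[OF E] em[where E = "E \<times> state_set"] E E_top by simp
  qed simp
  have d2: "distr ?\<pi> \<nu> snd = \<nu>"
  proof (rule measure_eqI)
    fix E assume "E \<in> sets (distr ?\<pi> \<nu> snd)"
    then have E: "E \<in> sets state_space" using nuD by simp
    have sub: "snd -` E \<inter> space ?\<pi> = state_set \<times> E"
      using sets.sets_into_space[OF E] by (auto simp: space_pi)
    have "emeasure (distr ?\<pi> \<nu> snd) E = emeasure ?\<pi> (state_set \<times> E)"
      using E sub nuD sets_pi by (subst emeasure_distr) (auto simp: measurable_cong_sets[OF sets_pi nuD(1)])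
    then show "emeasure (distr ?\<pi> \<nu> snd) E = emeasure \<nu> E"
      using snd[OF E] em[where E = "state_set \<times> E"] E E_top by simp
  qed simp
  have "?\<pi> \<in> couplings \<mu> \<nu>"
    using sets_pi sets_prod prob d1 d2 by (auto simp: couplings_def)
  then have "(INF \<pi> \<in> couplings \<mu> \<nu>. \<integral>\<^sup>+ (z, w). ennreal ((dist z w)\<^sup>2) \<partial>\<pi>)
      \<le> (\<integral>\<^sup>+ (z, w). ennreal ((dist z w)\<^sup>2) \<partial>?\<pi>)"
    by (rule INF_lower)
  also have "\<dots> \<le> ennreal C"
    using cost nn_integral_mixture[OF fin ne sub sets_m measurable_sq_dist] by simp
  finally have "enn2real (INF \<pi> \<in> couplings \<mu> \<nu>. \<integral>\<^sup>+ (z, w). ennreal ((dist z w)\<^sup>2) \<partial>\<pi>) \<le> C"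
    using C by (intro enn2real_leI) auto
  then show ?thesis unfolding W2_def by (rule real_sqrt_le_mono)
qed

text \<open>The independent coupling has finite cost. This matters because \<open>W2\<close> converts an extended nonnegative number into a
real one, so an infinite cost would be read as distance zero.\<close>

lemma finite_transport_cost:
  fixes \<mu> \<nu> :: "(real \<times> (real ^ 'd)) measure"
  assumes mu: "\<mu> \<in> P2" and nu: "\<nu> \<in> P2"
  shows "(INF \<pi> \<in> couplings \<mu> \<nu>. \<integral>\<^sup>+ (z, w). ennreal ((dist z w)\<^sup>2) \<partial>\<pi>) < \<infinity>"
proof -
  note muD = P2_D[OF mu] and nuD = P2_D[OF nu]
  interpret mu: prob_space \<mu> by (rule muD)
  interpret nu: prob_space \<nu> by (rule nuD)
  interpret pair_prob_space \<mu> \<nu> ..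
  have [measurable_cong]: "sets \<mu> = sets state_space" "sets \<nu> = sets state_space"
    using muD nuD by auto
  have d2: "distr (\<mu> \<Otimes>\<^sub>M \<nu>) \<nu> snd = \<nu>"
  proof (rule measure_eqI)
    fix E assume "E \<in> sets (distr (\<mu> \<Otimes>\<^sub>M \<nu>) \<nu> snd)"
    then have E: "E \<in> sets \<nu>" by simp
    have "snd -` E \<inter> space (\<mu> \<Otimes>\<^sub>M \<nu>) = space \<mu> \<times> E"
      using sets.sets_into_space[OF E] by (auto simp: space_pair_measure)
    then show "emeasure (distr (\<mu> \<Otimes>\<^sub>M \<nu>) \<nu> snd) E = emeasure \<nu> E"
      using E by (simp add: emeasure_distr nu.emeasure_pair_measure_Times mu.emeasure_space_1)
  qed simp
  have "\<mu> \<Otimes>\<^sub>M \<nu> \<in> couplings \<mu> \<nu>"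
    using d2 nu.distr_pair_fst[of \<mu>] by (auto simp: couplings_def intro: prob_space_axioms)
  then have "(INF \<pi> \<in> couplings \<mu> \<nu>. \<integral>\<^sup>+ (z, w). ennreal ((dist z w)\<^sup>2) \<partial>\<pi>)
      \<le> (\<integral>\<^sup>+ (z, w). ennreal ((dist z w)\<^sup>2) \<partial>(\<mu> \<Otimes>\<^sub>M \<nu>))"
    by (rule INF_lower)
  also have "\<dots> \<le> (\<integral>\<^sup>+ p. 2 * ennreal ((norm (fst p))\<^sup>2) + 2 * ennreal ((norm (snd p))\<^sup>2) \<partial>(\<mu> \<Otimes>\<^sub>M \<nu>))"
  proof (rule nn_integral_mono, clarify)
    fix a :: real and b :: "real ^ 'd" and c :: real and d :: "real ^ 'd"
    let ?z = "(a, b)" and ?w = "(c, d)"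
    have "dist ?z ?w \<le> norm ?z + norm ?w" unfolding dist_norm by (rule norm_triangle_ineq4)
    then have "(dist ?z ?w)\<^sup>2 \<le> (norm ?z + norm ?w)\<^sup>2" by (simp add: power_mono)
    also have "\<dots> \<le> 2 * (norm ?z)\<^sup>2 + 2 * (norm ?w)\<^sup>2"
      using sum_squares_bound[of "norm ?z" "norm ?w"] by (simp add: power2_sum)
    finally have "ennreal ((dist ?z ?w)\<^sup>2) \<le> ennreal (2 * (norm ?z)\<^sup>2 + 2 * (norm ?w)\<^sup>2)"
      by (rule ennreal_leI)
    also have "\<dots> = 2 * ennreal ((norm ?z)\<^sup>2) + 2 * ennreal ((norm ?w)\<^sup>2)"
      by (simp add: ennreal_plus ennreal_mult)
    finally show "ennreal ((dist ?z ?w)\<^sup>2)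
        \<le> 2 * ennreal ((norm (fst (?z, ?w)))\<^sup>2) + 2 * ennreal ((norm (snd (?z, ?w)))\<^sup>2)"
      by simp
  qed
  also have "\<dots> = 2 * (\<integral>\<^sup>+ p. ennreal ((norm (fst p))\<^sup>2) \<partial>(\<mu> \<Otimes>\<^sub>M \<nu>)) + 2 * (\<integral>\<^sup>+ p. ennreal ((norm (snd p))\<^sup>2) \<partial>(\<mu> \<Otimes>\<^sub>M \<nu>))"
    by (subst nn_integral_add) (auto simp: nn_integral_cmult)
  also have "(\<integral>\<^sup>+ p. ennreal ((norm (fst p))\<^sup>2) \<partial>(\<mu> \<Otimes>\<^sub>M \<nu>)) = (\<integral>\<^sup>+ z. ennreal ((norm z)\<^sup>2) \<partial>distr (\<mu> \<Otimes>\<^sub>M \<nu>) \<mu> fst)"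
    by (subst nn_integral_distr) auto
  also have "distr (\<mu> \<Otimes>\<^sub>M \<nu>) \<mu> fst = \<mu>" by (rule nu.distr_pair_fst)
  also have "(\<integral>\<^sup>+ p. ennreal ((norm (snd p))\<^sup>2) \<partial>(\<mu> \<Otimes>\<^sub>M \<nu>)) = (\<integral>\<^sup>+ z. ennreal ((norm z)\<^sup>2) \<partial>distr (\<mu> \<Otimes>\<^sub>M \<nu>) \<nu> snd)"
    by (subst nn_integral_distr) auto
  also note d2
  also have "2 * (\<integral>\<^sup>+ z. ennreal ((norm z)\<^sup>2) \<partial>\<mu>) + 2 * (\<integral>\<^sup>+ z. ennreal ((norm z)\<^sup>2) \<partial>\<nu>) < \<infinity>"
    using muD(4) nuD(4) by (simp add: ennreal_mult_less_top)
  finally show ?thesis .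
qed

text \<open>For every coupling the difference of the integrals is the integral of \<open>f z - f w\<close>, hence at most
\<open>L\<close> times the mean distance, and by Cauchy-Schwarz (positivity of the variance) at most \<open>L\<close> times the root
of the cost.\<close>

lemma lipschitz_integral_diff_le_W2:
  fixes \<mu> \<nu> :: "(real \<times> (real ^ 'd)) measure"
  assumes mu: "\<mu> \<in> P2" and nu: "\<nu> \<in> P2"
    and lip: "\<And>z w. \<bar>f z - f w\<bar> \<le> L * dist z w" and bd: "\<And>z. \<bar>f z\<bar> \<le> K"
    and [measurable]: "f \<in> borel_measurable borel" and L: "L > 0"
  shows "\<bar>(\<integral>z. f z \<partial>\<mu>) - (\<integral>z. f z \<partial>\<nu>)\<bar> \<le> L * W2 \<mu> \<nu>"
proof -
  note muD = P2_D[OF mu] and nuD = P2_D[OF nu]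
  define D where "D = \<bar>(\<integral>z. f z \<partial>\<mu>) - (\<integral>z. f z \<partial>\<nu>)\<bar> / L"
  have D0: "D \<ge> 0" using L by (simp add: D_def)
  have "ennreal (D\<^sup>2) \<le> (INF \<pi> \<in> couplings \<mu> \<nu>. \<integral>\<^sup>+ (z, w). ennreal ((dist z w)\<^sup>2) \<partial>\<pi>)"
  proof (rule INF_greatest)
    fix \<pi> assume "\<pi> \<in> couplings \<mu> \<nu>"
    then have s: "sets \<pi> = sets (\<mu> \<Otimes>\<^sub>M \<nu>)" and p: "prob_space \<pi>"
      and d1: "distr \<pi> \<mu> fst = \<mu>" and d2: "distr \<pi> \<nu> snd = \<nu>"
      by (auto simp: couplings_def)
    have [measurable_cong]: "sets \<mu> = sets state_space" "sets \<nu> = sets state_space" "sets \<pi> = sets (\<mu> \<Otimes>\<^sub>M \<nu>)"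
      using muD nuD s by auto
    interpret p: prob_space \<pi> by (rule p)
    show "ennreal (D\<^sup>2) \<le> (\<integral>\<^sup>+ (z, w). ennreal ((dist z w)\<^sup>2) \<partial>\<pi>)"
    \<comment> \<open>Couplings of infinite cost satisfy the bound trivially; the others have integrable distance.\<close>
    proof (cases "(\<integral>\<^sup>+ (z, w). ennreal ((dist z w)\<^sup>2) \<partial>\<pi>) = \<infinity>")
      case False
      let ?d = "\<lambda>q. dist (fst q) (snd q)"
      have nn: "(\<integral>\<^sup>+ (z, w). ennreal ((dist z w)\<^sup>2) \<partial>\<pi>) = (\<integral>\<^sup>+ q. ennreal ((?d q)\<^sup>2) \<partial>\<pi>)"
        by (intro nn_integral_cong) (auto simp: case_prod_unfold)
      have int2: "integrable \<pi> (\<lambda>q. (?d q)\<^sup>2)"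
        using False nn by (intro integrableI_nonneg) (auto simp: less_top)
      have int1: "integrable \<pi> ?d"
        by (rule p.square_integrable_imp_integrable[OF _ int2]) measurable
      have i1: "integrable \<pi> (\<lambda>q. f (fst q))" and i2: "integrable \<pi> (\<lambda>q. f (snd q))"
        using bd by (auto intro!: p.integrable_const_bound[where B = K])
      have "(\<integral>z. f z \<partial>\<mu>) = (\<integral>q. f (fst q) \<partial>\<pi>)"
        by (subst d1[symmetric], subst integral_distr) auto
      moreover have "(\<integral>z. f z \<partial>\<nu>) = (\<integral>q. f (snd q) \<partial>\<pi>)"
        by (subst d2[symmetric], subst integral_distr) auto
      ultimately have "\<bar>(\<integral>z. f z \<partial>\<mu>) - (\<integral>z. f z \<partial>\<nu>)\<bar> = \<bar>\<integral>q. f (fst q) - f (snd q) \<partial>\<pi>\<bar>"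
        using i1 i2 by simp
      also have "\<dots> \<le> (\<integral>q. \<bar>f (fst q) - f (snd q)\<bar> \<partial>\<pi>)"
        by (rule integral_abs_bound)
      also have "\<dots> \<le> (\<integral>q. L * ?d q \<partial>\<pi>)"
        using i1 i2 int1 lip by (intro integral_mono) auto
      finally have "D \<le> (\<integral>q. ?d q \<partial>\<pi>)" using L by (simp add: D_def field_simps)
      then have "D\<^sup>2 \<le> (\<integral>q. ?d q \<partial>\<pi>)\<^sup>2" using D0 by (intro power_mono) auto
      also have "\<dots> \<le> (\<integral>q. (?d q)\<^sup>2 \<partial>\<pi>)"
        using p.variance_positive[of ?d] p.variance_eq[OF int1 int2] by simp
      finally have "ennreal (D\<^sup>2) \<le> ennreal (\<integral>q. (?d q)\<^sup>2 \<partial>\<pi>)" by (rule ennreal_leI)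
      also have "\<dots> = (\<integral>\<^sup>+ q. ennreal ((?d q)\<^sup>2) \<partial>\<pi>)"
        by (rule nn_integral_eq_integral[symmetric]) (use int2 in auto)
      finally show ?thesis using nn by simp
    qed simp
  qed
  then have "D\<^sup>2 \<le> enn2real (INF \<pi> \<in> couplings \<mu> \<nu>. \<integral>\<^sup>+ (z, w). ennreal ((dist z w)\<^sup>2) \<partial>\<pi>)"
    using enn2real_mono[OF _ finite_transport_cost[OF mu nu, unfolded infinity_ennreal_def]] by fastforce
  then have "D \<le> W2 \<mu> \<nu>" unfolding W2_def by (rule real_le_rsqrt)
  then show ?thesis using L by (simp add: D_def field_simps)
qed

section \<open>Measurability on the Wasserstein space\<close>

lemma
  fixes lam :: "real measure"
  defines "M \<equiv> Mlam_borel lam :: (real \<times> (real ^ 'd)) measure measure"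
  shows space_Mlam_borel [simp]: "space M = Mlam lam"
    and sets_Mlam_borel: "sets M = sigma_sets (Mlam lam) {A. openin (W2_topology lam) A}"
proof -
  have "{A :: (real \<times> (real ^ 'd)) measure set. openin (W2_topology lam) A} \<subseteq> Pow (Mlam lam)"
    by (auto simp: openin_W2_topology)
  then show "space M = Mlam lam" "sets M = sigma_sets (Mlam lam) {A. openin (W2_topology lam) A}"
    by (simp_all add: Mlam_borel_def M_def)
qed

lemma continuous_map_W2_measurable:
  fixes f :: "(real \<times> (real ^ 'd)) measure \<Rightarrow> 'b :: topological_space"
  assumes "continuous_map (W2_topology lam) euclidean f"
  shows "f \<in> borel_measurable (Mlam_borel lam)"
proof (rule borel_measurableI)
  fix S :: "'b set" assume "open S"
  then have "openin (W2_topology lam) {\<mu> \<in> Mlam lam. f \<mu> \<in> S}"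
    using openin_continuous_map_preimage[OF assms, of S] by (simp add: topspace_W2_topology)
  moreover have "f -` S \<inter> space (Mlam_borel lam) = {\<mu> \<in> Mlam lam. f \<mu> \<in> S}" by auto
  ultimately show "f -` S \<inter> space (Mlam_borel lam) \<in> sets (Mlam_borel lam)"
    by (simp add: sets_Mlam_borel)
qed

lemma continuous_map_lipschitz_integral:
  fixes f :: "real \<times> (real ^ 'd) \<Rightarrow> real"
  assumes "\<And>z w. \<bar>f z - f w\<bar> \<le> L * dist z w" and "\<And>z. \<bar>f z\<bar> \<le> K"
    and "f \<in> borel_measurable borel" and L: "L > 0"
  shows "continuous_map (W2_topology lam) euclidean (\<lambda>\<mu>. \<integral>z. f z \<partial>\<mu>)"
  unfolding continuous_map_def
proof (intro conjI allI impI)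
  fix U :: "real set" assume U: "openin euclidean U"
  show "openin (W2_topology lam) {\<mu> \<in> topspace (W2_topology lam). (\<integral>z. f z \<partial>\<mu>) \<in> U}"
    unfolding openin_W2_topology topspace_W2_topology
  proof (intro conjI ballI)
    fix \<mu> :: "(real \<times> (real ^ 'd)) measure" assume mu: "\<mu> \<in> {\<mu> \<in> Mlam lam. (\<integral>z. f z \<partial>\<mu>) \<in> U}"
    then obtain e where e: "e > 0" "\<And>x. dist x (\<integral>z. f z \<partial>\<mu>) < e \<Longrightarrow> x \<in> U"
      using U by (auto simp: open_dist)
    have "(\<integral>z. f z \<partial>\<nu>) \<in> U" if nu: "\<nu> \<in> Mlam lam" "W2 \<mu> \<nu> < e / L" for \<nu>
    proof (rule e(2))
      have "\<bar>(\<integral>z. f z \<partial>\<mu>) - (\<integral>z. f z \<partial>\<nu>)\<bar> \<le> L * W2 \<mu> \<nu>"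
        using mu nu Mlam_subset_P2 by (intro lipschitz_integral_diff_le_W2[where K = K] assms) auto
      also have "\<dots> < e" using nu(2) L by (simp add: field_simps)
      finally show "dist (\<integral>z. f z \<partial>\<nu>) (\<integral>z. f z \<partial>\<mu>) < e" by (simp add: dist_real_def abs_minus_commute)
    qed
    then show "\<exists>r>0. \<forall>\<nu>\<in>Mlam lam. W2 \<mu> \<nu> < r \<longrightarrow> \<nu> \<in> {\<mu> \<in> Mlam lam. (\<integral>z. f z \<partial>\<mu>) \<in> U}"
      using e(1) L by (intro exI[of _ "e / L"]) auto
  qed auto
qed auto

lemma state_set_borel [measurable]: "state_set \<in> sets (borel :: (real \<times> (real ^ 'd)) measure)"
  unfolding state_set_def by (intro borel_closed closed_Times) auto

text \<open>The indicator of an open set is the pointwise limit of the Lipschitz functions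
\<open>min 1 (n \<cdot> infdist z (- U))\<close>, whose integrals are continuous in the measure. The whole space is treated
separately because the distance to the empty set is zero by convention.\<close>

lemma measurable_emeasure_open:
  fixes U :: "(real \<times> (real ^ 'd)) set"
  assumes U: "open U"
  shows "(\<lambda>\<mu>. emeasure \<mu> (state_set \<inter> U)) \<in> borel_measurable (Mlam_borel lam)"
proof (cases "U = UNIV")
  case True
  have "emeasure \<mu> (state_set \<inter> U) = 1" if "\<mu> \<in> space (Mlam_borel lam)" for \<mu>
  proof -
    have "\<mu> \<in> P2" using that Mlam_subset_P2 by auto
    from P2_D(2)[OF this] prob_space.emeasure_space_1[OF P2_D(3)[OF this]]
    show ?thesis using True by simp
  qed
  then show ?thesis by (subst measurable_cong[where g = "\<lambda>_. 1"]) auto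
next
  case False
  define f where "f n z = min 1 (real (Suc n) * infdist z (- U))" for n z
  have ne: "- U \<noteq> {}" using False by auto
  have cont: "continuous_on UNIV (f n)" for n
    unfolding f_def by (intro continuous_intros)
  have meas: "f n \<in> borel_measurable borel" for n
    by (rule borel_measurable_continuous_onI[OF cont])
  have bd: "\<bar>f n z\<bar> \<le> 1" for n z
    using infdist_nonneg[of z "- U"] by (auto simp: f_def abs_le_iff min_def intro: order_trans[of _ 0])
  have lip: "\<bar>f n z - f n w\<bar> \<le> real (Suc n) * dist z w" for n z w
  proof -
    have "\<bar>f n z - f n w\<bar> \<le> \<bar>real (Suc n) * infdist z (- U) - real (Suc n) * infdist w (- U)\<bar>"
    proof -
      have "\<bar>min 1 a - min 1 b\<bar> \<le> \<bar>a - b\<bar>" for a b :: real by linarith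
      then show ?thesis unfolding f_def .
    qed
    also have "\<dots> = real (Suc n) * \<bar>infdist z (- U) - infdist w (- U)\<bar>"
      by (simp add: abs_mult right_diff_distrib[symmetric] del: of_nat_Suc)
    also have "\<dots> \<le> real (Suc n) * dist z w"
      by (intro mult_left_mono infdist_triangle_abs) auto
    finally show ?thesis .
  qed
  have lim: "(\<lambda>n. f n z) \<longlonglongrightarrow> indicator U z" for z
  proof (cases "z \<in> U")
    case True
    then have pos: "infdist z (- U) > 0"
      using U ne by (intro infdist_pos_not_in_closed) auto
    obtain N :: nat where N: "1 / infdist z (- U) < real N" using reals_Archimedean2 by blast
    have "f n z = 1" if "n \<ge> N" for n
    proof -
      have "1 < real N * infdist z (- U)" using N pos by (simp add: field_simps)
      also have "\<dots> \<le> real (Suc n) * infdist z (- U)" using that pos by (intro mult_right_mono) auto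
      finally show ?thesis by (simp add: f_def)
    qed
    then have "eventually (\<lambda>n. f n z = 1) sequentially" by (auto simp: eventually_sequentially)
    then show ?thesis using True by (simp add: tendsto_eventually)
  qed (simp add: f_def)
  have "(\<lambda>\<mu>. measure \<mu> (state_set \<inter> U)) \<in> borel_measurable (Mlam_borel lam)"
  proof (rule borel_measurable_LIMSEQ_real)
    show "(\<lambda>\<mu>. \<integral>z. f n z \<partial>\<mu>) \<in> borel_measurable (Mlam_borel lam)" for n
      by (rule continuous_map_W2_measurable, rule continuous_map_lipschitz_integral[OF lip bd meas]) simp
    fix \<mu> :: "(real \<times> (real ^ 'd)) measure" assume "\<mu> \<in> space (Mlam_borel lam)"
    then have "\<mu> \<in> P2" using Mlam_subset_P2 by auto
    note muD = P2_D[OF this]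
    interpret prob_space \<mu> by (rule muD)
    have [measurable_cong]: "sets \<mu> = sets state_space" by (rule muD)
    have UM: "U \<inter> state_set \<in> sets \<mu>"
      using U unfolding muD(1) by (auto simp: state_space_def sets_restrict_space)
    have "(\<lambda>n. \<integral>z. f n z \<partial>\<mu>) \<longlonglongrightarrow> (\<integral>z. indicator U z \<partial>\<mu>)"
    proof (rule integral_dominated_convergence[where w = "\<lambda>_. 1"])
      show "indicator U \<in> borel_measurable \<mu>"
        by (rule borel_measurable_indicator') (use UM muD in \<open>auto simp: Int_commute Collect_conj_eq vimage_def\<close>)
      show "f n \<in> borel_measurable \<mu>" for n using meas[of n] by measurable
    qed (use lim bd in auto)
    moreover have "(\<integral>z. indicator U z \<partial>\<mu>) = measure \<mu> (state_set \<inter> U)"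
      by (simp add: Int_commute muD(2))
    ultimately show "(\<lambda>n. \<integral>z. f n z \<partial>\<mu>) \<longlonglongrightarrow> measure \<mu> (state_set \<inter> U)" by simp
  qed
  then have "(\<lambda>\<mu>. ennreal (measure \<mu> (state_set \<inter> U))) \<in> borel_measurable (Mlam_borel lam)"
    by simp
  also have "?this \<longleftrightarrow> ?thesis"
  proof (rule measurable_cong)
    fix \<mu> :: "(real \<times> (real ^ 'd)) measure" assume "\<mu> \<in> space (Mlam_borel lam)"
    then interpret prob_space \<mu> using Mlam_subset_P2 P2_D(3) by auto
    show "ennreal (measure \<mu> (state_set \<inter> U)) = emeasure \<mu> (state_set \<inter> U)"
      by (simp add: emeasure_eq_measure)
  qed
  finally show ?thesis .
qed

text \<open>It suffices to treat the open sets, an intersection-stable generator. With this, a point of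
\<open>Mlam lam\<close> may be used as a probability kernel.\<close>

lemma measurable_evaluation_kernel:
  "(\<lambda>\<mu>. \<mu>) \<in> measurable (Mlam_borel lam) (subprob_algebra (state_space :: (real \<times> (real ^ 'd)) measure))"
proof (rule measurable_subprob_algebra_generated)
  let ?G = "(\<inter>) state_set ` {U :: (real \<times> (real ^ 'd)) set. open U}"
  show "sets (state_space :: (real \<times> (real ^ 'd)) measure) = sigma_sets state_set ?G"
    unfolding state_space_def sets_restrict_space sets_borel
    by (rule sigma_sets_Int) (use state_set_borel in \<open>auto simp: sets_borel\<close>)
  show "Int_stable ?G"
  proof (rule Int_stableI_image)
    fix U W :: "(real \<times> (real ^ 'd)) set"
    assume "U \<in> {U. open U}" "W \<in> {U. open U}"
    then show "\<exists>Y\<in>{U. open U}. state_set \<inter> U \<inter> (state_set \<inter> W) = state_set \<inter> Y"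
      by (intro bexI[of _ "U \<inter> W"]) auto
  qed
  show "?G \<subseteq> Pow state_set" by auto
  show "(\<lambda>\<mu>. emeasure \<mu> state_set) \<in> borel_measurable (Mlam_borel lam)"
    using measurable_emeasure_open[of UNIV] by simp
next
  fix \<mu> :: "(real \<times> (real ^ 'd)) measure" assume "\<mu> \<in> space (Mlam_borel lam)"
  then have "\<mu> \<in> P2" using Mlam_subset_P2 by auto
  then show "subprob_space \<mu>" "sets \<mu> = sets state_space"
    by (simp_all add: P2_D(1) P2_D(3) prob_space_imp_subprob_space)
next
  fix A :: "(real \<times> (real ^ 'd)) set"
  assume "A \<in> (\<inter>) state_set ` {U. open U}"
  then show "(\<lambda>\<mu>. emeasure \<mu> A) \<in> borel_measurable (Mlam_borel lam)"
    using measurable_emeasure_open by auto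
qed

lemma continuous_map_sections:
  assumes V: "continuous_map (prod_topology (top_of_set state_set) (W2_topology lam)) euclidean V"
  shows "w \<in> state_set \<Longrightarrow> continuous_map (W2_topology lam) euclidean (\<lambda>\<mu>. V (w, \<mu>))"
    and "\<mu> \<in> Mlam lam \<Longrightarrow> continuous_on state_set (\<lambda>z. V (z, \<mu>))"
proof -
  show "continuous_map (W2_topology lam) euclidean (\<lambda>\<mu>. V (w, \<mu>))" if "w \<in> state_set"
  proof -
    have "continuous_map (W2_topology lam) (prod_topology (top_of_set state_set) (W2_topology lam)) (\<lambda>\<mu>. (w, \<mu>))"
      using that by (intro continuous_map_pairedI) auto
    from continuous_map_compose[OF this V] show ?thesis by (simp add: o_def)
  qed
  show "continuous_on state_set (\<lambda>z. V (z, \<mu>))" if "\<mu> \<in> Mlam lam"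
  proof -
    have "continuous_map (top_of_set state_set) (prod_topology (top_of_set state_set) (W2_topology lam)) (\<lambda>z. (z, \<mu>))"
      using that by (intro continuous_map_pairedI) (auto simp: topspace_W2_topology)
    from continuous_map_compose[OF this V] show ?thesis by (simp add: o_def)
  qed
qed

text \<open>Joint measurability does not follow from joint continuity directly, since the Borel sets of the
product topology might exceed the product \<open>\<sigma>\<close>-algebra. Instead \<open>z\<close> is approximated by functions
\<open>F i z\<close> with finitely many values: for each value the function is measurable in \<open>\<mu>\<close>, and
continuity in \<open>z\<close> gives convergence. The retraction \<open>r\<close> brings the values back into the
state space.\<close>

lemma caratheodory_measurable:
  fixes V :: "(real \<times> (real ^ 'd)) \<times> (real \<times> (real ^ 'd)) measure \<Rightarrow> 'b :: metric_space"
  assumes V: "continuous_map (prod_topology (top_of_set state_set) (W2_topology lam)) euclidean V"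
  shows "V \<in> borel_measurable (state_space \<Otimes>\<^sub>M Mlam_borel lam)"
proof -
  define r :: "real \<times> (real ^ 'd) \<Rightarrow> real \<times> (real ^ 'd)" where "r z = (max 0 (min 1 (fst z)), snd z)" for z
  have r_state: "r z \<in> state_set" for z by (auto simp: r_def state_set_def)
  have r_id: "r z = z" if "z \<in> state_set" for z using that by (auto simp: r_def state_set_def)
  have r_cont: "continuous_on UNIV r" unfolding r_def by (intro continuous_intros)
  obtain F where F: "\<And>i. simple_function state_space (F i)"
    "\<And>z. z \<in> state_set \<Longrightarrow> (\<lambda>i. F i z) \<longlonglongrightarrow> (z :: real \<times> (real ^ 'd))"
    using borel_measurable_implies_sequence_metric[OF measurable_ident_state_space, of 0]
    unfolding space_state_space by metis
  show ?thesis
  proof (rule borel_measurable_LIMSEQ_metric)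
    fix i
    let ?I = "F i ` state_set"
    have "(\<lambda>q. V (r (F i (fst q)), snd q)) \<in> borel_measurable (state_space \<Otimes>\<^sub>M Mlam_borel lam)"
    proof (rule measurable_compose_countable'[where I = ?I and f = "\<lambda>w q. V (r w, snd q)"])
      show "(\<lambda>q. V (r w, snd q)) \<in> borel_measurable (state_space \<Otimes>\<^sub>M Mlam_borel lam)" for w
        using continuous_map_W2_measurable[OF continuous_map_sections(1)[OF V r_state[of w]]]
        by (rule measurable_compose[OF measurable_snd])
      have fin: "finite ?I" using F(1)[of i] by (simp add: simple_function_def)
      have "F i \<in> measurable state_space (count_space ?I)"
        using F(1)[of i] fin by (auto simp: simple_function_def measurable_count_space_eq2)
      then show "(\<lambda>q. F i (fst q)) \<in> measurable (state_space \<Otimes>\<^sub>M Mlam_borel lam) (count_space ?I)"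
        by (rule measurable_compose[OF measurable_fst])
      show "countable ?I" using fin by (rule countable_finite)
    qed
    then show "(\<lambda>q. V (r (F i (fst q)), snd q)) \<in> borel_measurable (state_space \<Otimes>\<^sub>M Mlam_borel lam)" .
  next
    fix q :: "(real \<times> (real ^ 'd)) \<times> (real \<times> (real ^ 'd)) measure"
    assume "q \<in> space (state_space \<Otimes>\<^sub>M Mlam_borel lam)"
    then obtain z \<mu> where q: "q = (z, \<mu>)" and z: "z \<in> state_set" and mu: "\<mu> \<in> Mlam lam"
      by (auto simp: space_pair_measure)
    have "(\<lambda>i. r (F i z)) \<longlonglongrightarrow> r z"
      using continuous_on_tendsto_compose[OF r_cont F(2)[of z]] z by simp
    then have "(\<lambda>i. r (F i z)) \<longlonglongrightarrow> z" using r_id[OF z] by simp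
    from continuous_on_tendsto_compose[OF continuous_map_sections(2)[OF V mu] this z]
    show "(\<lambda>i. V (r (F i (fst q)), snd q)) \<longlonglongrightarrow> V q"
      using r_state by (simp add: q)
  qed
qed

text \<open>The law of \<open>(z, \<mu>)\<close> when \<open>\<mu>\<close> is drawn from \<open>\<rho>\<close> and then \<open>z\<close> from \<open>\<mu>\<close>. It turns the iterated integral of the theorem into
one integral, for which dominated convergence is available.\<close>

definition joint_law ::
  "real measure \<Rightarrow> (real \<times> (real ^ 'd)) measure measure \<Rightarrow> ((real \<times> (real ^ 'd)) \<times> (real \<times> (real ^ 'd)) measure) measure"
  where "joint_law lam \<rho> = \<rho> \<bind> (\<lambda>\<mu>. distr \<mu> (state_space \<Otimes>\<^sub>M Mlam_borel lam) (\<lambda>z. (z, \<mu>)))"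

context
  fixes lam :: "real measure" and \<rho> :: "(real \<times> (real ^ 'd)) measure measure"
  assumes rho: "prob_space \<rho>" and sets_rho: "sets \<rho> = sets (Mlam_borel lam)"
begin

lemma measurable_joint_law_kernel:
  "(\<lambda>\<mu>. distr \<mu> (state_space \<Otimes>\<^sub>M Mlam_borel lam) (\<lambda>z. (z, \<mu>)))
     \<in> measurable \<rho> (subprob_algebra (state_space \<Otimes>\<^sub>M Mlam_borel lam))"
proof (rule measurable_distr2[where M = state_space])
  show "(\<lambda>\<mu>. \<mu>) \<in> measurable \<rho> (subprob_algebra state_space)"
    using measurable_evaluation_kernel sets_rho by (simp cong: measurable_cong_sets)
  have [measurable_cong]: "sets \<rho> = sets (Mlam_borel lam)" by (rule sets_rho)
  show "(\<lambda>(\<mu>, z). (z, \<mu>)) \<in> measurable (\<rho> \<Otimes>\<^sub>M state_space) (state_space \<Otimes>\<^sub>M Mlam_borel lam)"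
    by measurable
qed

lemma sets_joint_law [measurable_cong]: "sets (joint_law lam \<rho>) = sets (state_space \<Otimes>\<^sub>M Mlam_borel lam)"
  unfolding joint_law_def
  by (rule sets_bind_measurable[OF measurable_joint_law_kernel]) (rule prob_space.not_empty[OF rho])

lemma nn_integral_joint_law:
  assumes h: "h \<in> borel_measurable (state_space \<Otimes>\<^sub>M Mlam_borel lam)"
  shows "(\<integral>\<^sup>+ q. h q \<partial>joint_law lam \<rho>) = (\<integral>\<^sup>+ \<mu>. (\<integral>\<^sup>+ z. h (z, \<mu>) \<partial>\<mu>) \<partial>\<rho>)"
  unfolding joint_law_def nn_integral_bind[OF h measurable_joint_law_kernel]
proof (rule nn_integral_cong)
  fix \<mu> :: "(real \<times> (real ^ 'd)) measure" assume "\<mu> \<in> space \<rho>"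
  then have mu: "\<mu> \<in> Mlam lam" using sets_eq_imp_space_eq[OF sets_rho] by simp
  then have [measurable_cong]: "sets \<mu> = sets state_space" using Mlam_subset_P2 P2_D(1) by blast
  have "(\<lambda>z. (z, \<mu>)) \<in> measurable \<mu> (state_space \<Otimes>\<^sub>M Mlam_borel lam)"
    using mu by (intro measurable_Pair measurable_const) auto
  then show "(\<integral>\<^sup>+ q. h q \<partial>distr \<mu> (state_space \<Otimes>\<^sub>M Mlam_borel lam) (\<lambda>z. (z, \<mu>))) = (\<integral>\<^sup>+ z. h (z, \<mu>) \<partial>\<mu>)"
    by (rule nn_integral_distr) (simp add: h)
qed

lemma prob_space_joint_law: "prob_space (joint_law lam \<rho>)"
proof (rule prob_spaceI)
  have "emeasure (joint_law lam \<rho>) (space (joint_law lam \<rho>)) = (\<integral>\<^sup>+ q. 1 \<partial>joint_law lam \<rho>)"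
    by simp
  also have "\<dots> = (\<integral>\<^sup>+ \<mu>. (\<integral>\<^sup>+ z. 1 \<partial>\<mu>) \<partial>\<rho>)"
    by (rule nn_integral_joint_law) simp
  also have "\<dots> = (\<integral>\<^sup>+ \<mu>. 1 \<partial>\<rho>)"
  proof (rule nn_integral_cong)
    fix \<mu> :: "(real \<times> (real ^ 'd)) measure" assume "\<mu> \<in> space \<rho>"
    then have "prob_space \<mu>" using sets_eq_imp_space_eq[OF sets_rho] Mlam_subset_P2 P2_D(3) by auto
    then show "(\<integral>\<^sup>+ z. 1 \<partial>\<mu>) = 1" by (simp add: prob_space.emeasure_space_1)
  qed
  also have "\<dots> = 1" by (simp add: prob_space.emeasure_space_1[OF rho])
  finally show "emeasure (joint_law lam \<rho>) (space (joint_law lam \<rho>)) = 1" .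
qed

end

section \<open>Projection onto finitely many moments\<close>

text \<open>Normalised hat functions around a finite net of \<open>S\<close>. They cover only a neighbourhood of \<open>S\<close>; the remaining
points are assigned to the centre \<open>x0\<close> through the extra summand \<open>infdist x C - \<delta> / 2\<close>, which vanishes on \<open>S\<close> because the
net has mesh \<open>\<delta> / 2\<close>.\<close>

lemma partition_of_unity_centres:
  fixes S :: "'a :: metric_space set" and x0 :: 'a
  assumes S: "compact S" and d: "\<delta> > 0"
  obtains C g where "finite C" "x0 \<in> C" "\<And>c. continuous_on UNIV (g c)" "\<And>c x. (g c x :: real) \<ge> 0"
    "\<And>x. (\<Sum>c\<in>C. g c x) = 1"
    "\<And>c x. c \<in> C \<Longrightarrow> g c x \<noteq> 0 \<Longrightarrow> dist x c < \<delta> \<or> (c = x0 \<and> x \<notin> S)"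
proof -
  obtain T where T: "finite T" "T \<subseteq> S" "S \<subseteq> (\<Union>t\<in>T. ball t (\<delta> / 2))"
    using seq_compact_imp_totally_bounded[of S] S d by (meson compact_imp_seq_compact half_gt_zero)
  define C where "C = insert x0 T"
  have C: "finite C" "C \<noteq> {}" using T by (auto simp: C_def)
  \<comment> \<open>The second summand is positive wherever no hat is, so the sum of all bumps never vanishes.\<close>
  define b where "b c x = max 0 (\<delta> - dist x c) + (if c = x0 then max 0 (infdist x C - \<delta> / 2) else 0)" for c x
  define D where "D x = (\<Sum>c\<in>C. b c x)" for x
  have b0: "b c x \<ge> 0" for c x by (auto simp: b_def)
  have b_cont: "continuous_on UNIV (b c)" for c
    unfolding b_def by (cases "c = x0") (auto intro!: continuous_intros)
  have D_cont: "continuous_on UNIV D"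
    unfolding D_def by (intro continuous_intros b_cont)
  have D_pos: "D x > 0" for x
  proof -
    have "\<exists>c\<in>C. b c x > 0"
    proof (cases "infdist x C < \<delta>")
      case True
      then obtain c where "c \<in> C" "dist x c < \<delta>"
        using C by (auto simp: infdist_notempty cINF_less_iff)
      then show ?thesis by (intro bexI[of _ c]) (auto simp: b_def add_pos_nonneg)
    next
      case False
      then show ?thesis using d by (intro bexI[of _ x0]) (auto simp: b_def C_def add_nonneg_pos)
    qed
    then show ?thesis unfolding D_def using C b0 by (auto intro: sum_pos2)
  qed
  show ?thesis
  proof (rule that[of C "\<lambda>c x. b c x / D x"])
    show "continuous_on UNIV (\<lambda>x. b c x / D x)" for c
      using D_pos by (intro continuous_intros b_cont D_cont) (metis less_irrefl)
    show "b c x / D x \<ge> 0" for c x using b0[of c x] D_pos[of x] by simp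
    show "(\<Sum>c\<in>C. b c x / D x) = 1" for x
      using D_pos[of x] by (simp add: sum_divide_distrib[symmetric] D_def)
    show "dist x c < \<delta> \<or> (c = x0 \<and> x \<notin> S)" if c: "c \<in> C" "b c x / D x \<noteq> 0" for c x
    proof (rule ccontr)
      assume *: "\<not> (dist x c < \<delta> \<or> (c = x0 \<and> x \<notin> S))"
      have "infdist x C \<le> \<delta> / 2" if xS: "x \<in> S"
      proof -
        obtain t where "t \<in> T" "x \<in> ball t (\<delta> / 2)" using xS T(3) by blast
        then have "dist x t \<le> \<delta> / 2" by (simp add: dist_commute)
        then show ?thesis using \<open>t \<in> T\<close> by (intro infdist_le2[of t]) (auto simp: C_def)
      qed
      then have "b c x = 0" using * by (auto simp: b_def)
      then show False using c by simp
    qed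
  qed (use C in \<open>auto simp: C_def\<close>)
qed

lemma tail_measurable:
  "(\<lambda>z :: real \<times> (real ^ 'd). ennreal (if R < norm (snd z) then (norm z)\<^sup>2 else 0)) \<in> borel_measurable borel"
proof -
  have [measurable]: "(snd :: real \<times> (real ^ 'd) \<Rightarrow> _) \<in> borel_measurable borel"
    by (intro borel_measurable_continuous_onI continuous_on_snd continuous_on_id)
  show ?thesis by measurable
qed

text \<open>The centres of the cells are the pairs in \<open>CU \<times> CX\<close>, numbered by \<open>pt\<close> so that moments form a sequence. Labels are
covered completely, states only inside the ball of radius \<open>R\<close>: the rest may be assigned to the origin.\<close>

locale finite_projection =
  fixes lam :: "real measure" and CU :: "real set" and CX :: "(real ^ 'd) set"
    and psi :: "real \<Rightarrow> real \<Rightarrow> real" and chi :: "real ^ 'd \<Rightarrow> real ^ 'd \<Rightarrow> real"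
    and \<delta> :: real and R :: real and J :: nat and pt :: "nat \<Rightarrow> real \<times> (real ^ 'd)"
  assumes lam: "prob_space lam" and sets_lam: "sets lam = sets label_space"
    and fin: "finite CU" "finite CX" and d: "\<delta> > 0"
    and psi_cont: "\<And>p. continuous_on UNIV (psi p)" and psi0: "\<And>p u. psi p u \<ge> 0"
    and psi1: "\<And>u. (\<Sum>p\<in>CU. psi p u) = 1"
    and psi_supp: "\<And>p u. p \<in> CU \<Longrightarrow> u \<in> {0..1} \<Longrightarrow> psi p u \<noteq> 0 \<Longrightarrow> dist u p < \<delta>"
    and chi_cont: "\<And>c. continuous_on UNIV (chi c)" and chi0: "\<And>c x. chi c x \<ge> 0"
    and chi1: "\<And>x. (\<Sum>c\<in>CX. chi c x) = 1"
    and chi_supp: "\<And>c x. c \<in> CX \<Longrightarrow> chi c x \<noteq> 0 \<Longrightarrow> dist x c < \<delta> \<or> (c = 0 \<and> R < norm x)"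
    and pt: "bij_betw pt {..<J} (CU \<times> CX)"
begin

definition cell_mass :: "real \<Rightarrow> real" where "cell_mass p = (\<integral>u. psi p u \<partial>lam)"

definition eta :: "nat \<Rightarrow> real \<times> (real ^ 'd) \<Rightarrow> real" where
  "eta j z = psi (fst (pt j)) (fst z) * chi (snd (pt j)) (snd z)"

text \<open>The measure by which the mass of cell \<open>j\<close> is replaced: the label is distributed as \<open>lam\<close> weighted by
\<open>psi p\<close>, the state sits at the centre. If the cell is \<open>lam\<close>-null, division by zero makes this the
zero measure.\<close>

definition cell_model :: "nat \<Rightarrow> (real \<times> (real ^ 'd)) measure" where
  "cell_model j = distr (density lam (\<lambda>u. ennreal (psi (fst (pt j)) u / cell_mass (fst (pt j))))) state_space
     (\<lambda>u. (u, snd (pt j)))"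

definition moments :: "(real \<times> (real ^ 'd)) measure \<Rightarrow> nat \<Rightarrow> real" where
  "moments \<mu> j = (if j < J then \<integral>z. eta j z \<partial>\<mu> else 0)"

text \<open>The third condition says that the moments belonging to one label cell add up to its mass under
\<open>lam\<close>. It is what makes the first marginal of \<open>recon y\<close> equal to \<open>lam\<close>. The entries beyond \<open>J\<close> vanish so that
finitely many coordinates determine the sequence.\<close>

definition admissible :: "(nat \<Rightarrow> real) set" where
  "admissible = {y. (\<forall>j. 0 \<le> y j) \<and> (\<forall>j\<ge>J. y j = 0) \<and>
     (\<forall>p\<in>CU. (\<Sum>j\<in>{j \<in> {..<J}. fst (pt j) = p}. y j) = cell_mass p)}"

definition recon :: "(nat \<Rightarrow> real) \<Rightarrow> (real \<times> (real ^ 'd)) measure" where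
  "recon y = mixture {..<J} (\<lambda>j. scale_measure (ennreal (y j)) (cell_model j))"

lemma space_lam: "space lam = {0..1}"
  using sets_eq_imp_space_eq[OF sets_lam] by (simp add: label_space_def space_restrict_space)

sublocale L: prob_space lam by (rule lam)

lemma sets_lam_restrict [measurable_cong]: "sets lam = sets (restrict_space borel {0..1})"
  using sets_lam by (simp add: label_space_def)

lemma psi_measurable [measurable]: "psi p \<in> borel_measurable borel"
  by (rule borel_measurable_continuous_onI[OF psi_cont])

lemma chi_measurable [measurable]: "chi c \<in> borel_measurable borel"
  by (rule borel_measurable_continuous_onI[OF chi_cont])

lemma ident_lam_measurable [measurable]: "(\<lambda>u. u) \<in> borel_measurable lam"
  unfolding measurable_cong_sets[OF sets_lam_restrict refl] by (intro measurable_restrict_space1) simp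

lemma eta_measurable [measurable]: "eta j \<in> borel_measurable borel"
  unfolding eta_def borel_prod[symmetric] by measurable

lemma eta_measurable' [measurable]: "eta j \<in> borel_measurable state_space"
  using measurable_compose[OF measurable_ident_state_space eta_measurable[of j]] .

lemma psi_le1: "p \<in> CU \<Longrightarrow> psi p u \<le> 1"
  using member_le_sum[of p CU "\<lambda>p. psi p u"] fin psi0 psi1[of u] by auto

lemma chi_le1: "c \<in> CX \<Longrightarrow> chi c x \<le> 1"
  using member_le_sum[of c CX "\<lambda>c. chi c x"] fin chi0 chi1[of x] by auto

lemma pt_in: "j < J \<Longrightarrow> fst (pt j) \<in> CU" "j < J \<Longrightarrow> snd (pt j) \<in> CX"
  using bij_betw_apply[OF pt, of j] by (auto simp: mem_Times_iff)

lemma eta0: "eta j z \<ge> 0"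
  using psi0 chi0 by (simp add: eta_def)

lemma eta_le1: "j < J \<Longrightarrow> eta j z \<le> 1"
  unfolding eta_def using psi0 chi0 psi_le1 chi_le1 pt_in by (intro mult_le_one) auto

lemma J_pos: "J > 0"
proof (rule ccontr)
  assume "\<not> J > 0"
  then have "CU \<times> CX = {}" using pt by (auto simp: bij_betw_def)
  then show False using psi1[of 0] chi1[of 0] by (cases "CU = {}") auto
qed

lemma sum_pt: "(\<Sum>j<J. f (pt j)) = (\<Sum>p\<in>CU. \<Sum>c\<in>CX. f (p, c))"
  using sum.reindex_bij_betw[OF pt, of f] by (simp add: sum.cartesian_product)

lemma sum_eta: "(\<Sum>j<J. eta j z) = 1"
  unfolding eta_def using sum_pt[of "\<lambda>a. psi (fst a) (fst z) * chi (snd a) (snd z)"]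
  by (simp add: sum_distrib_left[symmetric] psi1 chi1)

lemma sum_fiber: "(\<Sum>j\<in>{j \<in> {..<J}. fst (pt j) = p}. f (snd (pt j))) = (\<Sum>c\<in>CX. f c)" if p: "p \<in> CU"
proof (rule sum.reindex_bij_betw)
  have i: "inj_on pt {..<J}" and im: "pt ` {..<J} = CU \<times> CX" using pt by (auto simp: bij_betw_def)
  show "bij_betw (\<lambda>j. snd (pt j)) {j \<in> {..<J}. fst (pt j) = p} CX"
  proof (rule bij_betwI')
    fix j k assume "j \<in> {j \<in> {..<J}. fst (pt j) = p}" "k \<in> {j \<in> {..<J}. fst (pt j) = p}"
    then show "snd (pt j) = snd (pt k) \<longleftrightarrow> j = k"
      using inj_onD[OF i, of j k] by (auto simp: prod_eq_iff)
  next
    fix c assume "c \<in> CX"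
    then have "(p, c) \<in> pt ` {..<J}" using p im by simp
    then obtain j where "j < J" "pt j = (p, c)" by auto
    then show "\<exists>j\<in>{j \<in> {..<J}. fst (pt j) = p}. c = snd (pt j)" by (intro bexI[of _ j]) auto
  qed (use pt_in in auto)
qed

lemma psi_integrable: "p \<in> CU \<Longrightarrow> integrable lam (psi p)"
  using psi0 psi_le1 by (intro L.integrable_const_bound[where B = 1]) auto

lemma cell_mass_nonneg: "cell_mass p \<ge> 0"
  unfolding cell_mass_def using psi0 by (intro integral_nonneg_AE) auto

lemma ennreal_cell_mass: "p \<in> CU \<Longrightarrow> ennreal (cell_mass p) = (\<integral>\<^sup>+ u. ennreal (psi p u) \<partial>lam)"
  unfolding cell_mass_def using psi0 by (intro nn_integral_eq_integral[symmetric] psi_integrable) auto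

lemma sum_cell_mass: "(\<Sum>p\<in>CU. cell_mass p) = 1"
proof -
  have "(\<Sum>p\<in>CU. cell_mass p) = (\<integral>u. (\<Sum>p\<in>CU. psi p u) \<partial>lam)"
    unfolding cell_mass_def using psi_integrable by (intro Bochner_Integration.integral_sum[symmetric]) auto
  then show ?thesis by (simp add: psi1 L.prob_space)
qed

text \<open>Null cells are harmless: if \<open>cell_mass p = 0\<close>, then \<open>psi p\<close> vanishes almost everywhere, and both sides are zero.\<close>

lemma cell_mass_normalise:
  assumes p: "p \<in> CU" and g[measurable]: "g \<in> borel_measurable lam"
  shows "ennreal (cell_mass p) * (\<integral>\<^sup>+ u. g u * ennreal (psi p u / cell_mass p) \<partial>lam) = (\<integral>\<^sup>+ u. g u * ennreal (psi p u) \<partial>lam)"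
proof (cases "cell_mass p = 0")
  case True
  then have "(\<integral>\<^sup>+ u. ennreal (psi p u) \<partial>lam) = 0" using ennreal_cell_mass[OF p] by simp
  then have "AE u in lam. ennreal (psi p u) = 0" by (subst (asm) nn_integral_0_iff_AE) auto
  then have "(\<integral>\<^sup>+ u. g u * ennreal (psi p u) \<partial>lam) = (\<integral>\<^sup>+ u. 0 \<partial>lam)"
    by (intro nn_integral_cong_AE) auto
  then show ?thesis using True by simp
next
  case False
  then have pos: "cell_mass p > 0" using cell_mass_nonneg[of p] by simp
  have "ennreal (cell_mass p) * (\<integral>\<^sup>+ u. g u * ennreal (psi p u / cell_mass p) \<partial>lam)
      = (\<integral>\<^sup>+ u. ennreal (cell_mass p) * (g u * ennreal (psi p u / cell_mass p)) \<partial>lam)"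
    by (rule nn_integral_cmult[symmetric]) measurable
  also have "\<dots> = (\<integral>\<^sup>+ u. g u * ennreal (psi p u) \<partial>lam)"
  proof (rule nn_integral_cong)
    fix u
    have "ennreal (cell_mass p) * ennreal (psi p u / cell_mass p) = ennreal (psi p u)"
      using pos psi0 by (subst ennreal_mult'[symmetric]) auto
    then show "ennreal (cell_mass p) * (g u * ennreal (psi p u / cell_mass p)) = g u * ennreal (psi p u)"
      by (metis mult.left_commute)
  qed
  finally show ?thesis .
qed

lemma sets_cell_model [simp, measurable_cong]: "sets (cell_model j) = sets state_space"
  by (simp add: cell_model_def)

lemma space_cell_model [simp]: "space (cell_model j) = state_set"
  using sets_eq_imp_space_eq[OF sets_cell_model[of j]] by simp

lemma embed_measurable [measurable]: "(\<lambda>u. (u, c)) \<in> measurable lam state_space"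
  unfolding state_space_def
proof (rule measurable_restrict_space2)
  show "(\<lambda>u. (u, c)) \<in> space lam \<rightarrow> state_set" by (auto simp: space_lam state_set_def)
  show "(\<lambda>u. (u, c)) \<in> borel_measurable lam" unfolding borel_prod[symmetric] by measurable
qed

lemma nn_integral_cell_model:
  assumes f: "f \<in> borel_measurable state_space"
  shows "(\<integral>\<^sup>+ z. f z \<partial>cell_model j) = (\<integral>\<^sup>+ u. f (u, snd (pt j)) * ennreal (psi (fst (pt j)) u / cell_mass (fst (pt j))) \<partial>lam)"
proof -
  have "(\<lambda>u. f (u, snd (pt j))) \<in> borel_measurable lam"
    by (rule measurable_compose[OF embed_measurable f])
  then show ?thesis
    unfolding cell_model_def using f
    by (subst nn_integral_distr) (auto simp: nn_integral_density mult.commute)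
qed

lemma emeasure_cell_model_state:
  assumes "j < J"
  shows "emeasure (cell_model j) state_set = (if cell_mass (fst (pt j)) = 0 then 0 else 1)"
proof -
  let ?p = "fst (pt j)"
  have p: "?p \<in> CU" using pt_in assms by simp
  have "emeasure (cell_model j) state_set = (\<integral>\<^sup>+ z. 1 \<partial>cell_model j)" by simp
  also have "\<dots> = (\<integral>\<^sup>+ u. ennreal (psi ?p u / cell_mass ?p) \<partial>lam)"
    by (subst nn_integral_cell_model) auto
  finally have e: "emeasure (cell_model j) state_set = (\<integral>\<^sup>+ u. ennreal (psi ?p u / cell_mass ?p) \<partial>lam)" .
  show ?thesis
  proof (cases "cell_mass ?p = 0")
    case False
    then have "cell_mass ?p > 0" using cell_mass_nonneg[of ?p] by simp
    moreover have "ennreal (cell_mass ?p) * emeasure (cell_model j) state_set = ennreal (cell_mass ?p)"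
      using cell_mass_normalise[OF p, of "\<lambda>_. 1"] ennreal_cell_mass[OF p] by (simp add: e)
    ultimately show ?thesis
      using ennreal_mult_cancel_left[of "ennreal (cell_mass ?p)" "emeasure (cell_model j) state_set" 1] False by simp
  qed (simp add: e)
qed

lemma subprob_cell_model: "j < J \<Longrightarrow> subprob_space (cell_model j)"
  using emeasure_cell_model_state[of j] by (intro subprob_spaceI) (auto simp: state_set_def)

lemma admissibleD:
  assumes "y \<in> admissible"
  shows "y j \<ge> 0" "y j \<le> 1" "j \<ge> J \<Longrightarrow> y j = 0"
    "p \<in> CU \<Longrightarrow> (\<Sum>j\<in>{j \<in> {..<J}. fst (pt j) = p}. y j) = cell_mass p"
proof -
  show y0: "y j \<ge> 0" for j using assms by (auto simp: admissible_def)
  show yz: "j \<ge> J \<Longrightarrow> y j = 0" for j using assms by (auto simp: admissible_def)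
  show s: "(\<Sum>j\<in>{j \<in> {..<J}. fst (pt j) = p}. y j) = cell_mass p" if "p \<in> CU" for p
    using assms that by (auto simp: admissible_def)
  show "y j \<le> 1"
  proof (cases "j < J")
    case True
    let ?p = "fst (pt j)"
    have p: "?p \<in> CU" using True pt_in by simp
    have "y j \<le> (\<Sum>j\<in>{j \<in> {..<J}. fst (pt j) = ?p}. y j)"
      using True y0 by (intro member_le_sum) auto
    also have "\<dots> = cell_mass ?p" by (rule s[OF p])
    also have "\<dots> \<le> (\<Sum>p\<in>CU. cell_mass p)" using p fin cell_mass_nonneg by (intro member_le_sum) auto
    finally show ?thesis by (simp add: sum_cell_mass)
  qed (use yz in auto)
qed

lemma sum_admissible:
  fixes h :: "real \<Rightarrow> ennreal"
  assumes y: "y \<in> admissible"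
  shows "(\<Sum>j<J. ennreal (y j) * h (fst (pt j))) = (\<Sum>p\<in>CU. ennreal (cell_mass p) * h p)"
proof -
  have "(\<Sum>j<J. ennreal (y j) * h (fst (pt j)))
      = (\<Sum>p\<in>CU. \<Sum>j\<in>{j \<in> {..<J}. fst (pt j) = p}. ennreal (y j) * h (fst (pt j)))"
    by (rule sum.group[symmetric]) (use fin pt_in in auto)
  also have "\<dots> = (\<Sum>p\<in>CU. ennreal (cell_mass p) * h p)"
  proof (rule sum.cong[OF refl])
    fix p assume p: "p \<in> CU"
    have "(\<Sum>j\<in>{j \<in> {..<J}. fst (pt j) = p}. ennreal (y j) * h (fst (pt j)))
        = (\<Sum>j\<in>{j \<in> {..<J}. fst (pt j) = p}. ennreal (y j)) * h p"
      by (simp add: sum_distrib_right)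
    also have "(\<Sum>j\<in>{j \<in> {..<J}. fst (pt j) = p}. ennreal (y j)) = ennreal (cell_mass p)"
      unfolding admissibleD(4)[OF y p, symmetric]
      using admissibleD(1)[OF y] by (intro sum_ennreal) auto
    finally show "(\<Sum>j\<in>{j \<in> {..<J}. fst (pt j) = p}. ennreal (y j) * h (fst (pt j))) = ennreal (cell_mass p) * h p" .
  qed
  finally show ?thesis .
qed

lemma recon_components:
  assumes y: "y \<in> admissible" and j: "j \<in> {..<J}"
  shows "subprob_space (scale_measure (ennreal (y j)) (cell_model j))"
    "sets (scale_measure (ennreal (y j)) (cell_model j)) = sets state_space"
proof -
  have "ennreal (y j) * emeasure (cell_model j) state_set \<le> 1 * 1"
    using admissibleD(2)[OF y, of j] emeasure_cell_model_state[of j] j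
    by (intro mult_mono) (auto simp: ennreal_le_1)
  then show "subprob_space (scale_measure (ennreal (y j)) (cell_model j))"
    by (intro subprob_spaceI) (auto simp: space_scale_measure state_set_def)
qed simp

lemma
  assumes y: "y \<in> admissible"
  shows sets_recon: "sets (recon y) = sets state_space"
    and space_recon: "space (recon y) = state_set"
    and nn_integral_recon: "\<And>f. f \<in> borel_measurable state_space \<Longrightarrow>
      (\<integral>\<^sup>+ z. f z \<partial>recon y) = (\<Sum>j<J. ennreal (y j) * (\<integral>\<^sup>+ z. f z \<partial>cell_model j))"
    and emeasure_recon: "\<And>E. E \<in> sets state_space \<Longrightarrow>
      emeasure (recon y) E = (\<Sum>j<J. ennreal (y j) * emeasure (cell_model j) E)"
proof -
  have ne: "{..<J} \<noteq> {}" using J_pos by auto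
  show s: "sets (recon y) = sets state_space"
    unfolding recon_def by (rule sets_mixture[OF _ ne recon_components[OF y]]) auto
  show "space (recon y) = state_set" using sets_eq_imp_space_eq[OF s] by simp
  show "(\<integral>\<^sup>+ z. f z \<partial>recon y) = (\<Sum>j<J. ennreal (y j) * (\<integral>\<^sup>+ z. f z \<partial>cell_model j))"
    if f: "f \<in> borel_measurable state_space" for f
    unfolding recon_def
    by (subst nn_integral_mixture[OF _ ne recon_components[OF y] f])
       (use f in \<open>auto intro!: sum.cong nn_integral_scale_measure simp: measurable_cong_sets[OF sets_cell_model refl]\<close>)
  show "emeasure (recon y) E = (\<Sum>j<J. ennreal (y j) * emeasure (cell_model j) E)"
    if E: "E \<in> sets state_space" for E
    unfolding recon_def by (subst emeasure_mixture[OF _ ne recon_components[OF y] E]) auto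
qed

text \<open>Summing over the centres that share the label cell \<open>p\<close> gives the factor \<open>cell_mass p\<close>, which cancels the
normalisation; what remains is the partition of unity \<open>\<Sum> psi p = 1\<close>.\<close>

lemma recon_marginal:
  assumes y: "y \<in> admissible" and g[measurable]: "g \<in> borel_measurable lam"
    and gm: "(\<lambda>z :: real \<times> (real ^ 'd). g (fst z)) \<in> borel_measurable state_space"
  shows "(\<integral>\<^sup>+ z. g (fst z) \<partial>recon y) = (\<integral>\<^sup>+ u. g u \<partial>lam)"
proof -
  have "(\<integral>\<^sup>+ z. g (fst z) \<partial>recon y)
      = (\<Sum>j<J. ennreal (y j) * (\<integral>\<^sup>+ u. g u * ennreal (psi (fst (pt j)) u / cell_mass (fst (pt j))) \<partial>lam))"
    unfolding nn_integral_recon[OF y gm] nn_integral_cell_model[OF gm] fst_conv ..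
  also have "\<dots> = (\<Sum>p\<in>CU. ennreal (cell_mass p) * (\<integral>\<^sup>+ u. g u * ennreal (psi p u / cell_mass p) \<partial>lam))"
    by (rule sum_admissible[OF y])
  also have "\<dots> = (\<Sum>p\<in>CU. \<integral>\<^sup>+ u. g u * ennreal (psi p u) \<partial>lam)"
    by (intro sum.cong refl cell_mass_normalise g)
  also have "\<dots> = (\<integral>\<^sup>+ u. (\<Sum>p\<in>CU. g u * ennreal (psi p u)) \<partial>lam)"
    by (rule nn_integral_sum[symmetric]) measurable
  also have "\<dots> = (\<integral>\<^sup>+ u. g u \<partial>lam)"
  proof (rule nn_integral_cong)
    fix u
    have "(\<Sum>p\<in>CU. g u * ennreal (psi p u)) = g u * ennreal (\<Sum>p\<in>CU. psi p u)"
      unfolding sum_distrib_left[symmetric] using psi0 by (subst sum_ennreal) auto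
    then show "(\<Sum>p\<in>CU. g u * ennreal (psi p u)) = g u" by (simp add: psi1)
  qed
  finally show ?thesis .
qed

lemma recon_prob: "y \<in> admissible \<Longrightarrow> prob_space (recon y)"
proof (rule prob_spaceI)
  assume y: "y \<in> admissible"
  have "(\<integral>\<^sup>+ z. 1 \<partial>recon y) = (\<integral>\<^sup>+ u. 1 \<partial>lam)"
    by (rule recon_marginal[OF y]) (rule borel_measurable_const)+
  then show "emeasure (recon y) (space (recon y)) = 1"
    unfolding nn_integral_const mult_1 L.emeasure_space_1 .
qed

text \<open>The reconstruction is carried by the labels in \<open>{0..1}\<close> and the finitely many states in \<open>CX\<close>.\<close>

lemma nn_integral_recon_le:
  assumes y: "y \<in> admissible" and f: "f \<in> borel_measurable state_space"
    and le: "\<And>u c. u \<in> {0..1} \<Longrightarrow> c \<in> CX \<Longrightarrow> f (u, c) \<le> D"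
  shows "(\<integral>\<^sup>+ z. f z \<partial>recon y) \<le> D"
proof -
  have "(\<integral>\<^sup>+ z. f z \<partial>recon y) \<le> (\<integral>\<^sup>+ z. D \<partial>recon y)"
    unfolding nn_integral_recon[OF y f] nn_integral_recon[OF y borel_measurable_const[of D]]
  proof (intro sum_mono mult_left_mono)
    fix j assume j: "j \<in> {..<J}"
    show "(\<integral>\<^sup>+ z. f z \<partial>cell_model j) \<le> (\<integral>\<^sup>+ z. D \<partial>cell_model j)"
      unfolding nn_integral_cell_model[OF f] nn_integral_cell_model[OF borel_measurable_const[of D]]
      using j le pt_in by (intro nn_integral_mono mult_right_mono) (auto simp: space_lam)
  qed auto
  also have "\<dots> = D"
    unfolding nn_integral_const prob_space.emeasure_space_1[OF recon_prob[OF y]] by (rule mult_1_right)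
  finally show ?thesis .
qed

lemma fst_label_measurable [measurable]: "fst \<in> measurable (state_space :: (real \<times> (real ^ 'd)) measure) label_space"
  unfolding label_space_def
proof (rule measurable_restrict_space2)
  show "fst \<in> space (state_space :: (real \<times> (real ^ 'd)) measure) \<rightarrow> {0..1}" by (auto simp: state_set_def)
  have "fst \<in> borel_measurable (borel \<Otimes>\<^sub>M borel :: (real \<times> (real ^ 'd)) measure)" by measurable
  then show "fst \<in> borel_measurable (state_space :: (real \<times> (real ^ 'd)) measure)"
    unfolding borel_prod using measurable_compose[OF measurable_ident_state_space] by blast
qed

lemma recon_in_Mlam:
  assumes y: "y \<in> admissible"
  shows "recon y \<in> Mlam lam"
proof -
  interpret prob_space "recon y" by (rule recon_prob[OF y])
  have [measurable_cong]: "sets (recon y) = sets state_space" by (rule sets_recon[OF y])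
  define D where "D = (\<Sum>c\<in>CX. 1 + (norm c)\<^sup>2)"
  have "(\<integral>\<^sup>+ z. ennreal ((norm z)\<^sup>2) \<partial>recon y) \<le> ennreal D"
  proof (rule nn_integral_recon_le[OF y])
    fix u :: real and c :: "real ^ 'd" assume u: "u \<in> {0..1}" and c: "c \<in> CX"
    have "(norm (u, c))\<^sup>2 = u\<^sup>2 + (norm c)\<^sup>2" by (simp add: norm_Pair)
    also have "\<dots> \<le> 1 + (norm c)\<^sup>2" using u by (simp add: power_le_one)
    also have "\<dots> \<le> D" unfolding D_def using fin c by (intro member_le_sum) auto
    finally show "ennreal ((norm (u, c))\<^sup>2) \<le> ennreal D" by (rule ennreal_leI)
  qed measurable
  then have "(\<integral>\<^sup>+ z. ennreal ((norm z)\<^sup>2) \<partial>recon y) < \<infinity>"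
    unfolding infinity_ennreal_def by (rule le_less_trans) (rule ennreal_less_top)
  then have P2: "recon y \<in> P2"
    unfolding P2_def using sets_recon[OF y] prob_space_axioms by blast
  have "distr (recon y) label_space fst = lam"
  proof (rule measure_eqI)
    fix E assume "E \<in> sets (distr (recon y) label_space fst)"
    then have E: "E \<in> sets label_space" unfolding sets_distr .
    then have E': "E \<in> sets lam" unfolding sets_lam .
    have m: "(\<lambda>z. indicator E (fst z) :: ennreal) \<in> borel_measurable (state_space :: (real \<times> (real ^ 'd)) measure)"
      using measurable_compose[OF fst_label_measurable borel_measurable_indicator[OF E]] .
    have fm: "fst \<in> measurable (recon y) label_space"
      unfolding measurable_cong_sets[OF sets_recon[OF y] refl] by (rule fst_label_measurable)
    have "emeasure (distr (recon y) label_space fst) E = (\<integral>\<^sup>+ u. indicator E u \<partial>distr (recon y) label_space fst)"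
      by (rule nn_integral_indicator[symmetric]) (unfold sets_distr, rule E)
    also have "\<dots> = (\<integral>\<^sup>+ z. indicator E (fst z) \<partial>recon y)"
      by (rule nn_integral_distr[OF fm]) (rule borel_measurable_indicator, unfold sets_distr, rule E)
    also have "\<dots> = (\<integral>\<^sup>+ u. indicator E u \<partial>lam)"
      by (rule recon_marginal[OF y borel_measurable_indicator[OF E'] m])
    also have "\<dots> = emeasure lam E" by (rule nn_integral_indicator[OF E'])
    finally show "emeasure (distr (recon y) label_space fst) E = emeasure lam E" .
  qed (unfold sets_distr sets_lam, rule refl)
  then show ?thesis unfolding Mlam_def using P2 by blast
qed

text \<open>Summing \<open>eta j\<close> over the centres with label \<open>p\<close> leaves \<open>psi p\<close>, a function of the label alone, whose
integral is determined by the first marginal.\<close>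

lemma moments_admissible:
  assumes mu: "\<mu> \<in> Mlam lam"
  shows "moments \<mu> \<in> admissible"
proof -
  have P2: "\<mu> \<in> P2" and m: "distr \<mu> label_space fst = lam" using mu by (auto simp: Mlam_def)
  interpret prob_space \<mu> by (rule P2_D(3)[OF P2])
  note cong = measurable_cong_sets[OF P2_D(1)[OF P2] refl]
  have int: "integrable \<mu> (eta j)" if "j < J" for j
  proof (rule integrable_const_bound[where B = 1])
    show "AE z in \<mu>. norm (eta j z) \<le> 1"
      by (rule AE_I2) (simp add: eta0 eta_le1[OF that])
  qed (unfold cong, rule eta_measurable')
  have "(\<Sum>j\<in>{j \<in> {..<J}. fst (pt j) = p}. moments \<mu> j) = cell_mass p" if p: "p \<in> CU" for p
  proof -
    have "(\<Sum>j\<in>{j \<in> {..<J}. fst (pt j) = p}. moments \<mu> j)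
        = (\<Sum>j\<in>{j \<in> {..<J}. fst (pt j) = p}. \<integral>z. eta j z \<partial>\<mu>)"
      by (intro sum.cong) (auto simp: moments_def)
    also have "\<dots> = (\<integral>z. (\<Sum>j\<in>{j \<in> {..<J}. fst (pt j) = p}. eta j z) \<partial>\<mu>)"
      by (rule Bochner_Integration.integral_sum[symmetric]) (simp add: int)
    also have "\<dots> = (\<integral>z. psi p (fst z) \<partial>\<mu>)"
    proof (rule Bochner_Integration.integral_cong[OF refl])
      fix z
      have "(\<Sum>j\<in>{j \<in> {..<J}. fst (pt j) = p}. eta j z)
          = (\<Sum>j\<in>{j \<in> {..<J}. fst (pt j) = p}. psi p (fst z) * chi (snd (pt j)) (snd z))"
        by (intro sum.cong) (auto simp: eta_def)
      also have "\<dots> = psi p (fst z)"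
        using sum_fiber[OF p, of "\<lambda>c. psi p (fst z) * chi c (snd z)"]
        by (simp add: sum_distrib_left[symmetric] chi1)
      finally show "(\<Sum>j\<in>{j \<in> {..<J}. fst (pt j) = p}. eta j z) = psi p (fst z)" .
    qed
    also have "\<dots> = (\<integral>u. psi p u \<partial>distr \<mu> label_space fst)"
    proof (rule integral_distr[symmetric])
      show "psi p \<in> borel_measurable label_space"
        unfolding label_space_def by (rule measurable_restrict_space1[OF psi_measurable])
    qed (unfold cong, rule fst_label_measurable)
    finally show ?thesis by (simp add: m cell_mass_def)
  qed
  moreover have "moments \<mu> j \<ge> 0" for j
    using eta0 by (auto simp: moments_def intro!: integral_nonneg_AE)
  ultimately show ?thesis by (auto simp: admissible_def moments_def)
qed

lemma measurable_state [simp]: "state_set \<in> sets (state_space :: (real \<times> (real ^ 'd)) measure)"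
  using sets.top[of "state_space :: (real \<times> (real ^ 'd)) measure"] by simp

text \<open>The coupling sends the part \<open>eta j \<cdot> \<mu>\<close> of \<open>\<mu>\<close> independently to the model measure of the same
cell. Two labels in one cell are at distance less than \<open>2 \<delta>\<close>, a state and its centre at distance less than
\<open>\<delta>\<close>, which gives \<open>5 \<delta>\<^sup>2\<close>; a state outside the ball of radius \<open>R\<close> may instead be sent to
the origin, at a cost of at most \<open>(norm z)\<^sup>2\<close>.\<close>

lemma W2_recon_moments:
  assumes mu: "\<mu> \<in> Mlam lam" and tau: "\<tau> \<ge> 0"
    and tail: "(\<integral>\<^sup>+ z. ennreal (if R < norm (snd z) then (norm z)\<^sup>2 else 0) \<partial>\<mu>) \<le> ennreal \<tau>"
  shows "W2 \<mu> (recon (moments \<mu>)) \<le> sqrt (5 * \<delta>\<^sup>2 + \<tau>)"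
proof -
  let ?S = "state_space :: (real \<times> (real ^ 'd)) measure"
  have P2: "\<mu> \<in> P2" using mu Mlam_subset_P2 by blast
  interpret prob_space \<mu> by (rule P2_D(3)[OF P2])
  note sets_mu = P2_D(1)[OF P2] and space_mu = P2_D(2)[OF P2]
  note cong = measurable_cong_sets[OF sets_mu refl]
  note adm = moments_admissible[OF mu]
  have eta_m: "(\<lambda>z. ennreal (eta j z)) \<in> borel_measurable \<mu>" for j
    unfolding cong using eta_measurable'[of j] by (rule measurable_compose) (rule measurable_ennreal)
  define m where "m j = density \<mu> (\<lambda>z. ennreal (eta j z))" for j
  have sets_m: "sets (m j) = sets ?S" for j unfolding m_def sets_density by (rule sets_mu)
  have space_m: "space (m j) = state_set" for j unfolding m_def space_density by (rule space_mu)
  have em: "emeasure (m j) E = (\<integral>\<^sup>+ z. ennreal (eta j z) * indicator E z \<partial>\<mu>)" if "E \<in> sets ?S" for j E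
    unfolding m_def by (rule emeasure_density[OF eta_m]) (use that sets_mu in blast)
  have m_state: "emeasure (m j) state_set = ennreal (moments \<mu> j)" if j: "j < J" for j
  proof -
    have "emeasure (m j) state_set = (\<integral>\<^sup>+ z. ennreal (eta j z) \<partial>\<mu>)"
      unfolding em[OF measurable_state] by (rule nn_integral_cong) (simp add: space_mu)
    also have "\<dots> = ennreal (\<integral>z. eta j z \<partial>\<mu>)"
    proof (rule nn_integral_eq_integral)
      show "integrable \<mu> (eta j)"
      proof (rule integrable_const_bound[where B = 1])
        show "AE z in \<mu>. norm (eta j z) \<le> 1"
          by (rule AE_I2) (simp add: eta0 eta_le1[OF j])
      qed (unfold cong, rule eta_measurable')
    qed (simp add: eta0)
    finally show ?thesis using j by (simp add: moments_def)
  qed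
  have m_le1: "emeasure (m j) state_set \<le> 1" if "j < J" for j
    unfolding m_state[OF that] using admissibleD(2)[OF adm, of j] by (simp add: ennreal_le_1)
  \<comment> \<open>In a null cell the model measure is zero, but there \<open>\<mu>\<close> has no mass either.\<close>
  have m_cell_model: "emeasure (m j) E * emeasure (cell_model j) state_set = emeasure (m j) E" if E: "E \<in> sets ?S" and j: "j < J" for j E
  proof (cases "cell_mass (fst (pt j)) = 0")
    case True
    let ?F = "{i \<in> {..<J}. fst (pt i) = fst (pt j)}"
    have "moments \<mu> j \<le> (\<Sum>i\<in>?F. moments \<mu> i)"
      using j admissibleD(1)[OF adm] by (intro member_le_sum) auto
    also have "\<dots> = 0" using admissibleD(4)[OF adm pt_in(1)[OF j]] True by simp
    finally have "emeasure (m j) state_set = 0" using m_state[OF j] by (simp add: ennreal_neg)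
    moreover have "emeasure (m j) E \<le> emeasure (m j) state_set"
      using sets.sets_into_space[OF E] by (intro emeasure_mono) (auto simp: sets_m)
    ultimately show ?thesis by simp
  next
    case False
    then show ?thesis using emeasure_cell_model_state[OF j] by simp
  qed
  have pair: "emeasure (m j \<Otimes>\<^sub>M cell_model j) (A \<times> B) = emeasure (m j) A * emeasure (cell_model j) B"
    if "A \<in> sets ?S" "B \<in> sets ?S" "j < J" for A B j
  proof -
    interpret K: subprob_space "cell_model j" by (rule subprob_cell_model[OF that(3)])
    show ?thesis using that by (intro K.emeasure_pair_measure_Times) (simp_all add: sets_m)
  qed
  show ?thesis
  proof (rule W2_le_mixture_coupling[where I = "{..<J}" and m = "\<lambda>j. m j \<Otimes>\<^sub>M cell_model j"])
    show "finite {..<J}" "{..<J} \<noteq> {}" using J_pos by auto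
    show "\<mu> \<in> P2" by (rule P2)
    show "recon (moments \<mu>) \<in> P2" using recon_in_Mlam[OF adm] Mlam_subset_P2 by blast
    show "0 \<le> 5 * \<delta>\<^sup>2 + \<tau>" using tau by simp
    show "sets (m j \<Otimes>\<^sub>M cell_model j) = sets (?S \<Otimes>\<^sub>M ?S)" for j
      by (rule sets_pair_measure_cong[OF sets_m sets_cell_model])
    show "subprob_space (m j \<Otimes>\<^sub>M cell_model j)" if "j \<in> {..<J}" for j
    proof (rule subprob_spaceI)
      have j: "j < J" using that by simp
      show "emeasure (m j \<Otimes>\<^sub>M cell_model j) (space (m j \<Otimes>\<^sub>M cell_model j)) \<le> 1"
        unfolding space_pair_measure space_m space_cell_model pair[OF measurable_state measurable_state j]
          m_cell_model[OF measurable_state j] by (rule m_le1[OF j])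
      show "space (m j \<Otimes>\<^sub>M cell_model j) \<noteq> {}"
        unfolding space_pair_measure space_m space_cell_model by (auto simp: state_set_def)
    qed
    show "(\<Sum>j<J. emeasure (m j \<Otimes>\<^sub>M cell_model j) (E \<times> state_set)) = emeasure \<mu> E" if E: "E \<in> sets ?S" for E
    proof -
      have "(\<Sum>j<J. emeasure (m j \<Otimes>\<^sub>M cell_model j) (E \<times> state_set))
          = (\<Sum>j<J. \<integral>\<^sup>+ z. ennreal (eta j z) * indicator E z \<partial>\<mu>)"
        using E by (intro sum.cong refl) (simp add: pair m_cell_model em[symmetric])
      also have "\<dots> = (\<integral>\<^sup>+ z. (\<Sum>j<J. ennreal (eta j z) * indicator E z) \<partial>\<mu>)"
        using E sets_mu by (intro nn_integral_sum[symmetric] borel_measurable_times_ennreal eta_m borel_measurable_indicator) blast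
      also have "\<dots> = (\<integral>\<^sup>+ z. indicator E z \<partial>\<mu>)"
      proof (rule nn_integral_cong)
        fix z
        have "(\<Sum>j<J. ennreal (eta j z)) = 1"
          using eta0 by (subst sum_ennreal) (simp_all add: sum_eta)
        then show "(\<Sum>j<J. ennreal (eta j z) * indicator E z) = indicator E z"
          by (simp add: sum_distrib_right[symmetric])
      qed
      also have "\<dots> = emeasure \<mu> E" using E sets_mu by (intro nn_integral_indicator) blast
      finally show ?thesis .
    qed
    show "(\<Sum>j<J. emeasure (m j \<Otimes>\<^sub>M cell_model j) (state_set \<times> E)) = emeasure (recon (moments \<mu>)) E"
      if E: "E \<in> sets ?S" for E
      unfolding emeasure_recon[OF adm E] using E by (intro sum.cong refl) (simp add: pair m_state)
    define b :: "real \<times> (real ^ 'd) \<Rightarrow> ennreal"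
      where "b z = ennreal (5 * \<delta>\<^sup>2) + ennreal (if R < norm (snd z) then (norm z)\<^sup>2 else 0)" for z
    have b_m: "b \<in> borel_measurable borel"
      unfolding b_def by (intro borel_measurable_add borel_measurable_const tail_measurable)
    have b_mu: "b \<in> borel_measurable \<mu>"
      unfolding cong by (rule measurable_compose[OF measurable_ident_state_space b_m])
    have inner: "(\<integral>\<^sup>+ v. ennreal ((dist z v)\<^sup>2) \<partial>cell_model j) \<le> b z"
      if z: "z \<in> state_set" and j: "j < J" and nz: "eta j z \<noteq> 0" for z j
    proof -
      let ?p = "fst (pt j)" and ?c = "snd (pt j)"
      have d_m: "(\<lambda>v. ennreal ((dist z v)\<^sup>2)) \<in> borel_measurable ?S" by measurable
      have zu: "fst z \<in> {0..1}" using z by (auto simp: state_set_def)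
      have zp: "dist (fst z) ?p < \<delta>"
        using nz by (intro psi_supp pt_in j zu) (auto simp: eta_def)
      have zc: "dist (snd z) ?c < \<delta> \<or> (?c = 0 \<and> R < norm (snd z))"
        using nz by (intro chi_supp pt_in j) (auto simp: eta_def)
      have "(\<integral>\<^sup>+ v. ennreal ((dist z v)\<^sup>2) \<partial>cell_model j)
          = (\<integral>\<^sup>+ u. ennreal ((dist z (u, ?c))\<^sup>2) * ennreal (psi ?p u / cell_mass ?p) \<partial>lam)"
        by (rule nn_integral_cell_model[OF d_m])
      also have "\<dots> \<le> (\<integral>\<^sup>+ u. b z * ennreal (psi ?p u / cell_mass ?p) \<partial>lam)"
      proof (rule nn_integral_mono)
        fix u assume "u \<in> space lam"
        then have u: "u \<in> {0..1}" by (simp add: space_lam)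
        show "ennreal ((dist z (u, ?c))\<^sup>2) * ennreal (psi ?p u / cell_mass ?p) \<le> b z * ennreal (psi ?p u / cell_mass ?p)"
        proof (cases "psi ?p u = 0")
          case False
          have "dist u ?p < \<delta>" by (rule psi_supp[OF pt_in(1)[OF j] u False])
          then have "dist (fst z) u < 2 * \<delta>"
            using zp dist_triangle2[of "fst z" u ?p] by simp
          then have 1: "(dist (fst z) u)\<^sup>2 \<le> 4 * \<delta>\<^sup>2"
            using power_mono[of "dist (fst z) u" "2 * \<delta>" 2] by (simp add: power_mult_distrib)
          have 2: "(dist (snd z) ?c)\<^sup>2 \<le> \<delta>\<^sup>2 + (if R < norm (snd z) then (norm z)\<^sup>2 else 0)"
          proof (cases "dist (snd z) ?c < \<delta>")
            case True
            then have "(dist (snd z) ?c)\<^sup>2 \<le> \<delta>\<^sup>2" by (intro power_mono) auto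
            then show ?thesis by (simp add: add_increasing2)
          next
            case far: False
            then have "(dist (snd z) ?c)\<^sup>2 \<le> (norm z)\<^sup>2"
              using zc norm_snd_le[of "snd z" "fst z"] by (intro power_mono) auto
            then show ?thesis using zc far by (simp add: add_increasing)
          qed
          have "(dist z (u, ?c))\<^sup>2 = (dist (fst z) u)\<^sup>2 + (dist (snd z) ?c)\<^sup>2"
            by (simp add: dist_prod_def)
          also have "\<dots> \<le> 5 * \<delta>\<^sup>2 + (if R < norm (snd z) then (norm z)\<^sup>2 else 0)"
            using 1 2 by linarith
          finally have "ennreal ((dist z (u, ?c))\<^sup>2)
              \<le> ennreal (5 * \<delta>\<^sup>2 + (if R < norm (snd z) then (norm z)\<^sup>2 else 0))"
            by (rule ennreal_leI)
          also have "\<dots> = b z" unfolding b_def by (rule ennreal_plus) auto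
          finally have "ennreal ((dist z (u, ?c))\<^sup>2) \<le> b z" .
          then show ?thesis by (rule mult_right_mono) simp
        qed simp
      qed
      also have "\<dots> = (\<integral>\<^sup>+ v. b z \<partial>cell_model j)"
        by (rule nn_integral_cell_model[symmetric]) (rule borel_measurable_const)
      also have "\<dots> \<le> b z * 1"
        unfolding nn_integral_const space_cell_model using emeasure_cell_model_state[OF j] by (intro mult_left_mono) auto
      finally show ?thesis by simp
    qed
    have "(\<Sum>j<J. \<integral>\<^sup>+ (z, v). ennreal ((dist z v)\<^sup>2) \<partial>(m j \<Otimes>\<^sub>M cell_model j))
        \<le> (\<Sum>j<J. \<integral>\<^sup>+ z. ennreal (eta j z) * b z \<partial>\<mu>)"
    proof (rule sum_mono)
      fix j assume "j \<in> {..<J}"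
      then have j: "j < J" by simp
      interpret K: subprob_space "cell_model j" by (rule subprob_cell_model[OF j])
      have d_m: "(\<lambda>(z, v). ennreal ((dist z v)\<^sup>2)) \<in> borel_measurable (m j \<Otimes>\<^sub>M cell_model j)"
        unfolding measurable_cong_sets[OF sets_pair_measure_cong[OF sets_m sets_cell_model] refl]
        by (rule measurable_sq_dist)
      have i_m: "(\<lambda>z. \<integral>\<^sup>+ v. ennreal ((dist z v)\<^sup>2) \<partial>cell_model j) \<in> borel_measurable \<mu>"
        using K.borel_measurable_nn_integral_fst[OF d_m]
        by (simp add: measurable_cong_sets[OF sets_m refl] cong)
      have "(\<integral>\<^sup>+ (z, v). ennreal ((dist z v)\<^sup>2) \<partial>(m j \<Otimes>\<^sub>M cell_model j))
          = (\<integral>\<^sup>+ z. (\<integral>\<^sup>+ v. ennreal ((dist z v)\<^sup>2) \<partial>cell_model j) \<partial>m j)"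
        using K.nn_integral_fst[OF d_m] by simp
      also have "\<dots> = (\<integral>\<^sup>+ z. ennreal (eta j z) * (\<integral>\<^sup>+ v. ennreal ((dist z v)\<^sup>2) \<partial>cell_model j) \<partial>\<mu>)"
        unfolding m_def by (rule nn_integral_density[OF eta_m i_m])
      also have "\<dots> \<le> (\<integral>\<^sup>+ z. ennreal (eta j z) * b z \<partial>\<mu>)"
      proof (rule nn_integral_mono)
        fix z assume "z \<in> space \<mu>"
        then have z: "z \<in> state_set" by (simp add: space_mu)
        show "ennreal (eta j z) * (\<integral>\<^sup>+ v. ennreal ((dist z v)\<^sup>2) \<partial>cell_model j) \<le> ennreal (eta j z) * b z"
          using inner[OF z j] by (cases "eta j z = 0") (auto intro: mult_left_mono)
      qed
      finally show "(\<integral>\<^sup>+ (z, v). ennreal ((dist z v)\<^sup>2) \<partial>(m j \<Otimes>\<^sub>M cell_model j)) \<le> (\<integral>\<^sup>+ z. ennreal (eta j z) * b z \<partial>\<mu>)" .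
    qed
    also have "\<dots> = (\<integral>\<^sup>+ z. (\<Sum>j<J. ennreal (eta j z) * b z) \<partial>\<mu>)"
      by (intro nn_integral_sum[symmetric] borel_measurable_times_ennreal eta_m b_mu)
    also have "\<dots> = (\<integral>\<^sup>+ z. b z \<partial>\<mu>)"
    proof (rule nn_integral_cong)
      fix z
      have "(\<Sum>j<J. ennreal (eta j z)) = 1"
        using eta0 by (subst sum_ennreal) (simp_all add: sum_eta)
      then show "(\<Sum>j<J. ennreal (eta j z) * b z) = b z"
        by (simp add: sum_distrib_right[symmetric])
    qed
    also have "\<dots> = ennreal (5 * \<delta>\<^sup>2) + (\<integral>\<^sup>+ z. ennreal (if R < norm (snd z) then (norm z)\<^sup>2 else 0) \<partial>\<mu>)"
    proof -
      show ?thesis unfolding b_def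
        by (subst nn_integral_add)
           (auto simp: emeasure_space_1 cong measurable_compose[OF measurable_ident_state_space tail_measurable])
    qed
    also have "\<dots> \<le> ennreal (5 * \<delta>\<^sup>2) + ennreal \<tau>" by (rule add_left_mono[OF tail])
    also have "\<dots> = ennreal (5 * \<delta>\<^sup>2 + \<tau>)" using tau by (simp add: ennreal_plus)
    finally show "(\<Sum>j<J. \<integral>\<^sup>+ (z, v). ennreal ((dist z v)\<^sup>2) \<partial>(m j \<Otimes>\<^sub>M cell_model j)) \<le> ennreal (5 * \<delta>\<^sup>2 + \<tau>)" .
  qed
qed

text \<open>A bound for the squared distance of any two points that carry reconstructed mass.\<close>

definition diam2 :: real where "diam2 = 1 + (\<Sum>c\<in>CX. \<Sum>c'\<in>CX. (dist c c')\<^sup>2)"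

lemma sq_dist_le_diam2:
  fixes u u' :: real
  assumes "u \<in> {0..1}" "u' \<in> {0..1}" "c \<in> CX" "c' \<in> CX"
  shows "(dist (u, c) (u', c'))\<^sup>2 \<le> diam2"
proof -
  have "(dist c c')\<^sup>2 \<le> (\<Sum>c'\<in>CX. (dist c c')\<^sup>2)"
    using assms fin by (intro member_le_sum) auto
  also have "\<dots> \<le> (\<Sum>c\<in>CX. \<Sum>c'\<in>CX. (dist c c')\<^sup>2)"
    using assms fin by (intro member_le_sum[where f = "\<lambda>c. \<Sum>c'\<in>CX. (dist c c')\<^sup>2"] sum_nonneg) auto
  finally have c: "(dist c c')\<^sup>2 \<le> (\<Sum>c\<in>CX. \<Sum>c'\<in>CX. (dist c c')\<^sup>2)" .
  have "\<bar>u - u'\<bar> \<le> 1" using assms by auto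
  then have "(dist u u')\<^sup>2 \<le> 1" by (simp add: dist_real_def abs_square_le_1)
  then show ?thesis using c by (simp add: dist_prod_def diam2_def)
qed

lemma diam2_pos: "diam2 > 0"
  unfolding diam2_def by (intro add_pos_nonneg sum_nonneg) auto

text \<open>If \<open>y'\<close> dominates \<open>(1 - t) y\<close>, then \<open>y' = (1 - t) y + t y2\<close> with \<open>y2\<close> admissible. All but a
fraction \<open>t\<close> of the mass may then stay in place, and the rest travels a bounded distance.\<close>

lemma W2_recon_le:
  assumes y: "y \<in> admissible" and y': "y' \<in> admissible" and t: "0 < t" "t \<le> 1"
    and dom: "\<And>j. j < J \<Longrightarrow> (1 - t) * y j \<le> y' j"
  shows "W2 (recon y) (recon y') \<le> sqrt (t * diam2)"
proof -
  let ?S = "state_space :: (real \<times> (real ^ 'd)) measure"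
  define y2 where "y2 j = (y' j - (1 - t) * y j) / t" for j
  have y2_0: "y2 j \<ge> 0" for j
    using dom[of j] admissibleD(3)[OF y, of j] admissibleD(3)[OF y', of j] t
    by (cases "j < J") (auto simp: y2_def)
  have comb: "y' j = (1 - t) * y j + t * y2 j" for j using t by (simp add: y2_def)
  have y2: "y2 \<in> admissible"
  proof -
    have "(\<Sum>j\<in>{j \<in> {..<J}. fst (pt j) = p}. y2 j) = cell_mass p" if p: "p \<in> CU" for p
    proof -
      have "(\<Sum>j\<in>{j \<in> {..<J}. fst (pt j) = p}. y2 j)
        = ((\<Sum>j\<in>{j \<in> {..<J}. fst (pt j) = p}. y' j) - (1 - t) * (\<Sum>j\<in>{j \<in> {..<J}. fst (pt j) = p}. y j)) / t"
        unfolding y2_def by (simp only: sum_divide_distrib[symmetric] sum_subtractf sum_distrib_left[symmetric])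
      also have "\<dots> = cell_mass p" unfolding admissibleD(4)[OF y p] admissibleD(4)[OF y' p] using t by (simp add: field_simps)
      finally show ?thesis .
    qed
    then show ?thesis
      using y2_0 admissibleD(3)[OF y] admissibleD(3)[OF y'] by (auto simp: admissible_def y2_def)
  qed
  have recon_comb: "emeasure (recon y') E = ennreal (1 - t) * emeasure (recon y) E + ennreal t * emeasure (recon y2) E"
    if E: "E \<in> sets ?S" for E
  proof -
    have "ennreal (y' j) = ennreal (1 - t) * ennreal (y j) + ennreal t * ennreal (y2 j)" for j
      unfolding comb[of j] using t y2_0[of j] admissibleD(1)[OF y, of j]
      by (simp add: ennreal_plus ennreal_mult)
    then show ?thesis
      unfolding emeasure_recon[OF y E] emeasure_recon[OF y' E] emeasure_recon[OF y2 E]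
      by (simp add: distrib_right sum.distrib sum_distrib_left mult.assoc)
  qed
  have P: "recon y \<in> P2" "recon y' \<in> P2" "recon y2 \<in> P2"
    using recon_in_Mlam y y' y2 Mlam_subset_P2 by blast+
  interpret A: prob_space "recon y" by (rule recon_prob[OF y])
  interpret B: prob_space "recon y2" by (rule recon_prob[OF y2])
  have A1: "emeasure (recon y) state_set = 1" using A.emeasure_space_1 unfolding space_recon[OF y] .
  have B1: "emeasure (recon y2) state_set = 1" using B.emeasure_space_1 unfolding space_recon[OF y2] .
  define diag where "diag = distr (recon y) (?S \<Otimes>\<^sub>M ?S) (\<lambda>z. (z, z))"
  define prd where "prd = recon y \<Otimes>\<^sub>M recon y2"
  have diag_m: "(\<lambda>z. (z, z)) \<in> measurable (recon y) (?S \<Otimes>\<^sub>M ?S)"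
    unfolding measurable_cong_sets[OF sets_recon[OF y] refl] by (intro measurable_Pair measurable_ident_sets[OF refl])
  have sets_diag: "sets diag = sets (?S \<Otimes>\<^sub>M ?S)" unfolding diag_def by simp
  have sets_prd: "sets prd = sets (?S \<Otimes>\<^sub>M ?S)"
    unfolding prd_def by (rule sets_pair_measure_cong[OF sets_recon[OF y] sets_recon[OF y2]])
  have diag_e: "emeasure diag (E \<times> F) = emeasure (recon y) (E \<inter> F)" if "E \<in> sets ?S" "F \<in> sets ?S" for E F
  proof -
    have "(\<lambda>z. (z, z)) -` (E \<times> F) \<inter> space (recon y) = E \<inter> F"
      using sets.sets_into_space[OF that(1)] by (auto simp: space_recon[OF y])
    then show ?thesis unfolding diag_def using that by (subst emeasure_distr[OF diag_m]) auto
  qed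
  have prd_e: "emeasure prd (E \<times> F) = emeasure (recon y) E * emeasure (recon y2) F" if "E \<in> sets ?S" "F \<in> sets ?S" for E F
    unfolding prd_def using that sets_recon[OF y] sets_recon[OF y2] by (intro B.emeasure_pair_measure_Times) blast+
  have into: "E \<inter> state_set = E" "state_set \<inter> E = E" if "E \<in> sets ?S" for E
    using sets.sets_into_space[OF that] by auto
  let ?m = "\<lambda>b. if b then scale_measure (ennreal t) prd else scale_measure (ennreal (1 - t)) diag"
  show ?thesis
  proof (rule W2_le_mixture_coupling[where I = "UNIV :: bool set" and m = ?m])
    show "recon y \<in> P2" "recon y' \<in> P2" by (rule P)+
    show "0 \<le> t * diam2" using t diam2_pos by simp
    show "sets (?m b) = sets (?S \<Otimes>\<^sub>M ?S)" for b using sets_diag sets_prd by simp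
    have sp: "space prd = state_set \<times> state_set" "space diag = state_set \<times> state_set"
      using sets_eq_imp_space_eq[OF sets_prd] sets_eq_imp_space_eq[OF sets_diag] by (simp_all add: space_pair_measure)
    show "subprob_space (?m b)" for b
    proof (rule subprob_spaceI)
      show "space (?m b) \<noteq> {}" using sp by (auto simp: space_scale_measure state_set_def)
      show "emeasure (?m b) (space (?m b)) \<le> 1"
        using t by (auto simp: space_scale_measure sp prd_e diag_e A1 B1 ennreal_le_1)
    qed
    show "(\<Sum>b\<in>UNIV. emeasure (?m b) (E \<times> state_set)) = emeasure (recon y) E" if E: "E \<in> sets ?S" for E
    proof -
      have "ennreal t * emeasure (recon y) E + ennreal (1 - t) * emeasure (recon y) E = emeasure (recon y) E"
        using t by (simp add: distrib_right[symmetric] ennreal_plus[symmetric] del: ennreal_plus)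
      then show ?thesis using E by (simp add: UNIV_bool prd_e diag_e B1 into add.commute)
    qed
    show "(\<Sum>b\<in>UNIV. emeasure (?m b) (state_set \<times> E)) = emeasure (recon y') E" if E: "E \<in> sets ?S" for E
      using E by (simp add: UNIV_bool prd_e diag_e A1 into recon_comb add.commute)
    have d_prd: "(\<lambda>(z, v). ennreal ((dist z v)\<^sup>2)) \<in> borel_measurable prd"
      and d_diag: "(\<lambda>(z, v). ennreal ((dist z v)\<^sup>2)) \<in> borel_measurable diag"
      using measurable_sq_dist[where 'd = 'd]
      unfolding measurable_cong_sets[OF sets_prd refl] measurable_cong_sets[OF sets_diag refl] by blast+
    have "(\<integral>\<^sup>+ (z, v). ennreal ((dist z v)\<^sup>2) \<partial>diag) = 0"
      unfolding diag_def by (subst nn_integral_distr[OF diag_m]) (use measurable_sq_dist[where 'd = 'd] in auto)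
    moreover have "(\<integral>\<^sup>+ (z, v). ennreal ((dist z v)\<^sup>2) \<partial>prd) \<le> ennreal diam2"
    proof -
      have i_m: "(\<lambda>z. \<integral>\<^sup>+ v. ennreal ((dist z v)\<^sup>2) \<partial>recon y2) \<in> borel_measurable ?S"
        using B.borel_measurable_nn_integral_fst[OF d_prd[unfolded prd_def]]
        by (simp add: measurable_cong_sets[OF sets_recon[OF y] refl])
      have "(\<integral>\<^sup>+ (z, v). ennreal ((dist z v)\<^sup>2) \<partial>prd) = (\<integral>\<^sup>+ z. (\<integral>\<^sup>+ v. ennreal ((dist z v)\<^sup>2) \<partial>recon y2) \<partial>recon y)"
        unfolding prd_def using B.nn_integral_fst[OF d_prd[unfolded prd_def]] by simp
      also have "\<dots> \<le> ennreal diam2"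
      proof (rule nn_integral_recon_le[OF y i_m], rule nn_integral_recon_le[OF y2])
        show "(\<lambda>v. ennreal ((dist z v)\<^sup>2)) \<in> borel_measurable ?S" for z by measurable
      qed (intro ennreal_leI sq_dist_le_diam2)
      finally show ?thesis .
    qed
    ultimately show "(\<Sum>b\<in>UNIV. \<integral>\<^sup>+ (z, v). ennreal ((dist z v)\<^sup>2) \<partial>?m b) \<le> ennreal (t * diam2)"
      using d_prd d_diag t diam2_pos
      by (simp add: UNIV_bool nn_integral_scale_measure ennreal_mult mult_left_mono)
  qed simp_all
qed

text \<open>Near \<open>y\<close> every admissible \<open>y'\<close> dominates \<open>(1 - t) y\<close>: this is an open condition on the
finitely many coordinates where \<open>y\<close> is positive, and automatic on the others.\<close>

lemma continuous_map_recon: "continuous_map (top_of_set admissible) (W2_topology lam) recon"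
  unfolding continuous_map_def
proof (intro conjI allI impI)
  show "recon \<in> topspace (top_of_set admissible) \<rightarrow> topspace (W2_topology lam)"
    using recon_in_Mlam by (auto simp: topspace_W2_topology)
  fix U :: "(real \<times> (real ^ 'd)) measure set" assume U: "openin (W2_topology lam) U"
  show "openin (top_of_set admissible) {y \<in> topspace (top_of_set admissible). recon y \<in> U}"
  proof (subst openin_subopen, intro ballI)
    fix y assume "y \<in> {y \<in> topspace (top_of_set admissible). recon y \<in> U}"
    then have y: "y \<in> admissible" and yU: "recon y \<in> U" by auto
    then obtain r where r: "r > 0" "\<And>\<nu>. \<nu> \<in> Mlam lam \<Longrightarrow> W2 (recon y) \<nu> < r \<Longrightarrow> \<nu> \<in> U"
      using U unfolding openin_W2_topology by blast
    \<comment> \<open>Chosen such that the bound \<open>sqrt (t * diam2)\<close> of the previous lemma is below \<open>r\<close>.\<close>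
    define t where "t = min 1 (r\<^sup>2 / (2 * diam2))"
    have t: "0 < t" "t \<le> 1" using r(1) diam2_pos by (auto simp: t_def)
    have "t * diam2 \<le> r\<^sup>2 / (2 * diam2) * diam2" using diam2_pos by (intro mult_right_mono) (auto simp: t_def)
    also have "\<dots> = r\<^sup>2 / 2" using diam2_pos by simp
    also have "\<dots> < r\<^sup>2" using r(1) by simp
    finally have tr: "sqrt (t * diam2) < r" using r(1) real_less_lsqrt by (simp add: real_less_lsqrt)
    define N where "N = {y'. \<forall>j\<in>{j \<in> {..<J}. y j > 0}. (1 - t) * y j < y' j}"
    have "open N"
    proof -
      have "N = (\<Inter>j\<in>{j \<in> {..<J}. y j > 0}. {y'. (1 - t) * y j < y' j})" by (auto simp: N_def)
      also have "open \<dots>" by (intro open_INT ballI open_Collect_less continuous_on_const continuous_on_product_coordinates) auto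
      finally show ?thesis .
    qed
    then have "openin (top_of_set admissible) (admissible \<inter> N)" by (rule openin_open_Int)
    moreover have "y \<in> admissible \<inter> N"
    proof -
      have "(1 - t) * y j < y j" if "y j > 0" for j using that t by (simp add: algebra_simps)
      then show ?thesis using y by (auto simp: N_def)
    qed
    moreover have "admissible \<inter> N \<subseteq> {y \<in> topspace (top_of_set admissible). recon y \<in> U}"
    proof
      fix y' assume y'N: "y' \<in> admissible \<inter> N"
      then have y': "y' \<in> admissible" by simp
      have "(1 - t) * y j \<le> y' j" if "j < J" for j
        using y'N that admissibleD(1)[OF y, of j] admissibleD(1)[OF y', of j]
        by (cases "y j > 0") (auto simp: N_def less_imp_le)
      then have "W2 (recon y) (recon y') \<le> sqrt (t * diam2)" by (rule W2_recon_le[OF y y' t])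
      then show "y' \<in> {y \<in> topspace (top_of_set admissible). recon y \<in> U}"
        using r(2)[OF recon_in_Mlam[OF y']] tr y' by simp
    qed
    ultimately show "\<exists>T. openin (top_of_set admissible) T \<and> y \<in> T \<and> T \<subseteq> {y \<in> topspace (top_of_set admissible). recon y \<in> U}"
      by blast
  qed
qed

lemma compact_admissible: "compact admissible"
proof -
  have "compactin (product_topology (\<lambda>_. euclideanreal) UNIV) (PiE (UNIV :: nat set) (\<lambda>_. {0..1::real}))"
    unfolding compactin_PiE by auto
  then have c: "compact (PiE (UNIV :: nat set) (\<lambda>_. {0..1::real}))"
    unfolding euclidean_product_topology by simp
  have "admissible = (\<Inter>j. {y. 0 \<le> y j}) \<inter> (\<Inter>j\<in>{J..}. {y. y j = 0}) \<inter>
      (\<Inter>p\<in>CU. {y. (\<Sum>j\<in>{j \<in> {..<J}. fst (pt j) = p}. y j) = cell_mass p})"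
    by (auto simp: admissible_def)
  also have "closed \<dots>"
    by (intro closed_Int closed_INT ballI closed_Collect_le closed_Collect_eq continuous_on_const
        continuous_on_sum continuous_on_product_coordinates)
  finally have "closed admissible" .
  moreover have "admissible = PiE UNIV (\<lambda>_. {0..1}) \<inter> admissible"
    using admissibleD(1,2) by auto
  ultimately show ?thesis using compact_Int_closed[OF c] by metis
qed

end

section \<open>Tanh networks and exponential sums\<close>

text \<open>With \<open>q = exp (t - 2 c)\<close> the unit equals \<open>exp t / (1 + q)\<close>, and its distance from \<open>exp t\<close> is at most \<open>exp t \<cdot> q\<close>.\<close>

lemma exp_tanh_error:
  fixes t c :: real
  shows "\<bar>exp (2 * c) / 2 * tanh (t / 2 - c) + exp (2 * c) / 2 - exp t\<bar> \<le> exp (2 * t - 2 * c)"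
proof -
  define q where "q = exp (t - 2 * c)"
  have q: "q > 0" by (simp add: q_def)
  have ct: "exp (2 * c) * q = exp t" by (simp add: q_def exp_add[symmetric])
  have "exp (- 2 * (t / 2 - c)) = 1 / q"
    by (simp add: q_def exp_minus[symmetric] inverse_eq_divide[symmetric])
  then have tanh_q: "tanh (t / 2 - c) = (1 - 1 / q) / (1 + 1 / q)"
    unfolding tanh_real_altdef by simp
  have "tanh (t / 2 - c) = (q - 1) / (q + 1)"
    unfolding tanh_q using q by (simp add: divide_simps)
  then have "exp (2 * c) / 2 * tanh (t / 2 - c) + exp (2 * c) / 2 = exp (2 * c) / 2 * ((q - 1) / (q + 1) + 1)"
    by (simp add: distrib_left)
  also have "\<dots> = exp (2 * c) * q / (q + 1)" using q by (simp add: divide_simps)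
  finally have "exp (2 * c) / 2 * tanh (t / 2 - c) + exp (2 * c) / 2 - exp t = - (exp t * q / (q + 1))"
    using q unfolding ct by (simp add: field_simps)
  then have "\<bar>exp (2 * c) / 2 * tanh (t / 2 - c) + exp (2 * c) / 2 - exp t\<bar> = exp t * q / (q + 1)"
    using q by simp
  also have "\<dots> \<le> exp t * q" using q by (simp add: field_simps)
  also have "\<dots> = exp (2 * t - 2 * c)" by (simp add: q_def exp_add[symmetric])
  finally show ?thesis .
qed

lemma exp_tanh_approx:
  fixes M e :: real
  assumes e: "e > 0"
  shows "\<exists>\<alpha> \<beta>. \<forall>t\<le>M. \<bar>\<alpha> * tanh (t / 2 + \<beta>) + \<alpha> - exp t\<bar> \<le> e"
proof -
  \<comment> \<open>The error bound \<open>exp (2 * M - 2 * c)\<close> then equals \<open>e\<close>.\<close>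
  define c where "c = M - ln e / 2"
  show ?thesis
  proof (intro exI allI impI)
    fix t :: real assume t: "t \<le> M"
    have "\<bar>exp (2 * c) / 2 * tanh (t / 2 - c) + exp (2 * c) / 2 - exp t\<bar> \<le> exp (2 * t - 2 * c)"
      by (rule exp_tanh_error)
    also have "\<dots> \<le> exp (ln e)" using t by (simp add: c_def)
    finally show "\<bar>exp (2 * c) / 2 * tanh (t / 2 + - c) + exp (2 * c) / 2 - exp t\<bar> \<le> e" using e by simp
  qed
qed

definition squash :: "real \<times> (real ^ 'd) \<Rightarrow> real \<times> (real ^ 'd)" where
  "squash z = (tanh (fst z), \<chi> i. tanh (vec_nth (snd z) i))"

lemma coord_vec_dim [simp]: "coord_vec (x :: real ^ 'n) \<in> carrier_vec CARD('n)"
  by (simp add: coord_vec_def)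

lemma coord_sum:
  "(\<Sum>i<CARD('n). f (from_nat_into (UNIV :: 'n set) i)) = (\<Sum>i\<in>(UNIV :: 'n::finite set). f i)"
  by (rule sum.reindex_bij_betw[OF bij_betw_from_nat_into_finite]) simp

lemma coord_vec_scalar_prod:
  fixes a x :: "real ^ 'n"
  shows "scalar_prod (coord_vec a) (coord_vec x) = inner a x"
  using coord_sum[of "\<lambda>i. vec_nth a i * vec_nth x i"]
  by (simp add: scalar_prod_def coord_vec_def inner_vec_def atLeast0LessThan)

lemma map_coord_vec: "map_vec tanh (coord_vec x) = coord_vec (\<chi> i. tanh (vec_nth x i))"
  by (rule eq_vecI) (auto simp: coord_vec_def)

lemma map_vCons: "map_vec f (vCons a v) = vCons (f a) (map_vec f v)"
  by (rule eq_vecI) (auto simp: vec_index_vCons)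

text \<open>The first hidden layer is the identity matrix followed by tanh, which is \<open>squash\<close> in coordinates; the second has
a single unit.\<close>

lemma trunk_net_two_layer:
  fixes a :: "real \<times> (real ^ 'd)"
  shows "trunk_net (\<lambda>z. \<alpha> * tanh (inner a (squash z) + \<beta>) + \<gamma>)"
proof -
  let ?n = "1 + CARD('d)"
  define av where "av = vCons (fst a) (coord_vec (snd a))"
  have av: "av \<in> carrier_vec ?n" by (simp add: av_def)
  define A1 where "A1 = Matrix.mat 1 ?n (\<lambda>(i, j). vec_index av j)"
  define A2 where "A2 = Matrix.mat 1 1 (\<lambda>(i :: nat, j :: nat). \<alpha>)"
  define N where "N = (\<lambda>v. A2 *\<^sub>v map_vec tanh (A1 *\<^sub>v map_vec tanh (1\<^sub>m ?n *\<^sub>v v + 0\<^sub>v ?n) + Matrix.vec 1 (\<lambda>_. \<beta>)) + Matrix.vec 1 (\<lambda>_. \<gamma>))"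
  have net: "tanh_net ?n 1 N"
    unfolding N_def
    by (rule tanh_net.layer[OF tanh_net.layer[OF tanh_net.affine]]) (auto simp: A1_def A2_def)
  have "\<alpha> * tanh (inner a (squash (u, x)) + \<beta>) + \<gamma> = vec_index (N (vCons u (coord_vec x))) 0" for u and x :: "real ^ 'd"
  proof -
    define s where "s = map_vec tanh (vCons u (coord_vec x))"
    have s: "s = vCons (tanh u) (coord_vec (\<chi> i. tanh (vec_nth x i)))"
      by (simp add: s_def map_vCons map_coord_vec)
    have sd: "s \<in> carrier_vec ?n" by (simp add: s)
    have id: "1\<^sub>m ?n *\<^sub>v vCons u (coord_vec x) + 0\<^sub>v ?n = vCons u (coord_vec x)"
      by (subst one_mult_mat_vec) (auto intro!: right_zero_vec)
    have row: "Matrix.row A1 0 = av"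
      using av by (intro eq_vecI) (auto simp: A1_def)
    have "scalar_prod av s = inner a (squash (u, x))"
      by (simp add: av_def s squash_def inner_prod_def coord_vec_scalar_prod scalar_prod_vCons)
    then have i1: "vec_index (A1 *\<^sub>v s) 0 = inner a (squash (u, x))"
      using row by (simp add: mult_mat_vec_def A1_def)
    have l1: "map_vec tanh (A1 *\<^sub>v s + Matrix.vec 1 (\<lambda>_. \<beta>)) = Matrix.vec 1 (\<lambda>_. tanh (inner a (squash (u, x)) + \<beta>))"
      using i1 by (intro eq_vecI) (auto simp: A1_def)
    have "N (vCons u (coord_vec x)) = A2 *\<^sub>v Matrix.vec 1 (\<lambda>_. tanh (inner a (squash (u, x)) + \<beta>)) + Matrix.vec 1 (\<lambda>_. \<gamma>)"
      unfolding N_def id s_def[symmetric] l1 ..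
    then show ?thesis by (simp add: A2_def scalar_prod_def)
  qed
  then show ?thesis unfolding trunk_net_def using net by (intro exI[of _ N]) auto
qed

lemma branch_net_one_layer:
  fixes i :: "'q::finite"
  shows "branch_net J (\<lambda>v. (\<alpha> * tanh ((\<Sum>j<J. b j * vec_index v j) + \<beta>) + \<gamma>) *\<^sub>R (axis i 1 :: real ^ 'q))"
proof -
  define A1 where "A1 = Matrix.mat 1 J (\<lambda>(i :: nat, j). b j)"
  define ax where "ax = coord_vec (axis i 1 :: real ^ 'q)"
  have ax: "ax \<in> carrier_vec CARD('q)" by (simp add: ax_def)
  define A2 where "A2 = Matrix.mat CARD('q) 1 (\<lambda>(k, j :: nat). \<alpha> * vec_index ax k)"
  define N where "N = (\<lambda>v. A2 *\<^sub>v map_vec tanh (A1 *\<^sub>v v + Matrix.vec 1 (\<lambda>_. \<beta>)) + \<gamma> \<cdot>\<^sub>v ax)"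
  have net: "tanh_net J CARD('q) N"
    unfolding N_def
    by (rule tanh_net.layer[OF tanh_net.affine]) (use ax in \<open>auto simp: A1_def A2_def\<close>)
  have "coord_vec ((\<alpha> * tanh ((\<Sum>j<J. b j * vec_index v j) + \<beta>) + \<gamma>) *\<^sub>R (axis i 1 :: real ^ 'q)) = N v"
    if v: "v \<in> carrier_vec J" for v
  proof -
    have i1: "vec_index (A1 *\<^sub>v v) 0 = (\<Sum>j<J. b j * vec_index v j)"
      using v by (simp add: A1_def mult_mat_vec_def scalar_prod_def atLeast0LessThan)
    have l1: "map_vec tanh (A1 *\<^sub>v v + Matrix.vec 1 (\<lambda>_. \<beta>)) = Matrix.vec 1 (\<lambda>_. tanh ((\<Sum>j<J. b j * vec_index v j) + \<beta>))"
      using i1 by (intro eq_vecI) (auto simp: A1_def)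
    show ?thesis
      unfolding N_def l1
      using ax by (intro eq_vecI) (auto simp: A2_def scalar_prod_def ax_def coord_vec_def algebra_simps)
  qed
  then show ?thesis unfolding branch_net_def using net by (intro exI[of _ N]) auto
qed

text \<open>Functions of trunk-branch form, with the vector of moments represented by a sequence because sequences carry a
topology. Continuity is recorded for measurability, and \<open>r \<ge> 1\<close> because the theorem asks for it.\<close>

definition net_sum :: "nat \<Rightarrow> (real \<times> (real ^ 'd) \<Rightarrow> (nat \<Rightarrow> real) \<Rightarrow> real ^ 'q) \<Rightarrow> bool" where
  "net_sum J F \<longleftrightarrow> continuous_on UNIV (\<lambda>p. F (fst p) (snd p)) \<and>
     (\<exists>(r::nat) T B. 1 \<le> r \<and> (\<forall>k<r. trunk_net (T k) \<and> branch_net J (B k)) \<and>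
       (\<forall>z y. F z y = (\<Sum>k<r. T k z *\<^sub>R B k (Matrix.vec J y))))"

lemma net_sum_add:
  fixes F G :: "real \<times> (real ^ 'd) \<Rightarrow> (nat \<Rightarrow> real) \<Rightarrow> real ^ 'q"
  assumes "net_sum J F" "net_sum J G"
  shows "net_sum J (\<lambda>z y. F z y + G z y)"
proof -
  obtain r :: nat and T B where F: "r \<ge> 1" "\<And>k. k < r \<Longrightarrow> trunk_net (T k) \<and> branch_net J (B k)"
    "\<And>z y. F z y = (\<Sum>k<r. T k z *\<^sub>R B k (Matrix.vec J y))"
    and Fc: "continuous_on UNIV (\<lambda>p. F (fst p) (snd p))"
    using assms(1) unfolding net_sum_def by blast
  obtain r' :: nat and T' B' where G: "\<And>k. k < r' \<Longrightarrow> trunk_net (T' k) \<and> branch_net J (B' k)"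
    "\<And>z y. G z y = (\<Sum>k<r'. T' k z *\<^sub>R B' k (Matrix.vec J y))"
    and Gc: "continuous_on UNIV (\<lambda>p. G (fst p) (snd p))"
    using assms(2) unfolding net_sum_def by blast
  let ?T = "\<lambda>k. if k < r then T k else T' (k - r)" and ?B = "\<lambda>k. if k < r then B k else B' (k - r)"
  have sum_split: "(\<Sum>k<r + n. h k) = (\<Sum>k<r. h k) + (\<Sum>k<n. h (r + k))" for h :: "nat \<Rightarrow> real ^ 'q" and n
    by (induction n) (auto simp: add.assoc)
  have "F z y + G z y = (\<Sum>k<r + r'. ?T k z *\<^sub>R ?B k (Matrix.vec J y))" for z y
  proof -
    have "(\<Sum>k<r + r'. ?T k z *\<^sub>R ?B k (Matrix.vec J y))
      = (\<Sum>k<r. ?T k z *\<^sub>R ?B k (Matrix.vec J y)) + (\<Sum>k<r'. ?T (r + k) z *\<^sub>R ?B (r + k) (Matrix.vec J y))"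
      by (rule sum_split)
    then show ?thesis by (simp add: F(3) G(2))
  qed
  then show ?thesis
    unfolding net_sum_def using F G
    by (intro conjI exI[of _ "r + r'"] exI[of _ ?T] exI[of _ ?B] continuous_on_add Fc Gc) auto
qed

text \<open>The linear span of the exponentials of linear forms. It is an algebra by the functional equation of \<open>exp\<close>, whereas a
product of networks need not be a network; so Stone-Weierstrass is applied to these functions, and
only the result is replaced by networks.\<close>

inductive exp_sum :: "nat \<Rightarrow> ((real \<times> (real ^ 'd)) \<times> (nat \<Rightarrow> real) \<Rightarrow> real) \<Rightarrow> bool" for J where
  single: "exp_sum J (\<lambda>p. c * exp (inner a (fst p) + (\<Sum>j<J. b j * snd p j)))"
| add: "exp_sum J f \<Longrightarrow> exp_sum J g \<Longrightarrow> exp_sum J (\<lambda>p. f p + g p)"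

lemma exp_sum_mult:
  assumes "exp_sum J f" "exp_sum J g"
  shows "exp_sum J (\<lambda>p. f p * g p)"
  using assms
proof (induction f rule: exp_sum.induct)
  case (single c a b)
  from single show ?case
  proof (induction g rule: exp_sum.induct)
    case (single c' a' b')
    have "exp_sum J (\<lambda>p. (c * c') * exp (inner (a + a') (fst p) + (\<Sum>j<J. (b j + b' j) * snd p j)))"
      by (rule exp_sum.single)
    moreover have "(c * c') * exp (inner (a + a') (fst p) + (\<Sum>j<J. (b j + b' j) * snd p j))
        = c * exp (inner a (fst p) + (\<Sum>j<J. b j * snd p j)) * (c' * exp (inner a' (fst p) + (\<Sum>j<J. b' j * snd p j)))" for p
    proof -
      have "inner (a + a') (fst p) + (\<Sum>j<J. (b j + b' j) * snd p j)
          = (inner a (fst p) + (\<Sum>j<J. b j * snd p j)) + (inner a' (fst p) + (\<Sum>j<J. b' j * snd p j))"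
        by (simp add: inner_add_left distrib_right sum.distrib)
      then show ?thesis by (simp only: exp_add mult_ac)
    qed
    ultimately show ?case by simp
  next
    case (add f g)
    then show ?case by (simp add: distrib_left exp_sum.add)
  qed
next
  case (add f g)
  then show ?case by (simp add: distrib_right exp_sum.add)
qed

lemma continuous_coordinate: "continuous_on S (\<lambda>p :: ('a::topological_space) \<times> (nat \<Rightarrow> real). snd p j)"
  by (rule continuous_on_compose2[OF continuous_on_product_coordinates[of j] continuous_on_snd[OF continuous_on_id]]) simp

lemma continuous_on_exp_sum: "exp_sum J f \<Longrightarrow> continuous_on S f"
  by (induction rule: exp_sum.induct) (intro continuous_intros continuous_coordinate)+

text \<open>A set containing all admissible sequences; the linear forms in the branch exponentials are bounded on it.\<close>

definition moment_box :: "nat \<Rightarrow> (nat \<Rightarrow> real) set" where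
  "moment_box J = {y. (\<forall>j. 0 \<le> y j \<and> y j \<le> 1) \<and> (\<forall>j\<ge>J. y j = 0)}"

lemma squash_bound: "norm (squash (z :: real \<times> (real ^ 'd))) \<le> 1 + CARD('d)"
proof -
  have "norm (squash z) \<le> \<bar>tanh (fst z)\<bar> + norm (\<chi> i. tanh (vec_nth (snd z) i))"
    unfolding squash_def using norm_Pair_le[of "tanh (fst z)"] by simp
  also have "\<bar>tanh (fst z)\<bar> \<le> 1" using tanh_real_bounds[of "fst z"] by auto
  also have "norm (\<chi> i. tanh (vec_nth (snd z) i)) \<le> (\<Sum>i\<in>UNIV. \<bar>tanh (vec_nth (snd z) i)\<bar>)"
    using norm_le_l1_cart[of "\<chi> i. tanh (vec_nth (snd z) i)"] by simp
  also have "\<dots> \<le> (\<Sum>i\<in>(UNIV :: 'd set). 1)"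
    by (rule sum_mono) (metis abs_le_iff greaterThanLessThan_iff less_imp_le minus_le_iff tanh_real_bounds)
  finally show ?thesis by simp
qed

lemma continuous_squash: "continuous_on S (\<lambda>z. squash (z :: real \<times> (real ^ 'd)))"
  unfolding squash_def
  by (intro continuous_intros continuous_on_vec_lambda) auto

text \<open>The exponential factorises into one of \<open>squash z\<close> and one of \<open>y\<close>. Both exponents are bounded, the first one for
all \<open>z\<close>, so each factor is uniformly close to a single tanh unit.\<close>

lemma exp_term_net_approx:
  fixes a :: "real \<times> (real ^ 'd)" and i :: "'q::finite"
  assumes e: "e > 0"
  shows "\<exists>F :: _ \<Rightarrow> _ \<Rightarrow> real ^ 'q. net_sum J F \<and> (\<forall>z. \<forall>y\<in>moment_box J.
    norm (F z y - (c * exp (inner a (squash z) + (\<Sum>j<J. b j * y j))) *\<^sub>R axis i 1) \<le> e)"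
proof -
  define M1 where "M1 = norm a * (1 + CARD('d))"
  define M2 where "M2 = (\<Sum>j<J. \<bar>b j\<bar>)"
  have t1: "inner a (squash z) \<le> M1" for z
  proof -
    have "inner a (squash z) \<le> norm a * norm (squash z)" by (rule norm_cauchy_schwarz)
    also have "\<dots> \<le> M1" unfolding M1_def by (intro mult_left_mono squash_bound) auto
    finally show ?thesis .
  qed
  have t2: "(\<Sum>j<J. b j * y j) \<le> M2" if "y \<in> moment_box J" for y
    unfolding M2_def
  proof (rule sum_mono)
    fix j
    have "0 \<le> y j" "y j \<le> 1" using that by (auto simp: moment_box_def)
    then have "\<bar>b j\<bar> * y j \<le> \<bar>b j\<bar> * 1" by (intro mult_left_mono) auto
    moreover have "b j * y j \<le> \<bar>b j\<bar> * y j" using \<open>0 \<le> y j\<close> by (intro mult_right_mono) auto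
    ultimately show "b j * y j \<le> \<bar>b j\<bar>" by simp
  qed
  define L where "L = \<bar>c\<bar> * (exp M1 + exp M2 + 1) + 1"
  have L: "L > 0" unfolding L_def by (intro add_nonneg_pos mult_nonneg_nonneg add_nonneg_nonneg) auto
  define d where "d = min 1 (e / L)"
  have d: "0 < d" "d \<le> 1" "d * L \<le> e" using e L by (auto simp: d_def min_def field_simps)
  obtain \<alpha> \<beta> where T: "\<And>t. t \<le> M1 \<Longrightarrow> \<bar>\<alpha> * tanh (t / 2 + \<beta>) + \<alpha> - exp t\<bar> \<le> d"
    using exp_tanh_approx[OF d(1), of M1] by blast
  obtain \<alpha>' \<beta>' where B: "\<And>t. t \<le> M2 \<Longrightarrow> \<bar>\<alpha>' * tanh (t / 2 + \<beta>') + \<alpha>' - exp t\<bar> \<le> d"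
    using exp_tanh_approx[OF d(1), of M2] by blast
  define Tn where "Tn z = \<alpha> * tanh (inner (a /\<^sub>R 2) (squash z) + \<beta>) + \<alpha>" for z
  define Bn where "Bn v = (c * \<alpha>' * tanh ((\<Sum>j<J. (b j / 2) * vec_index v j) + \<beta>') + c * \<alpha>') *\<^sub>R (axis i 1 :: real ^ 'q)" for v
  have tn: "trunk_net Tn" unfolding Tn_def by (rule trunk_net_two_layer)
  have bn: "branch_net J Bn" unfolding Bn_def by (rule branch_net_one_layer)
  define F where "F z y = Tn z *\<^sub>R Bn (Matrix.vec J y)" for z y
  have Bn_vec: "Bn (Matrix.vec J y) = (c * (\<alpha>' * tanh ((\<Sum>j<J. b j * y j) / 2 + \<beta>') + \<alpha>')) *\<^sub>R axis i 1" for y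
  proof -
    have "(\<Sum>j<J. (b j / 2) * vec_index (Matrix.vec J y) j) = (\<Sum>j<J. b j * y j) / 2"
      by (simp add: sum_divide_distrib)
    then show ?thesis by (simp add: Bn_def distrib_left mult.assoc)
  qed
  have cont: "continuous_on UNIV (\<lambda>p. F (fst p) (snd p))"
    unfolding F_def Bn_vec Tn_def
    by (intro continuous_intros continuous_coordinate continuous_on_compose2[OF continuous_squash[of UNIV]]) auto
  have "net_sum J F"
    unfolding net_sum_def using cont tn bn
    by (intro conjI exI[of _ 1] exI[of _ "\<lambda>_. Tn"] exI[of _ "\<lambda>_. Bn"]) (auto simp: F_def)
  moreover have "norm (F z y - (c * exp (inner a (squash z) + (\<Sum>j<J. b j * y j))) *\<^sub>R axis i 1) \<le> e"
    if y: "y \<in> moment_box J" for z y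
  proof -
    define s where "s = inner a (squash z)"
    define t where "t = (\<Sum>j<J. b j * y j)"
    define \<tau> where "\<tau> = \<alpha> * tanh (s / 2 + \<beta>) + \<alpha>"
    define \<eta> where "\<eta> = \<alpha>' * tanh (t / 2 + \<beta>') + \<alpha>'"
    have s1: "\<bar>\<tau> - exp s\<bar> \<le> d" unfolding \<tau>_def by (rule T) (simp add: s_def t1)
    have s2: "\<bar>\<eta> - exp t\<bar> \<le> d" unfolding \<eta>_def by (rule B) (simp add: t_def t2[OF y])
    have e1: "exp s \<le> exp M1" using t1[of z] by (simp add: s_def)
    have e2: "exp t \<le> exp M2" using t2[OF y] by (simp add: t_def)
    have "inner (a /\<^sub>R 2) (squash z) = s / 2" by (simp add: s_def)
    then have "Tn z = \<tau>" unfolding Tn_def \<tau>_def by simp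
    then have "F z y = (c * (\<tau> * \<eta>)) *\<^sub>R axis i 1"
      unfolding F_def Bn_vec \<eta>_def t_def by (simp add: mult.left_commute)
    then have "F z y - (c * exp (s + t)) *\<^sub>R axis i 1 = (c * (\<tau> * \<eta> - exp s * exp t)) *\<^sub>R axis i 1"
      by (simp add: exp_add right_diff_distrib scaleR_diff_left)
    then have "norm (F z y - (c * exp (s + t)) *\<^sub>R axis i 1) = \<bar>c\<bar> * \<bar>\<tau> * \<eta> - exp s * exp t\<bar>"
      by (simp add: abs_mult norm_axis_1)
    also have "\<dots> \<le> \<bar>c\<bar> * (d * (exp M2 + 1) + exp M1 * d)"
    proof (rule mult_left_mono)
      have eta_le: "\<bar>\<eta>\<bar> \<le> exp M2 + 1" using s2 e2 d(2) exp_gt_zero[of t] by linarith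
      have "\<tau> * \<eta> - exp s * exp t = (\<tau> - exp s) * \<eta> + exp s * (\<eta> - exp t)" by (simp add: algebra_simps)
      moreover
      have "\<bar>\<tau> - exp s\<bar> * \<bar>\<eta>\<bar> \<le> d * (exp M2 + 1)" using eta_le s1 d by (intro mult_mono) auto
      moreover have "exp s * \<bar>\<eta> - exp t\<bar> \<le> exp M1 * d" using s2 e1 d by (intro mult_mono) auto
      moreover have "\<bar>(\<tau> - exp s) * \<eta> + exp s * (\<eta> - exp t)\<bar> \<le> \<bar>\<tau> - exp s\<bar> * \<bar>\<eta>\<bar> + exp s * \<bar>\<eta> - exp t\<bar>"
        using abs_triangle_ineq[of "(\<tau> - exp s) * \<eta>" "exp s * (\<eta> - exp t)"] by (simp add: abs_mult)
      ultimately show "\<bar>\<tau> * \<eta> - exp s * exp t\<bar> \<le> d * (exp M2 + 1) + exp M1 * d" by linarith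
    qed simp
    also have "\<bar>c\<bar> * (d * (exp M2 + 1) + exp M1 * d) = d * (\<bar>c\<bar> * (exp M1 + exp M2 + 1))" by (simp add: algebra_simps)
    also have "\<dots> \<le> d * L" using d by (intro mult_left_mono) (auto simp: L_def)
    finally show ?thesis using d(3) by (simp add: s_def t_def mult_left_mono)
  qed
  ultimately show ?thesis by blast
qed

lemma exp_sum_net_approx:
  fixes f :: "(real \<times> (real ^ 'd)) \<times> (nat \<Rightarrow> real) \<Rightarrow> real" and i :: "'q::finite"
  assumes "exp_sum J f" "e > 0"
  shows "\<exists>F :: _ \<Rightarrow> _ \<Rightarrow> real ^ 'q. net_sum J F \<and> (\<forall>z. \<forall>y\<in>moment_box J.
    norm (F z y - f (squash z, y) *\<^sub>R axis i 1) \<le> e)"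
  using assms
proof (induction f arbitrary: e rule: exp_sum.induct)
  case (single c a b)
  then show ?case using exp_term_net_approx[of e J c a b i] by simp
next
  case (add f g)
  then have "e / 2 > 0" by simp
  obtain F :: "real \<times> (real ^ 'd) \<Rightarrow> _ \<Rightarrow> real ^ 'q" where F: "net_sum J F"
    "\<And>z y. y \<in> moment_box J \<Longrightarrow> norm (F z y - f (squash z, y) *\<^sub>R axis i 1) \<le> e / 2"
    using add.IH(1)[OF \<open>e / 2 > 0\<close>] by blast
  obtain G :: "real \<times> (real ^ 'd) \<Rightarrow> _ \<Rightarrow> real ^ 'q" where G: "net_sum J G"
    "\<And>z y. y \<in> moment_box J \<Longrightarrow> norm (G z y - g (squash z, y) *\<^sub>R axis i 1) \<le> e / 2"
    using add.IH(2)[OF \<open>e / 2 > 0\<close>] by blast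
  have "norm (F z y + G z y - (f (squash z, y) + g (squash z, y)) *\<^sub>R axis i 1) \<le> e" if "y \<in> moment_box J" for z y
  proof -
    have "F z y + G z y - (f (squash z, y) + g (squash z, y)) *\<^sub>R axis i 1
        = (F z y - f (squash z, y) *\<^sub>R axis i 1) + (G z y - g (squash z, y) *\<^sub>R axis i 1)"
      by (simp add: scaleR_add_left)
    also have "norm \<dots> \<le> e"
      by (rule norm_triangle_le) (use F(2)[OF that, of z] G(2)[OF that, of z] in linarith)
    finally show ?thesis .
  qed
  then show ?case using net_sum_add[OF F(1) G(1)] by blast
qed

lemma net_sum_sum:
  assumes "finite I" "I \<noteq> {}" "\<And>i. i \<in> I \<Longrightarrow> net_sum J (F i)"
  shows "net_sum J (\<lambda>z y. \<Sum>i\<in>I. F i z y)"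
  using assms by (induction I rule: finite_ne_induct) (auto intro: net_sum_add)

lemma net_sum_dense:
  fixes G :: "(real \<times> (real ^ 'd)) \<times> (nat \<Rightarrow> real) \<Rightarrow> real ^ 'q"
  assumes S: "compact S" "range squash \<subseteq> S" and K: "compact K" "K \<subseteq> moment_box J"
    and G: "continuous_on (S \<times> K) G" and e: "e > 0"
  shows "\<exists>F. net_sum J F \<and> (\<forall>z. \<forall>y\<in>K. norm (F z y - G (squash z, y)) \<le> e)"
proof -
  define e' where "e' = e / (2 * real CARD('q))"
  have e': "e' > 0" using e by (simp add: e'_def)
  have "\<forall>i. \<exists>f. exp_sum J f \<and> (\<forall>p\<in>S \<times> K. \<bar>vec_nth (G p) i - f p\<bar> < e')"
  proof (rule allI, rule Stone_Weierstrass_HOL)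
    show "compact (S \<times> K)" using S K by (intro compact_Times)
    show "exp_sum J (\<lambda>p. c)" for c using exp_sum.single[of J c 0 "\<lambda>_. 0"] by simp
    show "continuous_on (S \<times> K) f" if "exp_sum J f" for f by (rule continuous_on_exp_sum[OF that])
    show "exp_sum J (\<lambda>p. f p + g p)" if "exp_sum J f \<and> exp_sum J g" for f g using that exp_sum.add by blast
    show "exp_sum J (\<lambda>p. f p * g p)" if "exp_sum J f \<and> exp_sum J g" for f g using that exp_sum_mult by blast
    show "continuous_on (S \<times> K) (\<lambda>p. vec_nth (G p) i)" for i by (rule bounded_linear.continuous_on[OF bounded_linear_vec_nth G])
    show "\<exists>f. exp_sum J f \<and> f p \<noteq> f p'" if pp: "p \<in> S \<times> K \<and> p' \<in> S \<times> K \<and> p \<noteq> p'"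
      for p p' :: "(real \<times> (real ^ 'd)) \<times> (nat \<Rightarrow> real)"
    proof (cases "fst p = fst p'")
      case False
      let ?a = "fst p - fst p'"
      have "inner ?a ?a \<noteq> 0" using False by simp
      then have "inner ?a (fst p) \<noteq> inner ?a (fst p')" by (simp add: inner_diff_right)
      then show ?thesis
        by (intro exI[of _ "\<lambda>p. 1 * exp (inner ?a (fst p) + (\<Sum>j<J. 0 * snd p j))"] conjI exp_sum.single) simp
    next
      case True
      then have "snd p \<noteq> snd p'" using pp by (auto simp: prod_eq_iff)
      then obtain j where j: "snd p j \<noteq> snd p' j" by blast
      have "j < J"
      proof (rule ccontr)
        assume "\<not> j < J"
        then have "snd p j = 0" "snd p' j = 0" using pp K(2) by (auto simp: moment_box_def subset_iff)
        then show False using j by simp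
      qed
      then have "(\<Sum>k<J. (if k = j then 1 else 0) * snd r k) = snd r j" for r :: "(real \<times> (real ^ 'd)) \<times> (nat \<Rightarrow> real)"
        by (simp add: if_distrib[of "\<lambda>x. x * _"] cong: if_cong)
      then show ?thesis using j
        by (intro exI[of _ "\<lambda>p. 1 * exp (inner 0 (fst p) + (\<Sum>k<J. (if k = j then 1 else 0) * snd p k))"]
            conjI exp_sum.single) simp
    qed
  qed (rule e')
  from choice[OF this] obtain f where f: "\<And>i. exp_sum J (f i)"
    "\<And>i p. p \<in> S \<times> K \<Longrightarrow> \<bar>vec_nth (G p) i - f i p\<bar> < e'"
    by blast
  have "\<forall>i. \<exists>F :: _ \<Rightarrow> _ \<Rightarrow> real ^ 'q. net_sum J F \<and> (\<forall>z. \<forall>y\<in>moment_box J.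
      norm (F z y - f i (squash z, y) *\<^sub>R axis i 1) \<le> e')"
    using exp_sum_net_approx[OF f(1) e'] by blast
  from choice[OF this] obtain F where F: "\<And>i. net_sum J (F i)"
    "\<And>i z y. y \<in> moment_box J \<Longrightarrow> norm (F i z y - f i (squash z, y) *\<^sub>R (axis i 1 :: real ^ 'q)) \<le> e'"
    by blast
  have "norm ((\<Sum>i\<in>UNIV. F i z y) - G (squash z, y)) \<le> e" if y: "y \<in> K" for z y
  proof -
    let ?p = "(squash z, y)"
    have p: "?p \<in> S \<times> K" using y S(2) by auto
    have "G ?p = (\<Sum>i\<in>UNIV. vec_nth (G ?p) i *\<^sub>R axis i 1)"
      using basis_expansion[of "G ?p"] by (simp add: scalar_mult_eq_scaleR)
    then have "(\<Sum>i\<in>UNIV. F i z y) - G ?p = (\<Sum>i\<in>UNIV. F i z y - vec_nth (G ?p) i *\<^sub>R axis i 1)"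
      by (simp add: sum_subtractf)
    also have "norm \<dots> \<le> (\<Sum>i\<in>(UNIV :: 'q set). 2 * e')"
    proof (rule sum_norm_le)
      fix i :: 'q
      have "F i z y - vec_nth (G ?p) i *\<^sub>R axis i 1
        = (F i z y - f i ?p *\<^sub>R axis i 1) + (f i ?p - vec_nth (G ?p) i) *\<^sub>R axis i 1"
        by (simp add: scaleR_diff_left)
      also have "norm \<dots> \<le> e' + \<bar>f i ?p - vec_nth (G ?p) i\<bar>"
        using F(2)[of y i z] y K(2) by (intro norm_triangle_le add_mono) (auto simp: norm_axis_1)
      also have "\<dots> \<le> 2 * e'" using f(2)[OF p, of i] by (simp add: abs_minus_commute)
      finally show "norm (F i z y - vec_nth (G ?p) i *\<^sub>R axis i 1) \<le> 2 * e'" .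
    qed
    also have "\<dots> = e" by (simp add: e'_def)
    finally show ?thesis .
  qed
  moreover have "net_sum J (\<lambda>z y. \<Sum>i\<in>UNIV. F i z y)"
    using F(1) by (intro net_sum_sum) auto
  ultimately show ?thesis by (intro exI conjI allI ballI)
qed

section \<open>Approximation by finitely many moments\<close>

text \<open>A continuous left inverse of \<open>squash\<close> on the states of norm at most \<open>n\<close>. The inner truncations keep
the argument of \<open>artanh\<close> away from \<open>\<plusminus>1\<close>, so that the map is continuous everywhere; the outer one forces
the label into the unit interval.\<close>

definition unsquash :: "nat \<Rightarrow> real \<times> (real ^ 'd) \<Rightarrow> real \<times> (real ^ 'd)" where
  "unsquash n s = (max 0 (min 1 (artanh (max 0 (min (tanh 1) (fst s))))),
     \<chi> i. artanh (max (- tanh (real n)) (min (tanh (real n)) (vec_nth (snd s) i))))"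

lemma unsquash_in_state: "unsquash n s \<in> state_set"
  by (auto simp: unsquash_def state_set_def)

lemma continuous_unsquash: "continuous_on S (unsquash n :: real \<times> (real ^ 'd) \<Rightarrow> _)"
proof -
  have "0 \<le> tanh (real n)" by simp
  then have b: "max (- tanh (real n)) (min (tanh (real n)) x) \<in> {-1<..<1}" for x
    using tanh_real_lt_1[of "real n"] tanh_real_gt_neg1[of "real n"] by (auto simp: max_def min_def)
  have "0 \<le> tanh (1 :: real)" by simp
  then have b': "max 0 (min (tanh 1) x) \<in> {-1<..<1 :: real}" for x
    using tanh_real_lt_1[of 1] by (auto simp: max_def min_def)
  have 1: "continuous_on S (\<lambda>s :: real \<times> (real ^ 'd). artanh (max 0 (min (tanh 1) (fst s))))"
    by (rule continuous_on_compose2[OF continuous_on_artanh[of "{-1<..<1}"]])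
       (use b' in \<open>auto intro!: continuous_intros\<close>)
  have 2: "continuous_on S (\<lambda>s :: real \<times> (real ^ 'd). artanh (max (- tanh (real n)) (min (tanh (real n)) (vec_nth (snd s) i))))" for i
  proof (rule continuous_on_compose2[OF continuous_on_artanh[of "{-1<..<1}"]])
    show "continuous_on S (\<lambda>s :: real \<times> (real ^ 'd). max (- tanh (real n)) (min (tanh (real n)) (vec_nth (snd s) i)))"
      by (intro continuous_on_max continuous_on_min continuous_on_const
          bounded_linear.continuous_on[OF bounded_linear_vec_nth] continuous_on_snd continuous_on_id)
  qed (use b in auto)
  show ?thesis unfolding unsquash_def
    by (intro continuous_on_Pair continuous_on_max continuous_on_min continuous_on_const 1 continuous_on_vec_lambda 2)
qed

lemma unsquash_squash:
  assumes z: "z \<in> state_set" and n: "norm z \<le> real n"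
  shows "unsquash n (squash z) = z"
proof (rule prod_eqI)
  have u: "fst z \<in> {0..1}" using z by (auto simp: state_set_def)
  then have "max 0 (min (tanh 1) (tanh (fst z))) = tanh (fst z)" by (auto simp: min_def max_def)
  then show "fst (unsquash n (squash z)) = fst z"
    using u by (simp add: unsquash_def squash_def artanh_tanh_real)
  have "\<bar>vec_nth (snd z) i\<bar> \<le> real n" for i
  proof -
    have "\<bar>vec_nth (snd z) i\<bar> \<le> norm (snd z)" by (rule component_le_norm_cart)
    also have "\<dots> \<le> norm z" using norm_snd_le[of "snd z" "fst z"] by simp
    finally show ?thesis using n by simp
  qed
  then have "- tanh (real n) \<le> tanh (vec_nth (snd z) i) \<and> tanh (vec_nth (snd z) i) \<le> tanh (real n)" for i
    unfolding tanh_minus[symmetric] tanh_real_le_iff by (metis abs_le_iff minus_le_iff)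
  then have "max (- tanh (real n)) (min (tanh (real n)) (tanh (vec_nth (snd z) i))) = tanh (vec_nth (snd z) i)" for i
    by (simp add: min_absorb2 max_absorb2)
  then show "snd (unsquash n (squash z)) = snd z"
    by (simp add: unsquash_def squash_def artanh_tanh_real)
qed

definition tail2 :: "real \<Rightarrow> (real \<times> (real ^ 'd)) measure \<Rightarrow> real" where
  "tail2 R \<mu> = enn2real (\<integral>\<^sup>+ z. ennreal (if R < norm (snd z) then (norm z)\<^sup>2 else 0) \<partial>\<mu>)"

lemma ennreal_tail2:
  assumes "\<mu> \<in> P2"
  shows "ennreal (tail2 R \<mu>) = (\<integral>\<^sup>+ z. ennreal (if R < norm (snd z) then (norm z)\<^sup>2 else 0) \<partial>\<mu>)"
proof -
  have "(\<integral>\<^sup>+ z. ennreal (if R < norm (snd z) then (norm z)\<^sup>2 else 0) \<partial>\<mu>) \<le> (\<integral>\<^sup>+ z. ennreal ((norm z)\<^sup>2) \<partial>\<mu>)"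
    by (rule nn_integral_mono) (auto intro: ennreal_leI)
  also have "\<dots> < \<infinity>" by (rule P2_D(4)[OF assms])
  finally show ?thesis unfolding tail2_def by (intro ennreal_enn2real) simp
qed

lemma tail2_tendsto_0:
  fixes \<mu> :: "(real \<times> (real ^ 'd)) measure"
  assumes mu: "\<mu> \<in> P2"
  shows "(\<lambda>n. tail2 (real n) \<mu>) \<longlonglongrightarrow> 0"
proof -
  note cong = measurable_cong_sets[OF P2_D(1)[OF mu] refl]
  have "(\<lambda>n. \<integral>\<^sup>+ z. ennreal (if real n < norm (snd z) then (norm z)\<^sup>2 else 0) \<partial>\<mu>) \<longlonglongrightarrow> (\<integral>\<^sup>+ z. 0 \<partial>\<mu>)"
  proof (rule nn_integral_dominated_convergence[where w = "\<lambda>z. ennreal ((norm z)\<^sup>2)"])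
    show "(\<lambda>z. ennreal (if real n < norm (snd z) then (norm z)\<^sup>2 else 0)) \<in> borel_measurable \<mu>" for n
      unfolding cong by (rule measurable_compose[OF measurable_ident_state_space tail_measurable])
    show "(\<lambda>z. ennreal ((norm z)\<^sup>2)) \<in> borel_measurable \<mu>"
      unfolding cong by measurable
    show "(\<integral>\<^sup>+ z. ennreal ((norm z)\<^sup>2) \<partial>\<mu>) < \<infinity>" by (rule P2_D(4)[OF mu])
    show "AE z in \<mu>. ennreal (if real n < norm (snd z) then (norm z)\<^sup>2 else 0) \<le> ennreal ((norm z)\<^sup>2)" for n
      by (intro AE_I2 ennreal_leI) auto
    show "AE z in \<mu>. (\<lambda>n. ennreal (if real n < norm (snd z) then (norm z)\<^sup>2 else 0)) \<longlonglongrightarrow> 0"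
    proof (intro AE_I2 tendsto_eventually)
      fix z :: "real \<times> (real ^ 'd)"
      obtain N :: nat where "norm (snd z) < real N" using reals_Archimedean2 by blast
      then have "\<not> real n < norm (snd z)" if "n \<ge> N" for n
        using that by (meson less_le_trans not_less of_nat_mono order_less_imp_le)
      then show "\<forall>\<^sub>F n in sequentially. ennreal (if real n < norm (snd z) then (norm z)\<^sup>2 else 0) = 0"
        unfolding eventually_sequentially by (intro exI[of _ N]) auto
    qed
  qed simp_all
  then show ?thesis unfolding tail2_def using tendsto_enn2real[of _ 0] by simp
qed

definition moment_seq :: "nat \<Rightarrow> (nat \<Rightarrow> 'a \<Rightarrow> real) \<Rightarrow> 'a measure \<Rightarrow> nat \<Rightarrow> real" where
  "moment_seq J \<phi> \<mu> j = (if j < J then integral\<^sup>L \<mu> (\<phi> j) else 0)"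

text \<open>One network at level \<open>n\<close>: it is uniformly close to \<open>W\<close> evaluated at a truncated state and at
a reconstructed measure. The conclusion keeps only what the limit needs: the truncation
leaves small states alone, and the reconstruction is near \<open>\<mu>\<close>.\<close>

lemma moment_net_approx:
  fixes lam :: "real measure"
    and W :: "(real \<times> (real ^ 'd)) \<times> (real \<times> (real ^ 'd)) measure \<Rightarrow> real ^ 'q" and n :: nat
  assumes lam: "prob_space lam" "sets lam = sets label_space"
    and W: "continuous_map (prod_topology (top_of_set state_set) (W2_topology lam)) euclidean W"
  shows "\<exists>J \<phi> F. J \<ge> 1 \<and> (\<forall>j<J. continuous_on UNIV (\<phi> j) \<and> (\<forall>z. 0 \<le> \<phi> j z \<and> \<phi> j z \<le> 1)) \<and> net_sum J F \<and>
    (\<forall>z\<in>state_set. \<forall>\<mu>\<in>Mlam lam. \<exists>z'\<in>state_set. \<exists>\<nu>\<in>Mlam lam. (norm z \<le> real n \<longrightarrow> z' = z) \<and>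
       W2 \<mu> \<nu> \<le> sqrt (5 * (1 / (real n + 1))\<^sup>2 + tail2 (real n) \<mu>) \<and>
       norm (F z (moment_seq J \<phi> \<mu>) - W (z', \<nu>)) \<le> 1 / (real n + 1))"
proof -
  define \<delta> where "\<delta> = 1 / (real n + 1)"
  have d: "\<delta> > 0" by (simp add: \<delta>_def)
  obtain CU psi where CU: "finite CU" "0 \<in> CU" "\<And>c. continuous_on UNIV (psi c)" "\<And>c x. (psi c x :: real) \<ge> 0"
    "\<And>x. (\<Sum>c\<in>CU. psi c x) = 1"
    "\<And>c x. c \<in> CU \<Longrightarrow> psi c x \<noteq> 0 \<Longrightarrow> dist x c < \<delta> \<or> (c = 0 \<and> x \<notin> {0..1::real})"
    by (rule partition_of_unity_centres[of "{0..1::real}" \<delta> 0, OF compact_Icc d]) (rule that)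
  obtain CX chi where CX: "finite CX" "0 \<in> CX" "\<And>c. continuous_on UNIV (chi c)" "\<And>c x. (chi c x :: real) \<ge> 0"
    "\<And>x. (\<Sum>c\<in>CX. chi c x) = 1"
    "\<And>c x. c \<in> CX \<Longrightarrow> chi c x \<noteq> 0 \<Longrightarrow> dist x c < \<delta> \<or> (c = 0 \<and> x \<notin> cball (0 :: real ^ 'd) (real n))"
    by (rule partition_of_unity_centres[of "cball (0 :: real ^ 'd) (real n)" \<delta> 0, OF compact_cball d]) (rule that)
  define J where "J = card (CU \<times> CX)"
  obtain pt where pt: "bij_betw pt {0..<J} (CU \<times> CX)"
    using ex_bij_betw_nat_finite[OF finite_cartesian_product[OF CU(1) CX(1)]] unfolding J_def by (elim exE)
  interpret finite_projection lam CU CX psi chi \<delta> "real n" J pt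
  proof (rule finite_projection.intro)
    show "prob_space lam" "sets lam = sets label_space" by (rule lam)+
    show "bij_betw pt {..<J} (CU \<times> CX)" using pt by (simp add: atLeast0LessThan)
    show "dist u p < \<delta>" if "p \<in> CU" "u \<in> {0..1}" "psi p u \<noteq> 0" for p u
      using CU(6)[OF that(1,3)] that(2) by blast
    show "dist x c < \<delta> \<or> (c = 0 \<and> real n < norm x)" if "c \<in> CX" "chi c x \<noteq> 0" for c x
      using CX(6)[OF that] by (simp add: not_le)
  qed (use CU CX d in auto)
  define S where "S = cball (0 :: real \<times> (real ^ 'd)) (1 + real CARD('d))"
  define G where "G p = W (unsquash n (fst p), recon (snd p))" for p
  have "continuous_on (S \<times> admissible) G"
  proof -
    have "continuous_map (top_of_set (S \<times> admissible)) (prod_topology (top_of_set state_set) (W2_topology lam))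
        (\<lambda>p. (unsquash n (fst p), recon (snd p)))"
    proof (rule continuous_map_pairedI)
      show "continuous_map (top_of_set (S \<times> admissible)) (top_of_set state_set) (\<lambda>p. unsquash n (fst p))"
        by (auto simp: continuous_map_in_subtopology unsquash_in_state
            intro!: continuous_on_compose2[OF continuous_unsquash[of UNIV]] continuous_on_fst continuous_on_id)
      have "continuous_map (top_of_set (S \<times> admissible)) (top_of_set admissible) snd"
        by (auto simp: continuous_map_in_subtopology intro!: continuous_on_snd continuous_on_id)
      from continuous_map_compose[OF this continuous_map_recon]
      show "continuous_map (top_of_set (S \<times> admissible)) (W2_topology lam) (\<lambda>p. recon (snd p))"
        by (simp add: o_def)
    qed
    from continuous_map_compose[OF this W] show ?thesis by (simp add: o_def G_def[abs_def])
  qed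
  moreover have "admissible \<subseteq> moment_box J"
    using admissibleD(1-3) by (auto simp: moment_box_def)
  moreover have "range squash \<subseteq> S"
    using squash_bound by (auto simp: S_def)
  moreover have "compact S" by (simp add: S_def)
  ultimately obtain F where F: "net_sum J F" "\<And>z y. y \<in> admissible \<Longrightarrow> norm (F z y - G (squash z, y)) \<le> \<delta>"
    using net_sum_dense[of S admissible J G \<delta>] compact_admissible d by blast
  have moments_eq: "moment_seq J eta \<mu> = moments \<mu>" for \<mu>
    by (rule ext) (simp add: moment_seq_def moments_def)
  have "\<exists>z'\<in>state_set. \<exists>\<nu>\<in>Mlam lam. (norm z \<le> real n \<longrightarrow> z' = z) \<and>
       W2 \<mu> \<nu> \<le> sqrt (5 * \<delta>\<^sup>2 + tail2 (real n) \<mu>) \<and>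
       norm (F z (moment_seq J eta \<mu>) - W (z', \<nu>)) \<le> \<delta>" if z: "z \<in> state_set" and mu: "\<mu> \<in> Mlam lam" for z \<mu>
  proof (intro bexI[of _ "unsquash n (squash z)"] bexI[of _ "recon (moments \<mu>)"] conjI impI)
    note adm = moments_admissible[OF mu]
    show "recon (moments \<mu>) \<in> Mlam lam" by (rule recon_in_Mlam[OF adm])
    show "unsquash n (squash z) \<in> state_set" by (rule unsquash_in_state)
    show "unsquash n (squash z) = z" if "norm z \<le> real n" by (rule unsquash_squash[OF z that])
    have P2: "\<mu> \<in> P2" using mu Mlam_subset_P2 by blast
    show "W2 \<mu> (recon (moments \<mu>)) \<le> sqrt (5 * \<delta>\<^sup>2 + tail2 (real n) \<mu>)"
      by (rule W2_recon_moments[OF mu]) (simp_all add: ennreal_tail2[OF P2], simp add: tail2_def)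
    show "norm (F z (moment_seq J eta \<mu>) - W (unsquash n (squash z), recon (moments \<mu>))) \<le> \<delta>"
      using F(2)[OF adm, of z] by (simp add: moments_eq G_def)
  qed
  moreover have "continuous_on UNIV (eta j)" for j
    unfolding eta_def
    by (intro continuous_on_mult continuous_on_compose2[OF psi_cont] continuous_on_compose2[OF chi_cont]
        continuous_on_fst continuous_on_snd continuous_on_id) auto
  ultimately show ?thesis
    using F(1) eta0 eta_le1 J_pos unfolding \<delta>_def
    by (intro exI[of _ J] exI[of _ eta] exI[of _ F]) auto
qed

section \<open>Density of the networks\<close>

definition clip :: "real \<Rightarrow> real ^ 'q \<Rightarrow> real ^ 'q" where
  "clip R v = (R / max R (norm v)) *\<^sub>R v"

lemma continuous_clip: "R > 0 \<Longrightarrow> continuous_on UNIV (clip R)"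
  unfolding clip_def by (intro continuous_intros) (auto simp: max_def)

lemma norm_clip: "R > 0 \<Longrightarrow> norm (clip R v) \<le> R"
  by (simp add: clip_def divide_simps mult_left_mono)

lemma clip_id: "R > 0 \<Longrightarrow> norm v \<le> R \<Longrightarrow> clip R v = v"
  by (simp add: clip_def max_absorb1)

lemma norm_diff_clip: "R > 0 \<Longrightarrow> norm (v - clip R v) \<le> norm v"
proof -
  assume R: "R > 0"
  define \<theta> where "\<theta> = R / max R (norm v)"
  have "0 \<le> \<theta>" "\<theta> \<le> 1" using R by (auto simp: \<theta>_def divide_simps)
  moreover have "v - clip R v = (1 - \<theta>) *\<^sub>R v" by (simp add: clip_def \<theta>_def scaleR_diff_left)
  ultimately show ?thesis by (simp add: mult_left_le_one_le)
qed

lemma net_value_measurable: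
  fixes F :: "real \<times> (real ^ 'd) \<Rightarrow> (nat \<Rightarrow> real) \<Rightarrow> real ^ 'q"
    and \<phi> :: "nat \<Rightarrow> real \<times> (real ^ 'd) \<Rightarrow> real"
  assumes F: "net_sum J F" and \<phi>: "\<And>j. j < J \<Longrightarrow> continuous_on UNIV (\<phi> j)"
  shows "(\<lambda>q. F (fst q) (moment_seq J \<phi> (snd q))) \<in> borel_measurable (state_space \<Otimes>\<^sub>M Mlam_borel lam)"
proof -
  let ?M = "state_space \<Otimes>\<^sub>M Mlam_borel lam :: ((real \<times> (real ^ 'd)) \<times> (real \<times> (real ^ 'd)) measure) measure"
  have m: "moment_seq J \<phi> \<in> borel_measurable (Mlam_borel lam :: (real \<times> (real ^ 'd)) measure measure)"
  proof (rule measurable_coordinatewise_then_product)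
    fix j
    show "(\<lambda>\<mu>. moment_seq J \<phi> \<mu> j) \<in> borel_measurable (Mlam_borel lam)"
    proof (cases "j < J")
      case True
      have "\<phi> j \<in> borel_measurable state_space"
        by (rule measurable_compose[OF measurable_ident_state_space borel_measurable_continuous_onI[OF \<phi>[OF True]]])
      from measurable_compose[OF measurable_evaluation_kernel integral_measurable_subprob_algebra[OF this]]
      show ?thesis using True by (simp add: moment_seq_def)
    qed (simp add: moment_seq_def)
  qed
  have pm: "(\<lambda>q. (fst q, moment_seq J \<phi> (snd q))) \<in> borel_measurable ?M"
    by (rule borel_measurable_Pair[OF measurable_compose[OF measurable_fst measurable_ident_state_space]
          measurable_compose[OF measurable_snd m]])
  have "(\<lambda>p. F (fst p) (snd p)) \<in> borel_measurable borel"
    using F unfolding net_sum_def by (intro borel_measurable_continuous_onI) blast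
  from measurable_compose[OF pm this] show ?thesis by simp
qed

text \<open>For large \<open>n\<close> the truncated state is \<open>z\<close> itself, so only continuity in the measure is used.\<close>

lemma net_approx_pointwise:
  fixes W :: "(real \<times> (real ^ 'd)) \<times> (real \<times> (real ^ 'd)) measure \<Rightarrow> real ^ 'q"
  assumes W: "continuous_map (prod_topology (top_of_set state_set) (W2_topology lam)) euclidean W"
    and z: "z \<in> state_set" and mu: "\<mu> \<in> Mlam lam"
    and f: "\<And>n. \<exists>z'\<in>state_set. \<exists>\<nu>\<in>Mlam lam. (norm z \<le> real n \<longrightarrow> z' = z) \<and>
       W2 \<mu> \<nu> \<le> sqrt (5 * (1 / (real n + 1))\<^sup>2 + tail2 (real n) \<mu>) \<and>
       norm (f n - W (z', \<nu>)) \<le> 1 / (real n + 1)"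
  shows "f \<longlonglongrightarrow> W (z, \<mu>)"
proof (rule LIMSEQ_I)
  fix e :: real assume e: "e > 0"
  let ?U = "{\<nu> \<in> Mlam lam. W (z, \<nu>) \<in> ball (W (z, \<mu>)) (e / 2)}"
  have "openin (W2_topology lam) ?U"
    using openin_continuous_map_preimage[OF continuous_map_sections(1)[OF W z], of "ball (W (z, \<mu>)) (e / 2)"]
    by (simp add: topspace_W2_topology)
  moreover have "\<mu> \<in> ?U" using mu e by simp
  ultimately obtain r where r: "r > 0" "\<And>\<nu>. \<nu> \<in> Mlam lam \<Longrightarrow> W2 \<mu> \<nu> < r \<Longrightarrow> \<nu> \<in> ?U"
    unfolding openin_W2_topology by blast
  have P2: "\<mu> \<in> P2" using mu Mlam_subset_P2 by blast
  have inv: "(\<lambda>n. 1 / (real n + 1)) \<longlonglongrightarrow> 0"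
    using LIMSEQ_inverse_real_of_nat by (simp add: inverse_eq_divide add.commute)
  have "(\<lambda>n. sqrt (5 * (1 / (real n + 1))\<^sup>2 + tail2 (real n) \<mu>)) \<longlonglongrightarrow> sqrt (5 * 0\<^sup>2 + 0)"
    by (intro tendsto_intros inv tail2_tendsto_0[OF P2])
  then have "eventually (\<lambda>n. sqrt (5 * (1 / (real n + 1))\<^sup>2 + tail2 (real n) \<mu>) < r) sequentially"
    using r(1) by (intro order_tendstoD(2)) auto
  moreover have "eventually (\<lambda>n. 1 / (real n + 1) < e / 2) sequentially"
    using inv e by (intro order_tendstoD(2)) auto
  moreover obtain N0 :: nat where N0: "norm z \<le> real N0" using real_arch_simple by blast
  have "eventually (\<lambda>n. norm z \<le> real n) sequentially"
    unfolding eventually_sequentially using N0 by (intro exI[of _ N0]) (auto intro: order_trans)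
  ultimately have "eventually (\<lambda>n. norm (f n - W (z, \<mu>)) < e) sequentially"
  proof eventually_elim
    case (elim n)
    obtain \<nu> where nu: "\<nu> \<in> Mlam lam" "W2 \<mu> \<nu> < r" "norm (f n - W (z, \<nu>)) < e / 2"
      using f[of n] elim by force
    have "norm (W (z, \<nu>) - W (z, \<mu>)) < e / 2"
      using r(2)[OF nu(1,2)] by (simp add: dist_norm norm_minus_commute)
    then show ?case using nu(3) norm_diff_triangle_less[of "f n" "W (z, \<nu>)" "e / 2" "W (z, \<mu>)" "e / 2"] by simp
  qed
  then show "\<exists>no. \<forall>n\<ge>no. norm (f n - W (z, \<mu>)) < e" by (simp add: eventually_sequentially)
qed

theorem theorem2p1:
  fixes lam :: "real measure"
    and \<rho> :: "(real \<times> (real ^ 'd)) measure measure"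
    and V :: "(real \<times> (real ^ 'd)) \<times> (real \<times> (real ^ 'd)) measure \<Rightarrow> real ^ 'q"
    and \<epsilon> :: real
  assumes "prob_space lam" and "sets lam = sets label_space"
    and "prob_space \<rho>" and "sets \<rho> = sets (Mlam_borel lam)"
    and "continuous_map (prod_topology (top_of_set state_set) (W2_topology lam)) euclidean V"
    and "(\<integral>\<^sup>+ \<mu>. (\<integral>\<^sup>+ z. ennreal ((norm (V (z, \<mu>)))\<^sup>2) \<partial>\<mu>) \<partial>\<rho>) < \<infinity>"
    and "\<epsilon> > 0"
  shows "\<exists>(J::nat) (r::nat) (\<phi> :: nat \<Rightarrow> real \<times> (real ^ 'd) \<Rightarrow> real)
            (T :: nat \<Rightarrow> real \<times> (real ^ 'd) \<Rightarrow> real) (B :: nat \<Rightarrow> real Matrix.vec \<Rightarrow> real ^ 'q).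
      J \<ge> 1 \<and> r \<ge> 1 \<and>
      (\<forall>j<J. continuous_on state_set (\<phi> j) \<and> (\<forall>\<mu>\<in>Mlam lam. integrable \<mu> (\<phi> j))) \<and>
      (\<forall>k<r. trunk_net (T k) \<and> branch_net J (B k)) \<and>
      (\<integral>\<^sup>+ \<mu>. (\<integral>\<^sup>+ z. ennreal ((norm (V (z, \<mu>)
          - (\<Sum>k<r. T k z *\<^sub>R B k (moment_vec J \<phi> \<mu>))))\<^sup>2) \<partial>\<mu>) \<partial>\<rho>) \<le> ennreal \<epsilon>"
proof -
  note lam = assms(1,2) and rho = assms(3,4) and V = assms(5) and e = assms(7)
  let ?M = "state_space \<Otimes>\<^sub>M Mlam_borel lam :: ((real \<times> (real ^ 'd)) \<times> (real \<times> (real ^ 'd)) measure) measure"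
  let ?Q = "joint_law lam \<rho>"
  note nnQ = nn_integral_joint_law[OF rho] and congQ = measurable_cong_sets[OF sets_joint_law[OF rho] refl]
  have spaceQ: "space ?Q = state_set \<times> Mlam lam"
    using sets_eq_imp_space_eq[OF sets_joint_law[OF rho]] by (simp add: space_pair_measure)
  interpret Q: prob_space ?Q by (rule prob_space_joint_law[OF rho])
  note V_m = caratheodory_measurable[OF V]
  define clipped where "clipped n q = clip (real (Suc n)) (V q)" for n q
  have clipped_cont: "continuous_map (prod_topology (top_of_set state_set) (W2_topology lam)) euclidean (clipped n)" for n
  proof -
    have "continuous_map euclidean euclidean (clip (real (Suc n)) :: real ^ 'q \<Rightarrow> _)"
      using continuous_clip[of "real (Suc n)"] by simp
    from continuous_map_compose[OF V this] show ?thesis by (simp add: o_def clipped_def[abs_def])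
  qed
  note clipped_m = caratheodory_measurable[OF clipped_cont]
  have sq_m: "(\<lambda>q. ennreal ((norm (f q - g q))\<^sup>2)) \<in> borel_measurable ?M"
    if [measurable]: "f \<in> borel_measurable ?M" "g \<in> borel_measurable ?M" for f g :: "_ \<Rightarrow> real ^ 'q"
    by measurable
  have "(\<lambda>n. \<integral>\<^sup>+ q. ennreal ((norm (V q - clipped n q))\<^sup>2) \<partial>?Q) \<longlonglongrightarrow> (\<integral>\<^sup>+ q. 0 \<partial>?Q)"
  proof (rule nn_integral_dominated_convergence[where w = "\<lambda>q. ennreal ((norm (V q))\<^sup>2)"])
    show "(\<lambda>q. ennreal ((norm (V q - clipped n q))\<^sup>2)) \<in> borel_measurable ?Q" for n
      unfolding congQ by (rule sq_m[OF V_m clipped_m])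
    have V2_m: "(\<lambda>q. ennreal ((norm (V q))\<^sup>2)) \<in> borel_measurable ?M"
      using sq_m[OF V_m, of "\<lambda>_. 0"] by simp
    then show "(\<lambda>q. ennreal ((norm (V q))\<^sup>2)) \<in> borel_measurable ?Q" unfolding congQ .
    show "(\<integral>\<^sup>+ q. ennreal ((norm (V q))\<^sup>2) \<partial>?Q) < \<infinity>" unfolding nnQ[OF V2_m] by (rule assms(6))
    show "AE q in ?Q. ennreal ((norm (V q - clipped n q))\<^sup>2) \<le> ennreal ((norm (V q))\<^sup>2)" for n
      unfolding clipped_def by (intro AE_I2 ennreal_leI power_mono norm_diff_clip) auto
    show "AE q in ?Q. (\<lambda>n. ennreal ((norm (V q - clipped n q))\<^sup>2)) \<longlonglongrightarrow> 0"
    proof (intro AE_I2 tendsto_eventually)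
      fix q
      obtain N :: nat where N: "norm (V q) \<le> real N" using real_arch_simple by blast
      have "clipped n q = V q" if "n \<ge> N" for n
        unfolding clipped_def using N that by (intro clip_id) auto
      then show "\<forall>\<^sub>F n in sequentially. ennreal ((norm (V q - clipped n q))\<^sup>2) = 0"
        unfolding eventually_sequentially by (intro exI[of _ N]) auto
    qed
  qed simp_all
  then have "(\<lambda>n. \<integral>\<^sup>+ q. ennreal ((norm (V q - clipped n q))\<^sup>2) \<partial>?Q) \<longlonglongrightarrow> 0" by simp
  moreover have e4: "(0 :: ennreal) < ennreal (\<epsilon> / 4)" using e by simp
  ultimately have "eventually (\<lambda>n. (\<integral>\<^sup>+ q. ennreal ((norm (V q - clipped n q))\<^sup>2) \<partial>?Q) < ennreal (\<epsilon> / 4)) sequentially"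
    by (rule order_tendstoD(2))
  then obtain k where k: "(\<integral>\<^sup>+ q. ennreal ((norm (V q - clipped k q))\<^sup>2) \<partial>?Q) < ennreal (\<epsilon> / 4)"
    by (auto simp: eventually_sequentially)
  define W where "W = clipped k"
  define R where "R = real (Suc k)"
  have W_bound: "norm (W q) \<le> R" for q unfolding W_def clipped_def R_def by (rule norm_clip) simp
  note W_cont = clipped_cont[of k, folded W_def] and W_m = clipped_m[of k, folded W_def]
  have "\<forall>n. \<exists>A. case A of (J, \<phi>, F) \<Rightarrow> J \<ge> 1 \<and>
      (\<forall>j<J. continuous_on UNIV (\<phi> j) \<and> (\<forall>z. 0 \<le> \<phi> j z \<and> \<phi> j z \<le> 1)) \<and> net_sum J F \<and>
    (\<forall>z\<in>state_set. \<forall>\<mu>\<in>Mlam lam. \<exists>z'\<in>state_set. \<exists>\<nu>\<in>Mlam lam. (norm z \<le> real n \<longrightarrow> z' = z) \<and>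
       W2 \<mu> \<nu> \<le> sqrt (5 * (1 / (real n + 1))\<^sup>2 + tail2 (real n) \<mu>) \<and>
       norm (F z (moment_seq J \<phi> \<mu>) - W (z', \<nu>)) \<le> 1 / (real n + 1))"
    using moment_net_approx[OF lam W_cont] by (simp add: split_paired_Ex)
  from choice[OF this] obtain A where A: "\<And>n. case A n of (J, \<phi>, F) \<Rightarrow> J \<ge> 1 \<and>
      (\<forall>j<J. continuous_on UNIV (\<phi> j) \<and> (\<forall>z. 0 \<le> \<phi> j z \<and> \<phi> j z \<le> 1)) \<and> net_sum J F \<and>
    (\<forall>z\<in>state_set. \<forall>\<mu>\<in>Mlam lam. \<exists>z'\<in>state_set. \<exists>\<nu>\<in>Mlam lam. (norm z \<le> real n \<longrightarrow> z' = z) \<and>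
       W2 \<mu> \<nu> \<le> sqrt (5 * (1 / (real n + 1))\<^sup>2 + tail2 (real n) \<mu>) \<and>
       norm (F z (moment_seq J \<phi> \<mu>) - W (z', \<nu>)) \<le> 1 / (real n + 1))"
    by blast
  define J where "J n = fst (A n)" for n
  define \<phi> where "\<phi> n = fst (snd (A n))" for n
  define F where "F n = snd (snd (A n))" for n
  have J: "J n \<ge> 1" and \<phi>_cont: "\<And>j. j < J n \<Longrightarrow> continuous_on UNIV (\<phi> n j)"
    and \<phi>_bound: "\<And>j z. j < J n \<Longrightarrow> 0 \<le> \<phi> n j z \<and> \<phi> n j z \<le> 1" and F: "net_sum (J n) (F n)"
    and approx: "\<And>z \<mu>. z \<in> state_set \<Longrightarrow> \<mu> \<in> Mlam lam \<Longrightarrow> \<exists>z'\<in>state_set. \<exists>\<nu>\<in>Mlam lam. (norm z \<le> real n \<longrightarrow> z' = z) \<and>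
       W2 \<mu> \<nu> \<le> sqrt (5 * (1 / (real n + 1))\<^sup>2 + tail2 (real n) \<mu>) \<and>
       norm (F n z (moment_seq (J n) (\<phi> n) \<mu>) - W (z', \<nu>)) \<le> 1 / (real n + 1)" for n
    using A[of n] unfolding J_def \<phi>_def F_def case_prod_beta by blast+
  \<comment> \<open>The networks are bounded by \<open>R + 1\<close> on the whole space, so the constant \<open>(2 * R + 1)\<^sup>2\<close> dominates.\<close>
  define f where "f n q = F n (fst q) (moment_seq (J n) (\<phi> n) (snd q))" for n q
  have f_m: "f n \<in> borel_measurable ?M" for n
    unfolding f_def by (rule net_value_measurable[OF F \<phi>_cont])
  have "(\<lambda>n. \<integral>\<^sup>+ q. ennreal ((norm (W q - f n q))\<^sup>2) \<partial>?Q) \<longlonglongrightarrow> (\<integral>\<^sup>+ q. 0 \<partial>?Q)"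
  proof (rule nn_integral_dominated_convergence[where w = "\<lambda>q. ennreal ((2 * R + 1)\<^sup>2)"])
    show "(\<lambda>q. ennreal ((norm (W q - f n q))\<^sup>2)) \<in> borel_measurable ?Q" for n
      unfolding congQ by (rule sq_m[OF W_m f_m])
    show "(\<integral>\<^sup>+ q. ennreal ((2 * R + 1)\<^sup>2) \<partial>?Q) < \<infinity>" by (simp add: Q.emeasure_space_1)
    show "AE q in ?Q. ennreal ((norm (W q - f n q))\<^sup>2) \<le> ennreal ((2 * R + 1)\<^sup>2)" for n
    proof (intro AE_I2 ennreal_leI power_mono)
      fix q assume "q \<in> space ?Q"
      then have "fst q \<in> state_set" "snd q \<in> Mlam lam" by (auto simp: spaceQ)
      from approx[OF this, of n] obtain z' \<nu> where "norm (f n q - W (z', \<nu>)) \<le> 1 / (real n + 1)"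
        unfolding f_def by blast
      also have "\<dots> \<le> 1" by simp
      finally have "norm (f n q) \<le> R + 1"
        using norm_triangle_sub[of "f n q" "W (z', \<nu>)"] W_bound[of "(z', \<nu>)"] by linarith
      then show "norm (W q - f n q) \<le> 2 * R + 1"
        using norm_triangle_ineq4[of "W q" "f n q"] W_bound[of q] by linarith
    qed simp
    show "AE q in ?Q. (\<lambda>n. ennreal ((norm (W q - f n q))\<^sup>2)) \<longlonglongrightarrow> 0"
    proof (rule AE_I2)
      fix q assume "q \<in> space ?Q"
      then have q: "fst q \<in> state_set" "snd q \<in> Mlam lam" by (auto simp: spaceQ)
      have "(\<lambda>n. f n q) \<longlonglongrightarrow> W (fst q, snd q)"
        by (rule net_approx_pointwise[OF W_cont q]) (unfold f_def, rule approx[OF q])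
      then have "(\<lambda>n. (norm (W q - f n q))\<^sup>2) \<longlonglongrightarrow> (norm (W q - W q))\<^sup>2"
        by (intro tendsto_intros) simp
      then show "(\<lambda>n. ennreal ((norm (W q - f n q))\<^sup>2)) \<longlonglongrightarrow> 0"
        using tendsto_ennrealI by fastforce
    qed
  qed simp_all
  then have "(\<lambda>n. \<integral>\<^sup>+ q. ennreal ((norm (W q - f n q))\<^sup>2) \<partial>?Q) \<longlonglongrightarrow> 0" by simp
  then have "eventually (\<lambda>n. (\<integral>\<^sup>+ q. ennreal ((norm (W q - f n q))\<^sup>2) \<partial>?Q) < ennreal (\<epsilon> / 4)) sequentially"
    using e4 by (rule order_tendstoD(2))
  then obtain n where n: "(\<integral>\<^sup>+ q. ennreal ((norm (W q - f n q))\<^sup>2) \<partial>?Q) < ennreal (\<epsilon> / 4)"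
    by (auto simp: eventually_sequentially)
  have VW_m: "(\<lambda>q. ennreal ((norm (V q - W q))\<^sup>2)) \<in> borel_measurable ?Q"
    and Wf_m: "(\<lambda>q. ennreal ((norm (W q - f n q))\<^sup>2)) \<in> borel_measurable ?Q"
    unfolding congQ by (rule sq_m[OF V_m W_m], rule sq_m[OF W_m f_m])
  have "(\<integral>\<^sup>+ q. ennreal ((norm (V q - f n q))\<^sup>2) \<partial>?Q)
      \<le> (\<integral>\<^sup>+ q. 2 * ennreal ((norm (V q - W q))\<^sup>2) + 2 * ennreal ((norm (W q - f n q))\<^sup>2) \<partial>?Q)"
  proof (rule nn_integral_mono)
    fix q
    have "norm (V q - f n q) \<le> norm (V q - W q) + norm (W q - f n q)"
      using norm_triangle_ineq[of "V q - W q" "W q - f n q"] by simp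
    then have "(norm (V q - f n q))\<^sup>2 \<le> (norm (V q - W q) + norm (W q - f n q))\<^sup>2" by (rule power_mono) simp
    also have "\<dots> \<le> 2 * (norm (V q - W q))\<^sup>2 + 2 * (norm (W q - f n q))\<^sup>2"
      using sum_squares_bound[of "norm (V q - W q)" "norm (W q - f n q)"] by (simp add: power2_sum)
    finally have "ennreal ((norm (V q - f n q))\<^sup>2) \<le> ennreal (2 * (norm (V q - W q))\<^sup>2 + 2 * (norm (W q - f n q))\<^sup>2)"
      by (rule ennreal_leI)
    then show "ennreal ((norm (V q - f n q))\<^sup>2) \<le> 2 * ennreal ((norm (V q - W q))\<^sup>2) + 2 * ennreal ((norm (W q - f n q))\<^sup>2)"
      by (simp add: ennreal_mult)
  qed
  also have "\<dots> = 2 * (\<integral>\<^sup>+ q. ennreal ((norm (V q - W q))\<^sup>2) \<partial>?Q) + 2 * (\<integral>\<^sup>+ q. ennreal ((norm (W q - f n q))\<^sup>2) \<partial>?Q)"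
    using VW_m Wf_m by (simp add: nn_integral_add nn_integral_cmult)
  also have "\<dots> \<le> 2 * ennreal (\<epsilon> / 4) + 2 * ennreal (\<epsilon> / 4)"
    using k[folded W_def] n by (intro add_mono mult_left_mono) auto
  also have "\<dots> = ennreal \<epsilon>"
  proof -
    have "2 * ennreal (\<epsilon> / 4) = ennreal (\<epsilon> / 2)"
      using ennreal_mult[of 2 "\<epsilon> / 4"] e by simp
    then have "2 * ennreal (\<epsilon> / 4) + 2 * ennreal (\<epsilon> / 4) = ennreal (\<epsilon> / 2 + \<epsilon> / 2)"
      using e by (simp only:) (subst ennreal_plus, auto)
    also have "\<epsilon> / 2 + \<epsilon> / 2 = \<epsilon>" by simp
    finally show ?thesis .
  qed
  finally have final: "(\<integral>\<^sup>+ q. ennreal ((norm (V q - f n q))\<^sup>2) \<partial>?Q) \<le> ennreal \<epsilon>" .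
  obtain r :: nat and T B where r: "1 \<le> r" "\<And>k. k < r \<Longrightarrow> trunk_net (T k) \<and> branch_net (J n) (B k)"
    "\<And>z y. F n z y = (\<Sum>k<r. T k z *\<^sub>R B k (Matrix.vec (J n) y))"
    using F[of n] unfolding net_sum_def by blast
  have vec_eq: "Matrix.vec (J n) (moment_seq (J n) (\<phi> n) \<mu>) = moment_vec (J n) (\<phi> n) \<mu>" for \<mu>
    unfolding moment_vec_def by (rule eq_vecI) (auto simp: moment_seq_def)
  have "(\<integral>\<^sup>+ \<mu>. (\<integral>\<^sup>+ z. ennreal ((norm (V (z, \<mu>)
          - (\<Sum>k<r. T k z *\<^sub>R B k (moment_vec (J n) (\<phi> n) \<mu>))))\<^sup>2) \<partial>\<mu>) \<partial>\<rho>) \<le> ennreal \<epsilon>"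
    using final unfolding nnQ[OF sq_m[OF V_m f_m]] unfolding f_def fst_conv snd_conv r(3) vec_eq .
  moreover have "integrable \<mu> (\<phi> n j)" if mu: "\<mu> \<in> Mlam lam" and j: "j < J n"
    for \<mu> :: "(real \<times> (real ^ 'd)) measure" and j
  proof -
    have P2: "\<mu> \<in> P2" using mu Mlam_subset_P2 by blast
    interpret prob_space \<mu> by (rule P2_D(3)[OF P2])
    show ?thesis
    proof (rule integrable_const_bound[where B = 1])
      show "AE z in \<mu>. norm (\<phi> n j z) \<le> 1" using \<phi>_bound[OF j] by (intro AE_I2) auto
      show "\<phi> n j \<in> borel_measurable \<mu>"
        unfolding measurable_cong_sets[OF P2_D(1)[OF P2] refl]
        by (rule measurable_compose[OF measurable_ident_state_space borel_measurable_continuous_onI[OF \<phi>_cont[OF j]]])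
    qed
  qed
  moreover have "continuous_on state_set (\<phi> n j)" if "j < J n" for j
    using continuous_on_subset[OF \<phi>_cont[OF that]] by blast
  ultimately show ?thesis
    using J[of n] r(1,2)
    by (intro exI[of _ "J n"] exI[of _ r] exI[of _ "\<phi> n"] exI[of _ T] exI[of _ B]) auto
qed

end
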